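(* Let $R$ be a non-local finite commutative ring with unity. Then the crosscap of the upper ideal relation graph $\Gamma_U(R)$ is $1$ if and only if $R$ is isomorphic to one of the following $5$ rings: $\mathbb{Z}_2 \times \mathbb{Z}_5$, $\mathbb{Z}_3 \times \mathbb{Z}_5$, $\mathbb{F}_4 \times \mathbb{Z}_5$, $\mathbb{Z}_3 \times \mathbb{Z}_4$, $\mathbb{Z}_3 \times \frac{\mathbb{Z}_2[x]}{(x^2)}$.
   Context: Rings have a unity. A ring is local if it has a unique maximal ideal; a non-local finite commutative ring is (up to isomorphism) a direct product $R_1\times\cdots\times R_n$ of finite commutative local rings with $n\ge 2$. For $x\in R$, $(x)$ is the ideal generated by $x$. The upper ideal relation graph $\Gamma_U(R)$ is the simple undirected graph whose vertex set is the set of all non-unit elements of $R$ (including $0$), where two distinct vertices $x,y$ are adjacent if and only if there exists a non-unit $z\in R$ with $(x)\subseteq (z)$ and $(y)\subseteq (z)$. $\mathbb{F}_q$ denotes the field with $q$ elements. Let $\mathbb{N}_k$ be the non-orientable surface formed by the connected sum of $k$ projective planes. The crosscap of a graph is the minimum non-negative integer $k$ such that the graph can be embedded (drawn without edge crossings) in $\mathbb{N}_k$; planar graphs have crosscap $0$. *)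

theory Defs
  imports
    "HOL-Analysis.Analysis"
    "HOL-Library.Extended_Nat"
    "HOL-Number_Theory.Residues"
    "HOL-Algebra.Chinese_Remainder"
    "HOL-Algebra.Polynomial_Divisibility"
begin

section \<open>Rings\<close>

definition local_ring :: "('a, 'b) ring_scheme \<Rightarrow> bool" where
  "local_ring R \<longleftrightarrow> (\<exists>!M. maximalideal M R)"

definition Z2_X_mod_X_squared :: "int list set ring" where
  "Z2_X_mod_X_squared =
     (let P = poly_ring (residue_ring 2)
      in P Quot (Idl\<^bsub>P\<^esub> {X\<^bsub>residue_ring 2\<^esub> [^]\<^bsub>P\<^esub> (2::nat)}))"


section \<open>The upper ideal relation graph\<close>

text \<open>A simple graph is given by its vertex set and its set of edges, where an edge is a
  two-element set of vertices.\<close>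

definition nonunits :: "('a, 'b) ring_scheme \<Rightarrow> 'a set" where
  "nonunits R = carrier R - Units R"

definition upper_ideal_adj :: "('a, 'b) ring_scheme \<Rightarrow> 'a \<Rightarrow> 'a \<Rightarrow> bool" where
  "upper_ideal_adj R x y \<longleftrightarrow>
     x \<noteq> y \<and> (\<exists>z \<in> nonunits R. Idl\<^bsub>R\<^esub> {x} \<subseteq> Idl\<^bsub>R\<^esub> {z} \<and> Idl\<^bsub>R\<^esub> {y} \<subseteq> Idl\<^bsub>R\<^esub> {z})"

definition upper_ideal_relation_graph :: "('a, 'b) ring_scheme \<Rightarrow> 'a set \<times> 'a set set" where
  "upper_ideal_relation_graph R =
     (nonunits R, {{x, y} | x y. x \<in> nonunits R \<and> y \<in> nonunits R \<and> upper_ideal_adj R x y})"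


section \<open>Non-orientable surfaces\<close>

abbreviation two_sphere :: "(real^3) topology" where
  "two_sphere \<equiv> top_of_set (sphere 0 1)"

text \<open>The real projective plane: the quotient of the two-sphere by the antipodal map, a point
  being an antipodal pair.\<close>

definition antipodal_pair :: "real^3 \<Rightarrow> (real^3) set" where
  "antipodal_pair x = {x, - x}"

definition projective_plane :: "(real^3) set topology" where
  "projective_plane =
     topology (\<lambda>U. U \<subseteq> antipodal_pair ` sphere 0 1 \<and>
       openin two_sphere {x \<in> sphere 0 1. antipodal_pair x \<in> U})"

lemma openin_projective_plane:
  "openin projective_plane U \<longleftrightarrow>
     U \<subseteq> antipodal_pair ` sphere 0 1 \<and>
     openin two_sphere {x \<in> sphere 0 1. antipodal_pair x \<in> U}"
proof -
  have inter: "{x \<in> sphere 0 1. antipodal_pair x \<in> U \<inter> V} =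
      {x \<in> sphere 0 1. antipodal_pair x \<in> U} \<inter> {x \<in> sphere 0 1. antipodal_pair x \<in> V}" for U V
    by auto
  have union: "{x \<in> sphere 0 1. antipodal_pair x \<in> \<Union>\<K>} =
      (\<Union>K\<in>\<K>. {x \<in> sphere 0 1. antipodal_pair x \<in> K})" for \<K>
    by auto
  have "istopology (\<lambda>U. U \<subseteq> antipodal_pair ` sphere 0 1 \<and>
       openin two_sphere {x \<in> sphere 0 1. antipodal_pair x \<in> U})"
    unfolding istopology_def inter union by (auto intro!: openin_Int openin_Union)
  then show ?thesis
    by (simp add: projective_plane_def)
qed

lemma topspace_projective_plane: "topspace projective_plane = antipodal_pair ` sphere 0 1"
proof
  show "topspace projective_plane \<subseteq> antipodal_pair ` sphere 0 1"
    using openin_projective_plane by blast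
  have eq: "{x \<in> sphere (0::real^3) 1. antipodal_pair x \<in> antipodal_pair ` sphere 0 1} = sphere 0 1"
    by blast
  have "openin two_sphere (sphere 0 1)"
    using openin_subtopology_self by blast
  then have "openin projective_plane (antipodal_pair ` sphere 0 1)"
    by (simp only: openin_projective_plane eq simp_thms subset_refl)
  then show "antipodal_pair ` sphere 0 1 \<subseteq> topspace projective_plane"
    by (rule openin_subset)
qed

lemma quotient_map_antipodal_pair: "quotient_map two_sphere projective_plane antipodal_pair"
  by (auto simp: quotient_map_def topspace_projective_plane openin_projective_plane)

text \<open>\<open>S\<close> is a connected sum of the surfaces \<open>M\<close> and \<open>N\<close>: remove from both the interior of an
  embedded closed disc (images of \<open>f\<close> and \<open>g\<close>), and identify the two boundary circles. The map
  \<open>h\<close> from the disjoint union onto \<open>S\<close> is the identification map.\<close>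

definition is_connected_sum :: "'a topology \<Rightarrow> 'a topology \<Rightarrow> 'b topology \<Rightarrow> bool" where
  "is_connected_sum M N S \<longleftrightarrow>
     (\<exists>f g h.
        embedding_map (top_of_set (cball (0::real^2) 1)) M f \<and>
        embedding_map (top_of_set (cball (0::real^2) 1)) N g \<and>
        (let M' = subtopology M (topspace M - f ` ball 0 1);
             N' = subtopology N (topspace N - g ` ball 0 1)
         in quotient_map (sum_topology (\<lambda>i::bool. if i then M' else N') UNIV) S h \<and>
            inj_on (\<lambda>x. h (True, x)) (topspace M') \<and>
            inj_on (\<lambda>y. h (False, y)) (topspace N') \<and>
            (\<forall>x \<in> topspace M'. \<forall>y \<in> topspace N'.
               h (True, x) = h (False, y) \<longleftrightarrow> (\<exists>z \<in> sphere 0 1. x = f z \<and> y = g z))))"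

text \<open>\<open>nonorientable_surface k S\<close>: the space \<open>S\<close> is homeomorphic to the connected sum of \<open>k\<close>
  projective planes, the empty connected sum being the sphere. The carrier type is no
  restriction on the homeomorphism type: a closed surface has the cardinality of the continuum,
  so it has a homeomorphic copy on any type that is at least as large.\<close>

inductive nonorientable_surface :: "nat \<Rightarrow> (real^3) set topology \<Rightarrow> bool" where
  zero: "S homeomorphic_space two_sphere \<Longrightarrow> nonorientable_surface 0 S"
| one: "S homeomorphic_space projective_plane \<Longrightarrow> nonorientable_surface (Suc 0) S"
| sum: "\<lbrakk>nonorientable_surface (Suc k) Y; is_connected_sum Y projective_plane S\<rbrakk>
        \<Longrightarrow> nonorientable_surface (Suc (Suc k)) S"


section \<open>Drawings and the crosscap of a graph\<close>

text \<open>A drawing without crossings: vertices are distinct points, every edge is a simple arc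
  joining its endpoints and passing through no other vertex, and two different arcs meet at
  most in common endpoints. This is used for Hausdorff \<open>S\<close> only, where an injective path
  is an arc.\<close>

definition embeds_in :: "'v set \<times> 'v set set \<Rightarrow> 'a topology \<Rightarrow> bool" where
  "embeds_in G S \<longleftrightarrow>
     (\<exists>(\<phi> :: 'v \<Rightarrow> 'a) (\<gamma> :: 'v set \<Rightarrow> real \<Rightarrow> 'a).
        inj_on \<phi> (fst G) \<and> \<phi> ` fst G \<subseteq> topspace S \<and>
        (\<forall>e \<in> snd G. pathin S (\<gamma> e) \<and> inj_on (\<gamma> e) {0..1} \<and>
           {\<gamma> e 0, \<gamma> e 1} = \<phi> ` e \<and> \<gamma> e ` {0<..<1} \<inter> \<phi> ` fst G = {}) \<and>
        (\<forall>e \<in> snd G. \<forall>e' \<in> snd G. e \<noteq> e' \<longrightarrow> \<gamma> e ` {0<..<1} \<inter> \<gamma> e' ` {0<..<1} = {}))"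

text \<open>The minimum is taken in \<^typ>\<open>enat\<close>, so that it would be \<open>\<infinity>\<close> for a graph that embeds in
  none of these surfaces.\<close>

definition crosscap :: "'v set \<times> 'v set set \<Rightarrow> enat" where
  "crosscap G = (INF k \<in> {k. \<exists>S. nonorientable_surface k S \<and> embeds_in G S}. enat k)"

end

theory Submission
  imports Defs "HOL-Algebra.Sylow"
begin

text \<open>Only the values \<open>0\<close> and \<open>1\<close> of the crosscap matter: it is \<open>1\<close> iff the graph embeds in the
  projective plane but not in the sphere. A drawing of \<open>K\<^sub>5\<close> is excluded on the sphere by counting the
  windings of edges around vertices modulo 2. Given a drawing of \<open>K\<^sub>5\<close> on the projective plane, one lifts
  it to the sphere: for every vertex \<open>v\<close>, some triangle avoiding \<open>v\<close> must be one-sided, since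
  otherwise the lift would be a drawing of \<open>K\<^sub>5\<close> on the sphere in which only adjacent edges
  may meet. As two one-sided curves always meet, neither \<open>K\<^sub>7\<close> nor two copies of \<open>K\<^sub>5\<close> with
  at most one common vertex embed in the projective plane.

  Every proper principal ideal of \<open>R\<close> is a clique of the graph. A non-local ring splits as \<open>A \<times> B\<close>;
  the absence of \<open>K\<^sub>7\<close> bounds the sizes of the factors, and the few remaining rings are
  decided by explicit drawings with geodesic edges or by a pair of copies of \<open>K\<^sub>5\<close>.\<close>

section \<open>Drawings of the complete graph on five vertices\<close>

text \<open>Edges are arbitrary continuous arcs, possibly of positive area, so the obstruction has
  to work without face counts or transversal crossings. The count modulo 2 does: it only ever
  compares edges without a common vertex. This freedom is what makes the lift from the projective
  plane possible, where an edge may be replaced by a detour that runs into its neighbours. The free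
  choice of the omitted vertex \<open>v\<close> carries the rest. Once a one-sided triangle
  \<open>T\<close> is found, a second \<open>K\<^sub>5\<close> may reuse one vertex of
  \<open>T\<close>, provided its own triangle is made to avoid that vertex. Seven vertices leave
  four outside \<open>T\<close>, which is just enough. Six is indeed possible: the antipodal
  quotient of the icosahedron is a drawing of \<open>K\<^sub>6\<close>. On the algebraic side, 6 is
  therefore the largest admissible size of a proper principal ideal. Each of two factors then has at
  most six elements; three factors either have two elements each, which gives a planar graph, or
  contain two large ideals with a sufficient overlap. So only finitely many sizes remain.\<close>

lemma continuous_exp_constant:
  fixes D :: "'a::topological_space \<Rightarrow> complex"
  assumes "connected S" "continuous_on S D" "\<And>x. x \<in> S \<Longrightarrow> exp (D x) = c" "x \<in> S" "y \<in> S"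
  shows "D x = D y"
proof -
  have "D constant_on S"
  proof (rule continuous_discrete_range_constant[OF assms(1,2)])
    fix x assume x: "x \<in> S"
    show "\<exists>e>0. \<forall>y. y \<in> S \<and> D y \<noteq> D x \<longrightarrow> e \<le> norm (D y - D x)"
    proof (intro exI[of _ "2 * pi"] conjI allI impI)
      fix y assume y: "y \<in> S \<and> D y \<noteq> D x"
      then have "exp (D y) = exp (D x)" using x assms(3) by simp
      then obtain n :: int where n: "D y = D x + (of_int (2 * n) * pi) * \<i>"
        by (auto simp: exp_eq)
      then have "norm (D y - D x) = 2 * \<bar>real_of_int n\<bar> * pi"
        by (simp add: norm_mult)
      moreover have "\<bar>real_of_int n\<bar> \<ge> 1"
      proof -
        have "n \<noteq> 0" using n y by auto
        then show ?thesis by linarith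
      qed
      ultimately show "2 * pi \<le> norm (D y - D x)" by simp
    qed simp
  qed
  then show ?thesis using assms(4,5) by (auto simp: constant_on_def)
qed

text \<open>On an interval, continuous logarithms of two functions with constant ratio differ by a
  constant, so the change from 0 to 1 depends on the function alone. The factor \<open>c\<close>
  allows for reversed differences and for the antipodal relations between opposite sides of a
  square.\<close>

lemma logarithm_change_unique:
  fixes f g :: "real \<Rightarrow> complex"
  assumes "continuous_on {0..1} f" "continuous_on {0..1} g"
    and "\<And>t. t \<in> {0..1} \<Longrightarrow> exp (f t) = c * exp (g t)"
  shows "f 1 - f 0 = g 1 - g 0"
proof -
  have "(\<lambda>t. f t - g t) 1 = (\<lambda>t. f t - g t) 0"
    by (rule continuous_exp_constant[where S = "{0..1::real}" and c = c])
      (use assms in \<open>auto simp: exp_diff intro!: continuous_intros\<close>)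
  then show ?thesis by (simp add: algebra_simps)
qed

lemma logarithm_on_convex:
  fixes f :: "'a::real_normed_vector \<Rightarrow> complex"
  assumes "convex S" "continuous_on S f" "\<And>x. x \<in> S \<Longrightarrow> f x \<noteq> 0"
  obtains L where "continuous_on S L" "\<And>x. x \<in> S \<Longrightarrow> exp (L x) = f x"
  using continuous_logarithm_on_contractible[OF assms(2) convex_imp_contractible[OF assms(1)] assms(3)]
  by metis

text \<open>A discrete form of the van Kampen obstruction: the winding of the edge \<open>ij\<close> around the
  vertex \<open>k\<close> defines an integer \<open>n k i j\<close>; the difference map of two disjoint
  edges has a logarithm on the unit square, which shows that the four integers attached to the pair
  have odd sum exactly when the edges cross in the drawing with all vertices in convex
  position.  Each integer occurs for two pairs, but five pairs cross.\<close>

lemma no_almost_embedding_K5_plane: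
  fixes \<phi> :: "nat \<Rightarrow> complex" and p :: "nat \<Rightarrow> nat \<Rightarrow> real \<Rightarrow> complex"
  assumes path: "\<And>i j. i < j \<Longrightarrow> j < 5 \<Longrightarrow> path (p i j)"
    and ends: "\<And>i j. i < j \<Longrightarrow> j < 5 \<Longrightarrow> pathstart (p i j) = \<phi> i \<and> pathfinish (p i j) = \<phi> j"
    and disj: "\<And>i j k l. i < j \<Longrightarrow> j < 5 \<Longrightarrow> k < l \<Longrightarrow> l < 5 \<Longrightarrow> {i, j} \<inter> {k, l} = {} \<Longrightarrow>
      path_image (p i j) \<inter> path_image (p k l) = {}"
  shows False
proof -
  have dist: "p i j s \<noteq> p k l t"
    if "i < j" "j < 5" "k < l" "l < 5" "{i, j} \<inter> {k, l} = {}" "s \<in> {0..1}" "t \<in> {0..1}" for i j k l s t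
    using disj[OF that(1-5)] that(6,7) by (fastforce simp: path_image_def)
  have p0: "p i j 0 = \<phi> i" and p1: "p i j 1 = \<phi> j" if "i < j" "j < 5" for i j
    using ends[OF that] by (auto simp: pathstart_def pathfinish_def)
  \<comment> \<open>Only edges without a common vertex are assumed disjoint. With five vertices
    there is an edge from \<open>k\<close> to some \<open>l\<close> outside \<open>{i, j}\<close>,
    and it carries the point \<open>\<phi> k\<close>.\<close>
  have avoid: "p i j s \<noteq> \<phi> k" if "i < j" "j < 5" "k < 5" "k \<notin> {i, j}" "s \<in> {0..1}" for i j k s
  proof -
    have "\<exists>l<5. l \<noteq> k \<and> l \<noteq> i \<and> l \<noteq> j"
      by (rule ccontr) (use that in presburger)
    then obtain l where l: "l < 5" "l \<noteq> k" "l \<noteq> i" "l \<noteq> j" by blast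
    show ?thesis
    proof (cases "k < l")
      case True
      then show ?thesis using dist[of i j k l s 0] p0[of k l] that l by auto
    next
      case False
      then show ?thesis using dist[of i j l k s 1] p1[of l k] that l by auto
    qed
  qed
  have vdist: "\<phi> i \<noteq> \<phi> j" if "i < 5" "j < 5" "i \<noteq> j" for i j
  proof -
    have "\<exists>l<5. l \<noteq> i \<and> l \<noteq> j"
      by (rule ccontr) (use that in presburger)
    then obtain l where l: "l < 5" "l \<noteq> i" "l \<noteq> j" by blast
    show ?thesis
    proof (cases "i < l")
      case True
      then show ?thesis using avoid[of i l j 0] p0[of i l] that l by auto
    next
      case False
      then show ?thesis using avoid[of l i j 1] p1[of l i] that l by auto
    qed
  qed
  define I where "I k i j \<longleftrightarrow> i < j \<and> j < 5 \<and> k < 5 \<and> k \<notin> {i, j}" for i j k :: nat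
  have "\<exists>L. continuous_on {0..1} L \<and> (\<forall>t\<in>{0..1}. exp (L t) = p i j t - \<phi> k)" if "I k i j" for k i j
  proof -
    have "continuous_on {0..1} (\<lambda>t. p i j t - \<phi> k)"
      using path[of i j] that by (auto simp: path_def I_def intro!: continuous_intros)
    moreover have "p i j t - \<phi> k \<noteq> 0" if "t \<in> {0..1}" for t
      using avoid[of i j k t] that \<open>I k i j\<close> by (auto simp: I_def)
    ultimately obtain L where "continuous_on {0..1} L" "\<And>t. t \<in> {0..1} \<Longrightarrow> exp (L t) = p i j t - \<phi> k"
      using logarithm_on_convex[OF convex_real_interval(5), of 0 1 "\<lambda>t. p i j t - \<phi> k"] by blast
    then show ?thesis by blast
  qed
  then obtain L where L: "\<And>k i j. I k i j \<Longrightarrow> continuous_on {0..1} (L k i j)"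
    "\<And>k i j t. I k i j \<Longrightarrow> t \<in> {0..1} \<Longrightarrow> exp (L k i j t) = p i j t - \<phi> k"
    by metis
  \<comment> \<open>The branch is fixed by the order of the indices, so that \<open>l i j\<close>
    and \<open>l j i\<close> differ by exactly \<open>\<i> * pi\<close> with a known sign
    \<open>eps\<close>. This order plays the part of the reference drawing in convex
    position.\<close>
  define l where "l i j = (if i < j then Ln (\<phi> j - \<phi> i) else Ln (\<phi> i - \<phi> j) + \<i> * pi)" for i j
  have exp_l: "exp (l i j) = \<phi> j - \<phi> i" if "i < 5" "j < 5" "i \<noteq> j" for i j
    using vdist[of i j] that by (auto simp: l_def exp_add exp_Ln mult.commute)
  have "\<exists>n::int. L k i j 1 - L k i j 0 = l k j - l k i + 2 * pi * \<i> * of_int n" if "I k i j" for k i j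
  proof -
    have ij: "i < j" "j < 5" "k < 5" "k \<noteq> i" "k \<noteq> j" "i < 5"
      using that by (auto simp: I_def)
    have "exp (L k i j 1) = exp (l k j)" "exp (L k i j 0) = exp (l k i)"
      using L(2)[OF that, of 1] L(2)[OF that, of 0] ij exp_l p0 p1 by auto
    then have "exp (L k i j 1 - L k i j 0) = exp (l k j - l k i)"
      by (simp add: exp_diff)
    then show ?thesis by (fastforce simp: exp_eq algebra_simps)
  qed
  then obtain n :: "nat \<Rightarrow> nat \<Rightarrow> nat \<Rightarrow> int" where
    n: "\<And>k i j. I k i j \<Longrightarrow> L k i j 1 - L k i j 0 = l k j - l k i + 2 * pi * \<i> * of_int (n k i j)"
    by metis
  define eps :: "nat \<Rightarrow> nat \<Rightarrow> int" where "eps i j = (if i < j then - 1 else 1)" for i j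
  have eps: "l i j - l j i = \<i> * pi * of_int (eps i j)" if "i \<noteq> j" for i j
    using that by (auto simp: l_def eps_def)
  \<comment> \<open>The two boundary routes of the square from \<open>(0, 0)\<close> to
    \<open>(1, 1)\<close> give the same change of \<open>M\<close>. Each side shows one edge as seen
    from an end of the other; on the sides with constant \<open>s\<close> the difference is
    reversed, hence the factor -1 below. The \<open>eps\<close> sum is 2 or -2 if the two pairs
    interleave in the order of the indices, and 0 otherwise.\<close>
  have key: "2 * (n k i j + n j k m - n m i j - n i k m) + (eps k j + eps j m + eps m i + eps i k) = 0"
    if "i < j" "j < 5" "k < m" "m < 5" "{i, j} \<inter> {k, m} = {}" for i j k m
  proof -
    have I: "I k i j" "I m i j" "I i k m" "I j k m"
      using that by (auto simp: I_def)
    have "continuous_on ({0..1} \<times> {0..1}) (\<lambda>z. p i j (fst z) - p k m (snd z))"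
      using path[of i j] path[of k m] that
      by (auto simp: path_def intro!: continuous_intros
          intro: continuous_on_compose2[of "{0..1}" "p i j"] continuous_on_compose2[of "{0..1}" "p k m"])
    moreover have "convex ({0..1::real} \<times> {0..1::real})"
      by (intro convex_Times) auto
    moreover have "p i j (fst z) - p k m (snd z) \<noteq> 0" if "z \<in> {0..1} \<times> {0..1}" for z
      using dist[OF \<open>i < j\<close> \<open>j < 5\<close> \<open>k < m\<close> \<open>m < 5\<close> \<open>{i, j} \<inter> {k, m} = {}\<close>] that by auto
    ultimately obtain M where M: "continuous_on ({0..1} \<times> {0..1}) M"
      "\<And>z. z \<in> {0..1} \<times> {0..1} \<Longrightarrow> exp (M z) = p i j (fst z) - p k m (snd z)"
      using logarithm_on_convex[of "{0..1} \<times> {0..1}" "\<lambda>z. p i j (fst z) - p k m (snd z)"] by blast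
    have Mc1: "continuous_on {0..1} (\<lambda>s. M (s, t))" if "t \<in> {0..1}" for t
      by (rule continuous_on_compose2[OF M(1)]) (use that in \<open>auto intro!: continuous_intros\<close>)
    have Mc2: "continuous_on {0..1} (\<lambda>t. M (s, t))" if "s \<in> {0..1}" for s
      by (rule continuous_on_compose2[OF M(1)]) (use that in \<open>auto intro!: continuous_intros\<close>)
    have m1: "M (1, 0) - M (0, 0) = L k i j 1 - L k i j 0"
      by (rule logarithm_change_unique[where c = 1]) (use Mc1 L[OF I(1)] M(2) p0[of k m] that in auto)
    have m2: "M (1, 1) - M (0, 1) = L m i j 1 - L m i j 0"
      by (rule logarithm_change_unique[where c = 1]) (use Mc1 L[OF I(2)] M(2) p1[of k m] that in auto)
    have m3: "M (0, 1) - M (0, 0) = L i k m 1 - L i k m 0"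
      by (rule logarithm_change_unique[where c = "-1"]) (use Mc2 L[OF I(3)] M(2) p0[of i j] that in auto)
    have m4: "M (1, 1) - M (1, 0) = L j k m 1 - L j k m 0"
      by (rule logarithm_change_unique[where c = "-1"]) (use Mc2 L[OF I(4)] M(2) p1[of i j] that in auto)
    have "(M (1, 0) - M (0, 0)) + (M (1, 1) - M (1, 0)) = (M (1, 1) - M (0, 1)) + (M (0, 1) - M (0, 0))"
      by simp
    then have "(l k j - l k i + 2 * pi * \<i> * of_int (n k i j)) + (l j m - l j k + 2 * pi * \<i> * of_int (n j k m))
       = (l m j - l m i + 2 * pi * \<i> * of_int (n m i j)) + (l i m - l i k + 2 * pi * \<i> * of_int (n i k m))"
      unfolding m1 m2 m3 m4 n[OF I(1)] n[OF I(2)] n[OF I(3)] n[OF I(4)] .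
    then have "(l k j - l j k) + (l j m - l m j) + (l m i - l i m) + (l i k - l k i)
      + 2 * pi * \<i> * (of_int (n k i j) + of_int (n j k m) - of_int (n m i j) - of_int (n i k m)) = 0"
      by (simp add: algebra_simps)
    moreover have "l k j - l j k = \<i> * pi * of_int (eps k j)" "l j m - l m j = \<i> * pi * of_int (eps j m)"
      "l m i - l i m = \<i> * pi * of_int (eps m i)" "l i k - l k i = \<i> * pi * of_int (eps i k)"
      using that by (auto intro!: eps)
    ultimately have "\<i> * pi * of_int (2 * (n k i j + n j k m - n m i j - n i k m)
       + (eps k j + eps j m + eps m i + eps i k)) = 0"
      by (simp add: algebra_simps)
    then have "of_int (2 * (n k i j + n j k m - n m i j - n i k m)
       + (eps k j + eps j m + eps m i + eps i k)) = (0 :: complex)"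
      using pi_neq_zero by (metis complex_i_not_zero mult_eq_0_iff of_real_eq_0_iff)
    then show ?thesis by (simp only: of_int_eq_0_iff)
  qed
  have e1: "n 2 0 1 + n 1 2 3 - n 3 0 1 - n 0 2 3 = 0" using key[of 0 1 2 3] by (simp add: eps_def)
  have e2: "n 2 0 1 + n 1 2 4 - n 4 0 1 - n 0 2 4 = 0" using key[of 0 1 2 4] by (simp add: eps_def)
  have e3: "n 3 0 1 + n 1 3 4 - n 4 0 1 - n 0 3 4 = 0" using key[of 0 1 3 4] by (simp add: eps_def)
  have e4: "n 1 0 2 + n 2 1 3 - n 3 0 2 - n 0 1 3 = 1" using key[of 0 2 1 3] by (simp add: eps_def)
  have e5: "n 1 0 2 + n 2 1 4 - n 4 0 2 - n 0 1 4 = 1" using key[of 0 2 1 4] by (simp add: eps_def)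
  have e6: "n 3 0 2 + n 2 3 4 - n 4 0 2 - n 0 3 4 = 0" using key[of 0 2 3 4] by (simp add: eps_def)
  have e7: "n 1 0 3 + n 3 1 2 - n 2 0 3 - n 0 1 2 = 0" using key[of 0 3 1 2] by (simp add: eps_def)
  have e8: "n 1 0 3 + n 3 1 4 - n 4 0 3 - n 0 1 4 = 1" using key[of 0 3 1 4] by (simp add: eps_def)
  have e9: "n 2 0 3 + n 3 2 4 - n 4 0 3 - n 0 2 4 = 1" using key[of 0 3 2 4] by (simp add: eps_def)
  have e10: "n 1 0 4 + n 4 1 2 - n 2 0 4 - n 0 1 2 = 0" using key[of 0 4 1 2] by (simp add: eps_def)
  have e11: "n 1 0 4 + n 4 1 3 - n 3 0 4 - n 0 1 3 = 0" using key[of 0 4 1 3] by (simp add: eps_def)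
  have e12: "n 2 0 4 + n 4 2 3 - n 3 0 4 - n 0 2 3 = 0" using key[of 0 4 2 3] by (simp add: eps_def)
  have e13: "n 3 1 2 + n 2 3 4 - n 4 1 2 - n 1 3 4 = 0" using key[of 1 2 3 4] by (simp add: eps_def)
  have e14: "n 2 1 3 + n 3 2 4 - n 4 1 3 - n 1 2 4 = 1" using key[of 1 3 2 4] by (simp add: eps_def)
  have e15: "n 2 1 4 + n 4 2 3 - n 3 1 4 - n 1 2 3 = 0" using key[of 1 4 2 3] by (simp add: eps_def)
  have "(n 2 0 1 + n 1 2 3 - n 3 0 1 - n 0 2 3)
    + (n 2 0 1 + n 1 2 4 - n 4 0 1 - n 0 2 4)
    + (n 3 0 1 + n 1 3 4 - n 4 0 1 - n 0 3 4)
    + (n 1 0 2 + n 2 1 3 - n 3 0 2 - n 0 1 3)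
    + (n 1 0 2 + n 2 1 4 - n 4 0 2 - n 0 1 4)
    + (n 3 0 2 + n 2 3 4 - n 4 0 2 - n 0 3 4)
    + (n 1 0 3 + n 3 1 2 - n 2 0 3 - n 0 1 2)
    + (n 1 0 3 + n 3 1 4 - n 4 0 3 - n 0 1 4)
    + (n 2 0 3 + n 3 2 4 - n 4 0 3 - n 0 2 4)
    + (n 1 0 4 + n 4 1 2 - n 2 0 4 - n 0 1 2)
    + (n 1 0 4 + n 4 1 3 - n 3 0 4 - n 0 1 3)
    + (n 2 0 4 + n 4 2 3 - n 3 0 4 - n 0 2 3)
    + (n 3 1 2 + n 2 3 4 - n 4 1 2 - n 1 3 4)
    + (n 2 1 3 + n 3 2 4 - n 4 1 3 - n 1 2 4)
    + (n 2 1 4 + n 4 2 3 - n 3 1 4 - n 1 2 3)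
    = 2 * (n 2 0 1 + n 1 0 2 + n 2 1 3 + n 2 1 4 + n 2 3 4 + n 1 0 3 + n 3 1 2 + n 3 2 4 + n 1 0 4 + n 4 2 3 - n 0 2 3 - n 4 0 1 - n 0 2 4 - n 0 3 4 - n 0 1 3 - n 4 0 2 - n 0 1 4 - n 0 1 2 - n 4 0 3 - n 3 0 4)" by (simp add: algebra_simps)
  then have "2 * (n 2 0 1 + n 1 0 2 + n 2 1 3 + n 2 1 4 + n 2 3 4 + n 1 0 3 + n 3 1 2 + n 3 2 4 + n 1 0 4 + n 4 2 3 - n 0 2 3 - n 4 0 1 - n 0 2 4 - n 0 3 4 - n 0 1 3 - n 4 0 2 - n 0 1 4 - n 0 1 2 - n 4 0 3 - n 3 0 4) = 5"
    by (simp only: e1 e2 e3 e4 e5 e6 e7 e8 e9 e10 e11 e12 e13 e14 e15)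
  moreover have "2 * x \<noteq> 5" for x :: int by presburger
  ultimately show False by blast
qed

section \<open>Stereographic projection\<close>

lemma norm_sphere3: "x \<in> sphere (0::real^3) 1 \<longleftrightarrow> (x$1)\<^sup>2 + (x$2)\<^sup>2 + (x$3)\<^sup>2 = 1"
  by (simp add: norm_vec_def L2_set_def sum_3)

definition stereographic :: "real^3 \<Rightarrow> complex" where
  "stereographic x = Complex (x$1 / (1 - x$3)) (x$2 / (1 - x$3))"

lemma north_pole_iff:
  assumes "x \<in> sphere (0::real^3) 1"
  shows "x$3 = 1 \<longleftrightarrow> x = axis 3 1"
proof
  assume "x$3 = 1"
  then have "(x$1)\<^sup>2 + (x$2)\<^sup>2 = 0" using assms norm_sphere3[of x] by simp
  then have "x$1 = 0" "x$2 = 0" by (simp_all add: sum_power2_eq_zero_iff)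
  then show "x = axis 3 1"
    using \<open>x$3 = 1\<close> by (simp add: vec_eq_iff forall_3 axis_def)
qed (simp add: axis_def)

text \<open>The modulus alone determines the height. This gives injectivity, and the size of the
  image of an antipode.\<close>

lemma stereographic_height:
  assumes "x \<in> sphere (0::real^3) 1" "x$3 \<noteq> 1"
  shows "(cmod (stereographic x))\<^sup>2 = (1 + x$3) / (1 - x$3)"
proof -
  have "(x$1)\<^sup>2 + (x$2)\<^sup>2 = (1 + x$3) * (1 - x$3)"
    using assms norm_sphere3[of x] by (simp add: algebra_simps power2_eq_square)
  then show ?thesis
    using assms(2)
    by (simp add: stereographic_def cmod_power2 power_divide add_divide_distrib[symmetric])
       (simp add: power2_eq_square)
qed

lemma inj_on_stereographic: "inj_on stereographic (sphere 0 1 - {axis 3 1})"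
proof (rule inj_onI)
  fix x y assume xy: "x \<in> sphere 0 1 - {axis 3 1}" "y \<in> sphere 0 1 - {axis 3 1}"
    and eq: "stereographic x = stereographic y"
  then have 3: "x$3 \<noteq> 1" "y$3 \<noteq> 1" using north_pole_iff by auto
  then have "(1 + x$3) / (1 - x$3) = (1 + y$3) / (1 - y$3)"
    using stereographic_height[of x] stereographic_height[of y] xy eq by auto
  then have z: "x$3 = y$3" using 3 by (simp add: field_simps)
  then have "x$1 = y$1" "x$2 = y$2" using eq 3 by (auto simp: stereographic_def)
  then show "x = y" using z by (simp add: vec_eq_iff forall_3)
qed

lemma continuous_on_stereographic: "continuous_on (sphere 0 1 - {axis 3 1}) stereographic"
proof -
  have "1 - x$3 \<noteq> 0" if "x \<in> sphere 0 1 - {axis 3 1}" for x :: "real^3"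
    using north_pole_iff that by auto
  then show ?thesis
    unfolding stereographic_def Complex_eq
    by (intro continuous_intros) auto
qed

text \<open>The images of antipodes lie on opposite rays from 0, the ratio being \<open>- c\<close>;
  by the height formula \<open>c\<close> is the inverse square of the modulus, so the moduli are
  inverse to each other.\<close>

lemma stereographic_antipode:
  assumes "x \<in> sphere (0::real^3) 1 - {axis 3 1, - axis 3 1}"
  shows "stereographic x \<noteq> 0" "stereographic (- x) = - 1 / cnj (stereographic x)"
proof -
  have "x$3 \<noteq> 1" "(- x)$3 \<noteq> 1"
    using north_pole_iff[of x] north_pole_iff[of "- x"] assms by (auto simp: equation_minus_iff[of _ "axis 3 1"])
  then have nz: "1 - x$3 \<noteq> 0" "1 + x$3 \<noteq> 0" by auto
  moreover have sq: "(cmod (stereographic x))\<^sup>2 = (1 + x$3) / (1 - x$3)"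
    using stereographic_height assms nz by simp
  ultimately show nz0: "stereographic x \<noteq> 0" by auto
  define c where "c = (1 - x$3) / (1 + x$3)"
  have c: "c * ((1 + x$3) / (1 - x$3)) = 1" using nz by (simp add: c_def)
  have m: "stereographic (- x) = - (of_real c * stereographic x)"
    using nz by (simp add: stereographic_def complex_eq_iff c_def)
  have "stereographic (- x) * cnj (stereographic x) = - of_real c * (stereographic x * cnj (stereographic x))"
    unfolding m by simp
  also have "\<dots> = - of_real (c * (cmod (stereographic x))\<^sup>2)"
    by (simp add: complex_norm_square[symmetric])
  also have "\<dots> = -1" unfolding sq c by simp
  finally show "stereographic (- x) = - 1 / cnj (stereographic x)"
    using nz0 by (simp add: field_simps)
qed

text \<open>An orthogonal map moves \<open>p\<close> to the north pole. Being linear, it commutes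
  with the antipodal map, so the formula for antipodes survives.\<close>

lemma stereographic_projection_exists:
  fixes p :: "real^3"
  assumes "p \<in> sphere 0 1"
  obtains S :: "real^3 \<Rightarrow> complex" where "continuous_on (sphere 0 1 - {p}) S" "inj_on S (sphere 0 1 - {p})"
    "\<And>x. x \<in> sphere 0 1 - {p, - p} \<Longrightarrow> S x \<noteq> 0"
    "\<And>x. x \<in> sphere 0 1 - {p, - p} \<Longrightarrow> S (- x) = - 1 / cnj (S x)"
proof -
  obtain f :: "real^3 \<Rightarrow> real^3" where f: "orthogonal_transformation f" "f p = axis 3 1"
  proof (rule orthogonal_transformation_exists_1)
    show "norm p = 1" "norm (axis 3 1 :: real^3) = 1" using assms by (simp_all add: norm_axis_1)
  qed
  have lin: "linear f" using f by (simp add: orthogonal_transformation_linear)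
  have inj: "f x = f y \<longleftrightarrow> x = y" for x y
    using orthogonal_transformation_inj[OF f(1)] by (auto simp: inj_def)
  have neg: "f (- x) = - f x" for x
    using linear_neg[OF lin] .
  have norm: "norm (f x) = norm x" for x
    using f by (simp add: orthogonal_transformation)
  have np: "f x = axis 3 1 \<longleftrightarrow> x = p" "f x = - axis 3 1 \<longleftrightarrow> x = - p" for x
    using inj[of x p] inj[of x "- p"] by (simp_all add: f(2) neg)
  have cont: "continuous_on A f" for A
    using lin by (simp add: linear_continuous_on linear_conv_bounded_linear)
  show thesis
  proof
    show "continuous_on (sphere 0 1 - {p}) (stereographic \<circ> f)"
      by (intro continuous_on_compose cont continuous_on_subset[OF continuous_on_stereographic])
         (auto simp: norm np)
    show "inj_on (stereographic \<circ> f) (sphere 0 1 - {p})"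
    proof (rule comp_inj_on)
      show "inj_on f (sphere 0 1 - {p})" by (simp add: inj_on_def inj)
      have "f ` (sphere 0 1 - {p}) \<subseteq> sphere 0 1 - {axis 3 1}" by (auto simp: norm np)
      then show "inj_on stereographic (f ` (sphere 0 1 - {p}))"
        by (rule inj_on_subset[OF inj_on_stereographic])
    qed
  next
    fix x assume "x \<in> sphere 0 1 - {p, - p}"
    then have "f x \<in> sphere 0 1 - {axis 3 1, - axis 3 1}"
      by (auto simp: norm np)
    from stereographic_antipode[OF this]
    show "(stereographic \<circ> f) x \<noteq> 0" "(stereographic \<circ> f) (- x) = - 1 / cnj ((stereographic \<circ> f) x)"
      by (auto simp: neg)
  qed
qed

section \<open>Points of the sphere off finitely many arcs\<close>

text \<open>An arc may have positive area, so measure does not help. Instead, in a planar chart each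
  arc is closed, and it has empty interior because an open planar set cannot be mapped continuously
  and injectively into the line. Finite unions of such sets keep both properties.\<close>

lemma finite_arcs_proper_subset_sphere:
  fixes \<A> :: "(real \<Rightarrow> real^3) set"
  assumes "finite \<A>" "\<And>g. g \<in> \<A> \<Longrightarrow> arc g"
  shows "\<exists>p\<in>sphere 0 1. p \<notin> (\<Union>g\<in>\<A>. path_image g)"
proof -
  \<comment> \<open>Chart by central projection: the plane at height 1 is mapped radially onto the
    open upper hemisphere, so the whole plane serves as domain.\<close>
  define v :: "complex \<Rightarrow> real^3" where
    "v z = Re z *\<^sub>R axis 1 1 + Im z *\<^sub>R axis 2 1 + axis 3 1" for z
  define h where "h z = (1 / norm (v z)) *\<^sub>R v z" for z
  have v: "v z $ 1 = Re z" "v z $ 2 = Im z" "v z $ 3 = 1" for z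
    by (simp_all add: v_def axis_def)
  have nz: "norm (v z) > 0" for z
  proof -
    have "v z \<noteq> 0"
      using v(3)[of z] by auto
    then show ?thesis by simp
  qed
  have hs: "h z \<in> sphere 0 1" for z
    using nz[of z] by (simp add: h_def)
  have hc: "continuous_on UNIV h"
    unfolding h_def using nz unfolding v_def
    by (intro continuous_intros) (auto simp: less_imp_neq[symmetric])
  have hi: "inj h"
  proof (rule injI)
    fix z w assume eq: "h z = h w"
    have c: "h z $ 1 = Re z / norm (v z)" "h z $ 2 = Im z / norm (v z)" "h z $ 3 = 1 / norm (v z)" for z
      by (simp_all add: h_def v)
    have "norm (v z) = norm (v w)" using c(3)[of z] c(3)[of w] eq by simp
    then show "z = w" using c(1,2)[of z] c(1,2)[of w] eq nz[of w] by (simp add: complex_eq_iff)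
  qed
  have one: "interior (h -` path_image g) = {}" "closed (h -` path_image g)" if g: "arc g" for g
  proof -
    obtain k where k: "homeomorphism {0..1} (path_image g) g k"
      using homeomorphism_arc[OF g] .
    show "interior (h -` path_image g) = {}"
    proof (rule ccontr)
      assume ne: "interior (h -` path_image g) \<noteq> {}"
      have sub: "h ` interior (h -` path_image g) \<subseteq> path_image g"
        using interior_subset[of "h -` path_image g"] by blast
      have "DIM(complex) \<le> DIM(real)"
      proof (rule invariance_of_dimension)
        show "continuous_on (interior (h -` path_image g)) (k \<circ> h)"
          using hc k sub by (intro continuous_on_compose) (auto simp: homeomorphism_def intro: continuous_on_subset)
        show "inj_on (k \<circ> h) (interior (h -` path_image g))"
        proof (rule comp_inj_on)
          show "inj_on h (interior (h -` path_image g))" using hi inj_on_subset by blast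
          have "inj_on k (path_image g)"
            using k by (metis homeomorphism_apply2 inj_on_inverseI)
          then show "inj_on k (h ` interior (h -` path_image g))" using sub inj_on_subset by blast
        qed
      qed (use ne in auto)
      then show False by simp
    qed
    show "closed (h -` path_image g)"
      using hc closed_arc_image[OF g] by (metis closed_vimage)
  qed
  have "interior (\<Union>g\<in>\<A>. h -` path_image g) = {} \<and> closed (\<Union>g\<in>\<A>. h -` path_image g)"
    using assms
  proof (induction rule: finite_induct)
    case (insert g \<A>)
    then show ?case using one[of g] by (simp add: interior_closed_Un_empty_interior closed_Un)
  qed auto
  then have "(\<Union>g\<in>\<A>. h -` path_image g) \<noteq> UNIV" by auto
  then show ?thesis using hs by blast
qed

text \<open>A path composed of several lifted edges and their antipodes need not be an arc, but
  finitely many arcs still cover it; that is all that is required to find a pole off the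
  drawing.\<close>

definition thin :: "'a::topological_space set \<Rightarrow> bool" where
  "thin B \<longleftrightarrow> (\<exists>\<A>. finite \<A> \<and> (\<forall>g\<in>\<A>. arc g) \<and> B \<subseteq> (\<Union>g\<in>\<A>. path_image g))"

lemma thin_arc: "arc g \<Longrightarrow> thin (path_image g)"
  unfolding thin_def by (rule exI[of _ "{g}"]) auto

lemma thin_empty: "thin {}"
  unfolding thin_def by blast

lemma thin_Un:
  assumes "thin B" "thin C"
  shows "thin (B \<union> C)"
proof -
  obtain \<A> \<B> where "finite \<A>" "\<forall>g\<in>\<A>. arc g" "B \<subseteq> (\<Union>g\<in>\<A>. path_image g)"
    "finite \<B>" "\<forall>g\<in>\<B>. arc g" "C \<subseteq> (\<Union>g\<in>\<B>. path_image g)"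
    using assms unfolding thin_def by metis
  then show ?thesis unfolding thin_def by (intro exI[of _ "\<A> \<union> \<B>"]) auto
qed

lemma thin_UN: "finite I \<Longrightarrow> (\<And>i. i \<in> I \<Longrightarrow> thin (B i)) \<Longrightarrow> thin (\<Union>i\<in>I. B i)"
  by (induction rule: finite_induct) (auto intro: thin_empty thin_Un)

text \<open>Thinness leaves a point of the sphere off all ten edges; projection from it is injective
  and so keeps disjoint edges disjoint in the plane.\<close>

lemma no_almost_embedding_K5_sphere:
  fixes x :: "nat \<Rightarrow> real^3" and p :: "nat \<Rightarrow> nat \<Rightarrow> real \<Rightarrow> real^3"
  assumes path: "\<And>i j. i < j \<Longrightarrow> j < 5 \<Longrightarrow> path (p i j)"
    and ends: "\<And>i j. i < j \<Longrightarrow> j < 5 \<Longrightarrow> pathstart (p i j) = x i \<and> pathfinish (p i j) = x j"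
    and sphere: "\<And>i j. i < j \<Longrightarrow> j < 5 \<Longrightarrow> path_image (p i j) \<subseteq> sphere 0 1"
    and disj: "\<And>i j k l. i < j \<Longrightarrow> j < 5 \<Longrightarrow> k < l \<Longrightarrow> l < 5 \<Longrightarrow> {i, j} \<inter> {k, l} = {} \<Longrightarrow>
      path_image (p i j) \<inter> path_image (p k l) = {}"
    and thin: "\<And>i j. i < j \<Longrightarrow> j < 5 \<Longrightarrow> thin (path_image (p i j))"
  shows False
proof -
  define I where "I = {z \<in> {..<5::nat} \<times> {..<5::nat}. fst z < snd z}"
  have "I \<subseteq> {..<5} \<times> {..<5}" by (auto simp: I_def)
  then have "finite I" by (rule finite_subset) simp
  then have "thin (\<Union>z\<in>I. path_image (p (fst z) (snd z)))"
  proof (rule thin_UN)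
    show "thin (path_image (p (fst z) (snd z)))" if "z \<in> I" for z
      using that by (intro thin) (simp_all add: I_def mem_Times_iff)
  qed
  then obtain \<A> where \<A>: "finite \<A>" "\<forall>g\<in>\<A>. arc g"
    "(\<Union>z\<in>I. path_image (p (fst z) (snd z))) \<subseteq> (\<Union>g\<in>\<A>. path_image g)"
    unfolding thin_def by blast
  then have cover: "path_image (p i j) \<subseteq> (\<Union>g\<in>\<A>. path_image g)" if "i < j" "j < 5" for i j
  proof -
    have "(i, j) \<in> I" using that by (simp add: I_def)
    from UN_upper[OF this, of "\<lambda>z. path_image (p (fst z) (snd z))"] show ?thesis
      using \<A>(3) by simp
  qed
  obtain q where q: "q \<in> sphere 0 1" "q \<notin> (\<Union>g\<in>\<A>. path_image g)"
    using finite_arcs_proper_subset_sphere[of \<A>] \<A> by blast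
  obtain S :: "real^3 \<Rightarrow> complex" where S: "continuous_on (sphere 0 1 - {q}) S" "inj_on S (sphere 0 1 - {q})"
    using stereographic_projection_exists[OF q(1)] by metis
  have sub: "path_image (p i j) \<subseteq> sphere 0 1 - {q}" if "i < j" "j < 5" for i j
    using sphere[OF that] cover[OF that] q(2) by blast
  show False
  proof (rule no_almost_embedding_K5_plane[where \<phi> = "S \<circ> x" and p = "\<lambda>i j. S \<circ> p i j"])
    fix i j :: nat assume ij: "i < j" "j < 5"
    show "path (S \<circ> p i j)"
      using path[OF ij] continuous_on_subset[OF S(1) sub[OF ij]] by (rule path_continuous_image)
    show "pathstart (S \<circ> p i j) = (S \<circ> x) i \<and> pathfinish (S \<circ> p i j) = (S \<circ> x) j"
      using ends[OF ij] by (simp add: pathstart_compose pathfinish_compose)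
    fix k l :: nat assume kl: "k < l" "l < 5" "{i, j} \<inter> {k, l} = {}"
    have "S ` path_image (p i j) \<inter> S ` path_image (p k l) = S ` (path_image (p i j) \<inter> path_image (p k l))"
      by (rule inj_on_image_Int[OF S(2), symmetric]) (use sub[OF ij] sub[OF kl(1,2)] in blast)+
    then show "path_image (S \<circ> p i j) \<inter> path_image (S \<circ> p k l) = {}"
      using disj[OF ij kl] by (simp add: path_image_compose)
  qed
qed

section \<open>The projective plane\<close>

text \<open>In stereographic coordinates from a pole that avoids both curves, the antipode of \<open>z\<close> is
  \<open>- 1 / cnj z\<close>, so the logarithms \<open>A\<close> of \<open>G - D\<close> and \<open>B\<close> of \<open>1 + G * cnj D\<close> on the unit square
  are related along opposite sides. Together these relations produce a number \<open>Z\<close> with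
  \<open>Im Z = 0\<close> and \<open>exp Z = - 1\<close>.\<close>

lemma antipodal_paths_meet:
  fixes g d :: "real \<Rightarrow> real^3"
  assumes g: "path g" "path_image g \<subseteq> sphere 0 1" "pathfinish g = - pathstart g"
    and d: "path d" "path_image d \<subseteq> sphere 0 1" "pathfinish d = - pathstart d"
  shows "\<exists>x\<in>path_image g. x \<in> path_image d \<or> - x \<in> path_image d"
proof (rule ccontr)
  assume "\<not> ?thesis"
  then have dis: "x \<noteq> y" "- x \<noteq> y" if "x \<in> path_image g" "y \<in> path_image d" for x y
    using that by auto
  define K where "K f = path_image f \<union> uminus ` path_image f" for f :: "real \<Rightarrow> real^3"
  have closed: "closed (K f)" if "path f" for f
    using that by (auto simp: K_def closed_path_image intro!: closed_Un closed_negations)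
  \<comment> \<open>\<open>K g\<close> and \<open>K d\<close> are closed, nonempty and, by
    assumption, disjoint on the sphere; as the sphere is connected they cannot cover it.\<close>
  have "\<exists>p\<in>sphere 0 1. p \<notin> K g \<and> p \<notin> K d"
  proof (rule ccontr)
    assume no: "\<not> ?thesis"
    have "connected (sphere (0::real^3) 1)" by (rule connected_sphere) simp
    moreover have "sphere 0 1 \<subseteq> K g \<union> K d" using no by blast
    moreover have "K g \<inter> K d \<inter> sphere 0 1 = {}"
      using dis by (fastforce simp: K_def)
    moreover have "K g \<inter> sphere 0 1 \<noteq> {}" "K d \<inter> sphere 0 1 \<noteq> {}"
      using g(2) d(2) path_image_nonempty[of g] path_image_nonempty[of d] by (auto simp: K_def)
    ultimately show False
      using closed[OF g(1)] closed[OF d(1)] unfolding connected_closed by blast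
  qed
  then obtain p where p: "p \<in> sphere 0 1" "p \<notin> K g" "p \<notin> K d" by blast
  obtain S :: "real^3 \<Rightarrow> complex" where S: "continuous_on (sphere 0 1 - {p}) S" "inj_on S (sphere 0 1 - {p})"
    "\<And>x. x \<in> sphere 0 1 - {p, - p} \<Longrightarrow> S x \<noteq> 0"
    "\<And>x. x \<in> sphere 0 1 - {p, - p} \<Longrightarrow> S (- x) = - 1 / cnj (S x)"
    using stereographic_projection_exists[OF p(1)] by metis
  have sub: "path_image f \<subseteq> sphere 0 1 - {p, - p}" if "path_image f \<subseteq> sphere 0 1" "p \<notin> K f" for f
    using that by (force simp: K_def)
  have subg: "g t \<in> sphere 0 1 - {p, - p}" and subd: "d t \<in> sphere 0 1 - {p, - p}" if "t \<in> {0..1}" for t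
    using sub[OF g(2) p(2)] sub[OF d(2) p(3)] that unfolding path_image_def by blast+
  define G where "G = S \<circ> g"
  define D where "D = S \<circ> d"
  have contS: "continuous_on {0..1} (S \<circ> f)"
    if "path f" "\<And>t. t \<in> {0..1} \<Longrightarrow> f t \<in> sphere 0 1 - {p, - p}" for f
    using that(1) unfolding path_def
    by (intro continuous_on_compose continuous_on_subset[OF S(1)]) (use that(2) in \<open>blast+\<close>)
  have cont: "continuous_on {0..1} G" "continuous_on {0..1} D"
    unfolding G_def D_def using contS[OF g(1) subg] contS[OF d(1) subd] by blast+
  have nz: "G t \<noteq> 0" "D t \<noteq> 0" if "t \<in> {0..1}" for t
    using S(3) subg[OF that] subd[OF that] by (auto simp: G_def D_def)
  \<comment> \<open>In coordinates: \<open>g s\<close> is neither \<open>d t\<close> nor its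
    antipode.\<close>
  have GD: "G s \<noteq> D t" "1 + G s * cnj (D t) \<noteq> 0" if st: "s \<in> {0..1}" "t \<in> {0..1}" for s t
  proof -
    have gd: "g s \<in> path_image g" "d t \<in> path_image d" using st by (auto simp: path_image_def)
    show "G s \<noteq> D t"
      using inj_onD[OF S(2), of "g s" "d t"] subg[OF st(1)] subd[OF st(2)] dis(1)[OF gd]
      by (auto simp: G_def D_def)
    have "- d t \<in> sphere 0 1 - {p}" using subd[OF st(2)] by auto
    then have "S (g s) \<noteq> S (- d t)"
      using inj_onD[OF S(2), of "g s" "- d t"] subg[OF st(1)] dis(2)[OF gd] by auto
    then have "G s \<noteq> - 1 / cnj (D t)"
      using S(4)[OF subd[OF st(2)]] by (simp add: G_def D_def)
    then show "1 + G s * cnj (D t) \<noteq> 0"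
      using nz(2)[OF st(2)] by (auto simp: field_simps add_eq_0_iff)
  qed
  have G1: "G 1 = - 1 / cnj (G 0)" and D1: "D 1 = - 1 / cnj (D 0)"
    using S(4)[OF subg[of 0]] S(4)[OF subd[of 0]] g(3) d(3)
    by (auto simp: G_def D_def pathstart_def pathfinish_def)
  let ?Q = "{0..1::real} \<times> {0..1::real}"
  have Q: "convex ?Q" by (intro convex_Times) auto
  have cQ: "continuous_on ?Q (\<lambda>z. G (fst z))" "continuous_on ?Q (\<lambda>z. D (snd z))"
    by (auto intro!: continuous_intros continuous_on_compose2[OF cont(1)] continuous_on_compose2[OF cont(2)])
  have "continuous_on ?Q (\<lambda>z. G (fst z) - D (snd z))"
    by (intro continuous_intros cQ)
  moreover have "G (fst z) - D (snd z) \<noteq> 0" if "z \<in> ?Q" for z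
    using GD(1) that by auto
  ultimately obtain A where A: "continuous_on ?Q A" "\<And>z. z \<in> ?Q \<Longrightarrow> exp (A z) = G (fst z) - D (snd z)"
    using logarithm_on_convex[OF Q, of "\<lambda>z. G (fst z) - D (snd z)"] by blast
  have "continuous_on ?Q (\<lambda>z. 1 + G (fst z) * cnj (D (snd z)))"
    by (intro continuous_intros cQ)
  moreover have "1 + G (fst z) * cnj (D (snd z)) \<noteq> 0" if "z \<in> ?Q" for z
    using GD(2) that by auto
  ultimately obtain B where B: "continuous_on ?Q B" "\<And>z. z \<in> ?Q \<Longrightarrow> exp (B z) = 1 + G (fst z) * cnj (D (snd z))"
    using logarithm_on_convex[OF Q, of "\<lambda>z. 1 + G (fst z) * cnj (D (snd z))"] by blast
  have c1: "continuous_on {0..1} (\<lambda>s. H (s, t))" if "continuous_on ?Q H" "t \<in> {0..1}" for t and H :: "real \<times> real \<Rightarrow> complex"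
    by (rule continuous_on_compose2[OF that(1)]) (use that in \<open>auto intro!: continuous_intros\<close>)
  have c2: "continuous_on {0..1} (\<lambda>t. H (s, t))" if "continuous_on ?Q H" "s \<in> {0..1}" for s and H :: "real \<times> real \<Rightarrow> complex"
    by (rule continuous_on_compose2[OF that(1)]) (use that in \<open>auto intro!: continuous_intros\<close>)
  \<comment> \<open>Going from \<open>t = 0\<close> to \<open>t = 1\<close> replaces the value of
    \<open>D\<close> by that of its antipode, which turns \<open>G - D\<close> and
    \<open>1 + G * cnj D\<close> into constant multiples of each other. The same happens for
    \<open>G\<close> along the other direction, there with a conjugation.\<close>
  have e1: "A (1, 1) - A (0, 1) = B (1, 0) - B (0, 0)"
  proof (rule logarithm_change_unique[where c = "1 / cnj (D 0)"])
    show "exp (A (t, 1)) = 1 / cnj (D 0) * exp (B (t, 0))" if "t \<in> {0..1}" for t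
      using A(2)[of "(t, 1)"] B(2)[of "(t, 0)"] that D1 nz(2)[of 0] by (simp add: field_simps)
  qed (use c1[OF A(1)] c1[OF B(1)] in auto)
  have e2: "B (1, 1) - B (0, 1) = A (1, 0) - A (0, 0)"
  proof (rule logarithm_change_unique[where c = "- 1 / D 0"])
    show "exp (B (t, 1)) = - 1 / D 0 * exp (A (t, 0))" if "t \<in> {0..1}" for t
    proof -
      have "exp (B (t, 1)) = 1 - G t / D 0" "exp (A (t, 0)) = G t - D 0"
        using B(2)[of "(t, 1)"] A(2)[of "(t, 0)"] that D1 by simp_all
      then show ?thesis using nz(2)[of 0] by (simp add: diff_divide_distrib)
    qed
  qed (use c1[OF A(1)] c1[OF B(1)] in auto)
  have f1: "exp (A (1, t)) = - 1 / cnj (G 0) * exp (cnj (B (0, t)))" if "t \<in> {0..1}" for t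
  proof -
    have "exp (A (1, t)) = - 1 / cnj (G 0) - D t" "exp (cnj (B (0, t))) = 1 + cnj (G 0) * D t"
      using A(2)[of "(1, t)"] B(2)[of "(0, t)"] that G1 by (simp_all add: exp_cnj[symmetric])
    then show ?thesis using nz(1)[of 0] by (simp add: field_simps)
  qed
  have f2: "exp (B (1, t)) = 1 / cnj (G 0) * exp (cnj (A (0, t)))" if "t \<in> {0..1}" for t
  proof -
    have "exp (B (1, t)) = 1 - cnj (D t) / cnj (G 0)" "exp (cnj (A (0, t))) = cnj (G 0) - cnj (D t)"
      using B(2)[of "(1, t)"] A(2)[of "(0, t)"] that G1 by (simp_all add: exp_cnj[symmetric])
    then show ?thesis using nz(1)[of 0] by (simp add: diff_divide_distrib)
  qed
  have e3: "A (1, 1) - A (1, 0) = cnj (B (0, 1)) - cnj (B (0, 0))"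
    by (rule logarithm_change_unique[where c = "- 1 / cnj (G 0)"])
      (use c2[OF A(1)] continuous_on_cnj[OF c2[OF B(1)]] f1 in auto)
  have e4: "B (1, 1) - B (1, 0) = cnj (A (0, 1)) - cnj (A (0, 0))"
    by (rule logarithm_change_unique[where c = "1 / cnj (G 0)"])
      (use c2[OF B(1)] continuous_on_cnj[OF c2[OF A(1)]] f2 in auto)
  \<comment> \<open>The relations \<open>e1\<close> to \<open>e4\<close> express \<open>Im Z\<close>
    as its own negative, while \<open>f1\<close> and \<open>f2\<close> at \<open>t = 0\<close> carry
    the factors \<open>- 1 / cnj (G 0)\<close> and \<open>1 / cnj (G 0)\<close>, whose quotient is
    -1.\<close>
  define Z where "Z = A (1, 0) - B (1, 0) - cnj (B (0, 0)) + cnj (A (0, 0))"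
  have "Im Z = 0"
    using arg_cong[OF e1, of Im] arg_cong[OF e2, of Im] arg_cong[OF e3, of Im] arg_cong[OF e4, of Im]
    by (simp add: Z_def)
  then have "exp Z = of_real (exp (Re Z))"
    by (metis complex_is_Real_iff of_real_Re exp_of_real)
  moreover have "exp Z = - 1"
    using f1[of 0] f2[of 0] nz(1)[of 0] by (simp add: Z_def exp_add exp_diff)
  ultimately have "exp (Re Z) = - 1"
    by (metis of_real_eq_iff of_real_1 of_real_minus)
  then show False using exp_gt_zero[of "Re Z"] by linarith
qed

section \<open>The antipodal covering and one-sided curves\<close>

text \<open>The Veronese map, sending \<open>x\<close> to the rank one matrix of the projection onto
  its line. It realises the projective plane inside a normed space, where path lifting for covering
  spaces is available.\<close>

definition outer_square :: "real^3 \<Rightarrow> real^3^3" where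
  "outer_square x = (\<chi> i j. x$i * x$j)"

lemma outer_square_mult: "outer_square x *v y = (x \<bullet> y) *\<^sub>R x"
  by (simp add: outer_square_def matrix_vector_mult_def vec_eq_iff inner_vec_def sum_3 algebra_simps)

lemma outer_square_uminus [simp]: "outer_square (- x) = outer_square x"
  by (simp add: outer_square_def vec_eq_iff)

lemma continuous_on_outer_square: "continuous_on A outer_square"
  unfolding outer_square_def by (intro continuous_intros)

lemma outer_square_eqD:
  assumes "outer_square x = outer_square y" "x \<in> sphere 0 1" "y \<in> sphere 0 1"
  shows "x = y \<or> x = - y"
proof -
  have "x \<bullet> x = 1" "y \<bullet> y = 1" using assms by (simp_all add: dot_square_norm)
  have "(x \<bullet> x) *\<^sub>R x = (y \<bullet> x) *\<^sub>R y"
    using assms(1) by (metis outer_square_mult)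
  then have x: "x = (y \<bullet> x) *\<^sub>R y" using \<open>x \<bullet> x = 1\<close> by simp
  then have "norm x = \<bar>y \<bullet> x\<bar> * norm y" by (metis norm_scaleR)
  then have "\<bar>y \<bullet> x\<bar> = 1" using assms by simp
  then have "y \<bullet> x = 1 \<or> y \<bullet> x = - 1" by linarith
  then show ?thesis using x by auto
qed

text \<open>Over the matrices \<open>N\<close> with \<open>a \<bullet> (N *v a) > 0\<close> the two
  sheets are the open hemispheres around \<open>a\<close> and \<open>- a\<close>. Since
  \<open>outer_square x *v a\<close> is a multiple of \<open>x\<close>, normalising
  \<open>N *v a\<close> and choosing the sign inverts the map on each sheet.\<close>

lemma covering_space_outer_square: "covering_space (sphere 0 1) outer_square (outer_square ` sphere 0 1)"
  unfolding covering_space_def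
proof (intro conjI ballI)
  show "continuous_on (sphere 0 1) outer_square" by (rule continuous_on_outer_square)
  fix M assume "M \<in> outer_square ` sphere 0 1"
  then obtain a where a: "a \<in> sphere 0 1" "M = outer_square a" by blast
  define T where "T = {N \<in> outer_square ` sphere 0 1. a \<bullet> (N *v a) > 0}"
  define U where "U c = {x \<in> sphere 0 1. c * (x \<bullet> a) > 0}" for c :: real
  have mult: "a \<bullet> (outer_square x *v a) = (x \<bullet> a)\<^sup>2" for x
    by (simp add: outer_square_mult power2_eq_square inner_commute)
  have homeo: "homeomorphism (U c) T outer_square (\<lambda>N. (c / norm (N *v a)) *\<^sub>R (N *v a))" if c: "c = 1 \<or> c = - 1" for c
  proof -
    have inv: "(c / norm (outer_square x *v a)) *\<^sub>R (outer_square x *v a) = x" if "x \<in> U c" for x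
    proof -
      have "c * (x \<bullet> a) > 0" "norm x = 1" using that by (auto simp: U_def)
      moreover from this have "\<bar>x \<bullet> a\<bar> = c * (x \<bullet> a)" using c by auto
      ultimately show ?thesis using c by (auto simp: outer_square_mult)
    qed
    have TU: "\<exists>x\<in>U c. N = outer_square x" if N: "N \<in> T" for N
    proof -
      obtain x where x: "x \<in> sphere 0 1" "N = outer_square x" "x \<bullet> a \<noteq> 0"
        using N mult by (auto simp: T_def)
      show ?thesis
      proof (cases "c * (x \<bullet> a) > 0")
        case True then show ?thesis using x by (auto simp: U_def)
      next
        case False
        then have "c * (- x \<bullet> a) > 0" using x c by (auto simp: not_less)
        then show ?thesis using x by (intro bexI[of _ "- x"]) (auto simp: U_def)
      qed
    qed
    have UT: "outer_square x \<in> T" if "x \<in> U c" for x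
      using that mult by (auto simp: U_def T_def)
    show ?thesis
    proof (rule homeomorphismI)
      show "continuous_on (U c) outer_square" by (rule continuous_on_outer_square)
      show "continuous_on T (\<lambda>N. (c / norm (N *v a)) *\<^sub>R (N *v a))"
      proof -
        have "norm (N *v a) \<noteq> 0" if "N \<in> T" for N using that by (auto simp: T_def)
        moreover have "continuous_on T (\<lambda>N. N *v a)"
          unfolding matrix_vector_mult_def by (intro continuous_intros)
        ultimately show ?thesis by (intro continuous_intros) auto
      qed
      show "outer_square ` U c \<subseteq> T" using UT by blast
      show "(\<lambda>N. (c / norm (N *v a)) *\<^sub>R (N *v a)) ` T \<subseteq> U c" using TU inv by fastforce
      show "(c / norm (outer_square x *v a)) *\<^sub>R (outer_square x *v a) = x" if "x \<in> U c" for x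
        using inv[OF that] .
      show "outer_square ((c / norm (N *v a)) *\<^sub>R (N *v a)) = N" if "N \<in> T" for N
        using TU[OF that] inv by auto
    qed
  qed
  have "openin (top_of_set (outer_square ` sphere 0 1)) T"
  proof -
    have "open {N :: real^3^3. a \<bullet> (N *v a) > 0}"
      unfolding matrix_vector_mult_def by (intro open_Collect_less continuous_intros)
    moreover have "T = outer_square ` sphere 0 1 \<inter> {N. a \<bullet> (N *v a) > 0}" by (auto simp: T_def)
    ultimately show ?thesis by (simp add: openin_open_Int)
  qed
  moreover have "openin (top_of_set (sphere 0 1)) (U c)" for c
  proof -
    have "open {x. c * (x \<bullet> a) > 0}" by (intro open_Collect_less continuous_intros)
    moreover have "U c = sphere 0 1 \<inter> {x. c * (x \<bullet> a) > 0}" by (auto simp: U_def)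
    ultimately show ?thesis by (simp add: openin_open_Int)
  qed
  moreover have "M \<in> T" using a mult by (auto simp: T_def dot_square_norm)
  moreover have "\<Union> {U 1, U (- 1)} = sphere 0 1 \<inter> outer_square -` T"
    using mult by (auto simp: U_def T_def)
  moreover have "pairwise disjnt {U 1, U (- 1)}"
    by (auto simp: pairwise_def disjnt_def U_def)
  moreover have "\<exists>q. homeomorphism u T outer_square q" if "u \<in> {U 1, U (- 1)}" for u
    using that homeo[of 1] homeo[of "- 1"] by blast
  ultimately show "\<exists>T. M \<in> T \<and> openin (top_of_set (outer_square ` sphere 0 1)) T \<and>
     (\<exists>v. \<Union> v = sphere 0 1 \<inter> outer_square -` T \<and> (\<forall>u\<in>v. openin (top_of_set (sphere 0 1)) u) \<and>
       pairwise disjnt v \<and> (\<forall>u\<in>v. \<exists>q. homeomorphism u T outer_square q))"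
    by (intro exI[of _ T] conjI exI[of _ "{U 1, U (- 1)}"]) simp_all
qed simp

lemma antipodal_pair_uminus [simp]: "antipodal_pair (- x) = antipodal_pair x"
  by (auto simp: antipodal_pair_def)

lemma antipodal_pair_eq_iff: "antipodal_pair x = antipodal_pair y \<longleftrightarrow> x = y \<or> x = - y"
  by (auto simp: antipodal_pair_def doubleton_eq_iff)

text \<open>\<open>C\<close> contains a closed curve whose lift to the sphere ends at the antipode
  of its starting point. \<open>C\<close> is a set of points, so that unions of drawn edges qualify
  without naming a parametrisation.\<close>

definition one_sided :: "(real^3) set set \<Rightarrow> bool" where
  "one_sided C \<longleftrightarrow> (\<exists>g. path g \<and> path_image g \<subseteq> sphere 0 1 \<and> pathfinish g = - pathstart g \<and>
     antipodal_pair ` path_image g \<subseteq> C)"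

lemma one_sided_meet:
  assumes "one_sided C" "one_sided D"
  shows "C \<inter> D \<noteq> {}"
proof -
  obtain g d where g: "path g" "path_image g \<subseteq> sphere 0 1" "pathfinish g = - pathstart g" "antipodal_pair ` path_image g \<subseteq> C"
    and d: "path d" "path_image d \<subseteq> sphere 0 1" "pathfinish d = - pathstart d" "antipodal_pair ` path_image d \<subseteq> D"
    using assms unfolding one_sided_def by blast
  obtain x where "x \<in> path_image g" "x \<in> path_image d \<or> - x \<in> path_image d"
    using antipodal_paths_meet[OF g(1-3) d(1-3)] by blast
  then have "antipodal_pair x \<in> C" "antipodal_pair x \<in> D"
    using g(4) d(4) by (metis antipodal_pair_uminus image_subset_iff)+
  then show ?thesis by blast
qed

section \<open>Lifting drawn edges to the sphere\<close>

text \<open>\<open>outer_square\<close> is even, so \<open>\<Omega>\<close> does not depend on the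
  chosen representative, and it is continuous by the quotient property. The path is moved to
  matrices, lifted there, and read back as antipodal pairs.\<close>

lemma lift_path_projective_plane:
  assumes \<gamma>: "pathin projective_plane \<gamma>" and x: "x \<in> sphere 0 1" "antipodal_pair x = \<gamma> 0"
  obtains g where "path g" "path_image g \<subseteq> sphere 0 1" "pathstart g = x"
    "\<And>t. t \<in> {0..1} \<Longrightarrow> antipodal_pair (g t) = \<gamma> t"
proof -
  define \<Omega> where "\<Omega> P = outer_square (SOME x. x \<in> P)" for P
  have \<Omega>: "\<Omega> (antipodal_pair x) = outer_square x" for x
    unfolding \<Omega>_def by (rule someI2[of _ x]) (auto simp: antipodal_pair_def)
  have "\<Omega> \<circ> antipodal_pair = outer_square" using \<Omega> by auto
  then have "continuous_map two_sphere euclidean (\<Omega> \<circ> antipodal_pair)"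
    by (simp add: continuous_on_outer_square)
  then have "continuous_map projective_plane euclidean \<Omega>"
    by (rule continuous_compose_quotient_map[OF quotient_map_antipodal_pair])
  then have "path (\<Omega> \<circ> \<gamma>)"
    using pathin_compose[OF \<gamma>] by (fastforce simp: pathin_def path_def)
  moreover have top: "\<gamma> t \<in> antipodal_pair ` sphere 0 1" if "t \<in> {0..1}" for t
    using \<gamma> that unfolding pathin_def continuous_map_def topspace_projective_plane by (auto simp: Pi_def)
  then have "path_image (\<Omega> \<circ> \<gamma>) \<subseteq> outer_square ` sphere 0 1"
    using \<Omega> by (fastforce simp: path_image_def)
  moreover have "pathstart (\<Omega> \<circ> \<gamma>) = outer_square x"
    using x \<Omega>[of x] by (simp add: pathstart_def)
  ultimately obtain g where g: "path g" "path_image g \<subseteq> sphere 0 1" "pathstart g = x"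
    "\<And>t. t \<in> {0..1} \<Longrightarrow> outer_square (g t) = (\<Omega> \<circ> \<gamma>) t"
    using covering_space_lift_path_strong[OF covering_space_outer_square x(1)] by metis
  have "antipodal_pair (g t) = \<gamma> t" if t: "t \<in> {0..1}" for t
  proof -
    obtain y where y: "y \<in> sphere 0 1" "\<gamma> t = antipodal_pair y" using top[OF t] by auto
    have "g t \<in> sphere 0 1" using g(2) t unfolding path_image_def by blast
    then show ?thesis
      using outer_square_eqD[of "g t" y] g(4)[OF t] y \<Omega> by (auto simp: antipodal_pair_eq_iff)
  qed
  then show thesis using that g by blast
qed

text \<open>Injectivity of \<open>\<gamma>\<close> passes to the lift in a stronger form: the lift
  contains no pair of antipodes. Edges of a drawing are not oriented, so the given point may lie
  over either end; the second case reverses the arc.\<close>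

lemma lift_arc_projective_plane:
  assumes \<gamma>: "pathin projective_plane \<gamma>" "inj_on \<gamma> {0..1}"
    and x: "x \<in> sphere 0 1" "antipodal_pair x \<in> {\<gamma> 0, \<gamma> 1}"
  obtains g where "arc g" "path_image g \<subseteq> sphere 0 1" "pathstart g = x"
    "antipodal_pair ` path_image g = \<gamma> ` {0..1}" "inj_on antipodal_pair (path_image g)"
    "{antipodal_pair x, antipodal_pair (pathfinish g)} = {\<gamma> 0, \<gamma> 1}"
proof -
  note result = that
  have *: thesis if \<gamma>': "pathin projective_plane \<gamma>'" "inj_on \<gamma>' {0..1}" "antipodal_pair x = \<gamma>' 0"
    and eq: "\<gamma>' ` {0..1} = \<gamma> ` {0..1}" "{\<gamma>' 0, \<gamma>' 1} = {\<gamma> 0, \<gamma> 1}" for \<gamma>'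
  proof -
    obtain g where g: "path g" "path_image g \<subseteq> sphere 0 1" "pathstart g = x"
      "\<And>t. t \<in> {0..1} \<Longrightarrow> antipodal_pair (g t) = \<gamma>' t"
      using lift_path_projective_plane[OF \<gamma>'(1) x(1) \<gamma>'(3)] by metis
    have "arc g" unfolding arc_def
    proof
      show "inj_on g {0..1}"
        using g(4) \<gamma>'(2) unfolding inj_on_def by metis
    qed (rule g(1))
    moreover have "inj_on antipodal_pair (path_image g)"
      using g(4) \<gamma>'(2) unfolding inj_on_def path_image_def by (metis imageE)
    moreover have "antipodal_pair ` path_image g = \<gamma>' ` {0..1}"
      unfolding path_image_def image_image using g(4) by (intro image_cong) auto
    moreover have "antipodal_pair (pathfinish g) = \<gamma>' 1"
      using g(4)[of 1] by (simp add: pathfinish_def)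
    ultimately show thesis using eq g(2,3) \<gamma>'(3) by (intro result[of g]) auto
  qed
  show thesis
  proof (cases "antipodal_pair x = \<gamma> 0")
    case True
    then show ?thesis using *[OF \<gamma>] by simp
  next
    case False
    have im: "(\<lambda>t::real. 1 - t) ` {0..1} = {0..1}"
      by (simp add: image_diff_atLeastAtMost)
    show ?thesis
    proof (rule *[of "\<gamma> \<circ> (\<lambda>t. 1 - t)"])
      have "continuous_map (subtopology euclideanreal {0..1}) (subtopology euclideanreal {0..1}) (\<lambda>t. 1 - t)"
        using im by (auto simp: continuous_map_in_subtopology intro!: continuous_intros)
      then show "pathin projective_plane (\<gamma> \<circ> (\<lambda>t. 1 - t))"
        using \<gamma>(1) unfolding pathin_def by (rule continuous_map_compose)
      show "inj_on (\<gamma> \<circ> (\<lambda>t. 1 - t)) {0..1}"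
      proof (rule comp_inj_on)
        show "inj_on \<gamma> ((\<lambda>t::real. 1 - t) ` {0..1})" unfolding im by (rule \<gamma>(2))
      qed (simp add: inj_on_def)
      show "(\<gamma> \<circ> (\<lambda>t. 1 - t)) ` {0..1} = \<gamma> ` {0..1}"
        by (simp only: image_comp[symmetric] im)
    qed (use x(2) False in auto)
  qed
qed

text \<open>If no triangle on the vertices \<open>0, 1, 2, 3\<close> is one-sided, the drawing of their
  \<open>K\<^sub>4\<close> lifts to the sphere, together with the edge from \<open>0\<close> to \<open>4\<close>. An edge from \<open>4\<close> to
  \<open>i\<close> either lifts to the chosen points as well, or ends at the antipode of the lift of \<open>i\<close>; in
  the latter case it is replaced by a detour through the antipodal copy of the \<open>K\<^sub>4\<close>, which is
  disjoint from the chosen one.\<close>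

lemma K5_one_sided_triangle:
  fixes \<phi> :: "nat \<Rightarrow> (real^3) set" and C :: "nat set \<Rightarrow> (real^3) set set"
  assumes lift: "\<And>i j x. i < 5 \<Longrightarrow> j < 5 \<Longrightarrow> i \<noteq> j \<Longrightarrow> x \<in> sphere 0 1 \<Longrightarrow> antipodal_pair x = \<phi> i \<Longrightarrow>
      \<exists>g. arc g \<and> path_image g \<subseteq> sphere 0 1 \<and> pathstart g = x \<and> antipodal_pair (pathfinish g) = \<phi> j \<and>
        antipodal_pair ` path_image g = C {i, j} \<and> inj_on antipodal_pair (path_image g)"
    and \<phi>: "\<phi> 0 \<in> antipodal_pair ` sphere 0 1"
    and meet: "\<And>i j k l. i < 5 \<Longrightarrow> j < 5 \<Longrightarrow> i \<noteq> j \<Longrightarrow> k < 5 \<Longrightarrow> l < 5 \<Longrightarrow> k \<noteq> l \<Longrightarrow> {i, j} \<noteq> {k, l} \<Longrightarrow>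
      C {i, j} \<inter> C {k, l} \<subseteq> \<phi> ` ({i, j} \<inter> {k, l})"
  shows "\<exists>i j k. i < j \<and> j < k \<and> k < 4 \<and> one_sided (C {i, j} \<union> C {j, k} \<union> C {i, k})"
proof (rule ccontr)
  assume "\<not> ?thesis"
  then have no: "\<not> one_sided (C {i, j} \<union> C {j, k} \<union> C {i, k})" if "i < j" "j < k" "k < 4" for i j k
    using that by blast
  obtain x0 where x0: "x0 \<in> sphere 0 1" "antipodal_pair x0 = \<phi> 0"
    using \<phi> by auto
  have "\<exists>g. arc g \<and> path_image g \<subseteq> sphere 0 1 \<and> pathstart g = x0 \<and> antipodal_pair (pathfinish g) = \<phi> i \<and>
        antipodal_pair ` path_image g = C {0, i} \<and> inj_on antipodal_pair (path_image g)" if "0 < i" "i < 5" for i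
    using that by (intro lift x0) auto
  then obtain h where h: "\<And>i. 0 < i \<Longrightarrow> i < 5 \<Longrightarrow> arc (h i) \<and> path_image (h i) \<subseteq> sphere 0 1 \<and> pathstart (h i) = x0 \<and>
        antipodal_pair (pathfinish (h i)) = \<phi> i \<and>
        antipodal_pair ` path_image (h i) = C {0, i} \<and> inj_on antipodal_pair (path_image (h i))"
    by metis
  define x where "x i = (if i = 0 then x0 else pathfinish (h i))" for i
  have x: "x i \<in> sphere 0 1" "antipodal_pair (x i) = \<phi> i" if "i < 5" for i
  proof -
    have "path_image (h i) \<subseteq> sphere 0 1 \<and> antipodal_pair (pathfinish (h i)) = \<phi> i" if "i \<noteq> 0"
      using h[of i] \<open>i < 5\<close> that by blast
    then show "x i \<in> sphere 0 1" "antipodal_pair (x i) = \<phi> i"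
      using x0 subsetD[OF _ pathfinish_in_path_image[of "h i"], of "sphere 0 1"]
      by (cases "i = 0"; simp add: x_def)+
  qed
  have x0_over: "z = x0" if "z \<in> path_image (h i)" "antipodal_pair z = \<phi> 0" "0 < i" "i < 5" for z i
  proof -
    have "x0 \<in> path_image (h i)" using h[OF that(3,4)] pathstart_in_path_image[of "h i"] by auto
    then show ?thesis
      using h[OF that(3,4)] inj_onD[of antipodal_pair "path_image (h i)" z x0] that(1,2) x0(2) by auto
  qed
  \<comment> \<open>This makes the detour safe. A common point would lie over
    \<open>\<phi> 0\<close>, the only common point of the two drawn edges; but each lifted edge
    passes over \<open>\<phi> 0\<close> at \<open>x0\<close> only, never at
    \<open>- x0\<close>.\<close>
  have opp: "uminus ` path_image (h i) \<inter> path_image (h j) = {}" if "0 < i" "i < 5" "0 < j" "j < 5" "i \<noteq> j" for i j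
  proof (rule ccontr)
    assume "\<not> ?thesis"
    then obtain z where z: "z \<in> path_image (h i)" "- z \<in> path_image (h j)" by auto
    then have "antipodal_pair z \<in> C {0, i} \<inter> C {0, j}"
      using h[of i] h[of j] that by (metis IntI antipodal_pair_uminus imageI)
    moreover have "{0, i} \<noteq> {0, j}" using that by (auto simp: doubleton_eq_iff)
    ultimately have "antipodal_pair z \<in> \<phi> ` ({0, i} \<inter> {0, j})"
      using meet[of 0 i 0 j] that by auto
    then have "antipodal_pair z = \<phi> 0" using that by auto
    then have zx: "z = x0" and nzx: "- z = x0"
      using x0_over[OF z(1)] x0_over[OF z(2)] that(1-4) unfolding antipodal_pair_uminus by blast+
    have "x0 = - x0" using nzx unfolding zx by (rule sym)
    then have "2 *\<^sub>R x0 = 0" by (simp only: eq_neg_iff_add_eq_0 scaleR_2)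
    then have "x0 = 0" by simp
    then show False using x0(1) by simp
  qed
  \<comment> \<open>Territory allotted to the edge \<open>ij\<close>: edges at 0 keep to the chosen
    lift, the others may use both lifts of their drawn edge, and an edge ending in 4 also the
    antipodal detour. Disjointness is proved for the territories. Of two edges without a common
    vertex at most one ends in 4, so two detours are never compared.\<close>
  define W where "W i j = (if i = 0 then path_image (h j)
      else antipodal_pair -` C {i, j} \<union> (if j = 4 then uminus ` (path_image (h i) \<union> path_image (h 4)) else {}))" for i j
  have W_C: "antipodal_pair z \<in> C {i, j}" if "z \<in> W i j" "i < j" "j < 4" for i j z
    using that h[of j] by (auto simp: W_def split: if_splits)
  have W_disj': "W i j \<inter> W k l = {}" if "i < j" "j < 5" "k < l" "l < 4" "{i, j} \<inter> {k, l} = {}" for i j k l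
  proof (rule ccontr)
    assume "\<not> ?thesis"
    then obtain z where z: "z \<in> W i j" "z \<in> W k l" by blast
    have kl: "antipodal_pair z \<in> C {k, l}" using W_C z that by auto
    have nij: "antipodal_pair z \<notin> C {i, j}"
      using meet[of i j k l] that kl by auto
    then have ij: "i \<noteq> 0" "j = 4" "- z \<in> path_image (h i) \<union> path_image (h 4)"
      using z(1) h[of j] that by (auto simp: W_def split: if_splits)
    then obtain a where a: "a = i \<or> a = 4" "- z \<in> path_image (h a)" by auto
    have a': "0 < a" "a < 5" "a \<noteq> k" "a \<noteq> l" using a ij that by auto
    show False
    proof (cases "k = 0")
      case True
      then have "z \<in> path_image (h l)" using z(2) by (simp add: W_def)
      then show False using opp[of a l] a a' that by force
    next
      case False
      have "antipodal_pair z \<in> C {0, a}" using a h[OF a'(1,2)] by (metis antipodal_pair_uminus imageI)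
      moreover have "{0, a} \<noteq> {k, l}" using False that by (auto simp: doubleton_eq_iff)
      ultimately show False using meet[of 0 a k l] kl a' that False by auto
    qed
  qed
  have W_disj: "W i j \<inter> W k l = {}" if "i < j" "j < 5" "k < l" "l < 5" "{i, j} \<inter> {k, l} = {}" for i j k l
  proof (cases "l = 4")
    case True
    then have "j < 4" using that by auto
    then show ?thesis using W_disj'[of k l i j] that by blast
  qed (use W_disj'[of i j k l] that in auto)
  have thinh: "thin (uminus ` path_image (h i))" if "0 < i" "i < 5" for i
  proof -
    have "arc (uminus \<circ> h i)"
      using h[OF that] by (auto simp: arc_def path_def inj_on_def intro!: continuous_intros)
    then show ?thesis using thin_arc by (fastforce simp: path_image_compose)
  qed
  have "\<exists>p. path p \<and> pathstart p = x i \<and> pathfinish p = x j \<and> path_image p \<subseteq> sphere 0 1 \<and> path_image p \<subseteq> W i j \<and> thin (path_image p)"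
    if ij: "i < j" "j < 5" for i j
  proof -
    consider "i = 0" | "0 < i" "j < 4" | "0 < i" "j = 4" using ij by linarith
    then show ?thesis
    proof cases
      case 1
      then show ?thesis using h[of j] ij by (intro exI[of _ "h j"]) (auto simp: x_def W_def arc_imp_path thin_arc)
    next
      case 2
      obtain g where g: "arc g" "path_image g \<subseteq> sphere 0 1" "pathstart g = x i" "antipodal_pair (pathfinish g) = \<phi> j"
        "antipodal_pair ` path_image g = C {i, j}"
        using lift[of i j "x i"] x[of i] ij by auto
      \<comment> \<open>Otherwise the triangle on 0, \<open>i\<close>, \<open>j\<close> lifts to a
        path from \<open>x j\<close> through \<open>x0\<close> and \<open>x i\<close> to
        \<open>- x j\<close>.\<close>
      have "pathfinish g = x j"
      proof (rule ccontr)
        assume "pathfinish g \<noteq> x j"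
        moreover have "antipodal_pair (pathfinish g) = antipodal_pair (x j)" using g(4) x(2)[OF ij(2)] by simp
        ultimately have neg: "pathfinish g = - x j" unfolding antipodal_pair_eq_iff by blast
        have hi: "path (h i)" "path (h j)" "pathstart (h i) = x0" "pathstart (h j) = x0" "pathfinish (h i) = x i" "pathfinish (h j) = x j"
          "path_image (h i) \<subseteq> sphere 0 1" "path_image (h j) \<subseteq> sphere 0 1"
          "antipodal_pair ` path_image (h i) = C {0, i}" "antipodal_pair ` path_image (h j) = C {0, j}"
          using h[of i] h[of j] ij 2 by (auto simp: x_def arc_imp_path)
        define q where "q = (reversepath (h j) +++ h i) +++ g"
        have q: "path q" "path_image q = path_image (h j) \<union> path_image (h i) \<union> path_image g"
          "pathstart q = x j" "pathfinish q = - x j"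
          using hi g neg by (simp_all add: q_def arc_imp_path path_image_join)
        have "path_image q \<subseteq> sphere 0 1" unfolding q(2) using hi(7,8) g(2) by blast
        moreover have "antipodal_pair ` path_image q \<subseteq> C {0, i} \<union> C {i, j} \<union> C {0, j}"
          unfolding q(2) image_Un hi(9,10) g(5) by blast
        moreover have "pathfinish q = - pathstart q" unfolding q(3,4) ..
        ultimately have "one_sided (C {0, i} \<union> C {i, j} \<union> C {0, j})"
          unfolding one_sided_def using q(1) by blast
        then show False using no[of 0 i j] ij 2 by auto
      qed
      moreover have "path_image g \<subseteq> antipodal_pair -` C {i, j}" using g(5) by blast
      then have "path_image g \<subseteq> W i j" using 2 by (simp add: W_def)
      ultimately show ?thesis using g(1-3) arc_imp_path[OF g(1)] thin_arc[OF g(1)] by blast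
    next
      case 3
      obtain f where f: "arc f" "path_image f \<subseteq> sphere 0 1" "pathstart f = x i" "antipodal_pair (pathfinish f) = \<phi> 4"
        "antipodal_pair ` path_image f = C {i, 4}"
        using lift[of i 4 "x i"] x[of i] ij 3 by auto
      show ?thesis
      proof (cases "pathfinish f = x 4")
        case True
        have "path_image f \<subseteq> antipodal_pair -` C {i, 4}" using f(5) by blast
        then have "path_image f \<subseteq> W i j" using 3 by (auto simp: W_def)
        then show ?thesis using True f(1-3) 3 arc_imp_path[OF f(1)] thin_arc[OF f(1)] by blast
      next
        case False
        moreover have "antipodal_pair (pathfinish f) = antipodal_pair (x 4)" using f(4) x(2)[of 4] by simp
        ultimately have neg: "pathfinish f = - x 4" unfolding antipodal_pair_eq_iff by blast
        have hi: "path (h i)" "path (h 4)" "pathstart (h i) = x0" "pathstart (h 4) = x0" "pathfinish (h i) = x i" "pathfinish (h 4) = x 4"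
          "path_image (h i) \<subseteq> sphere 0 1" "path_image (h 4) \<subseteq> sphere 0 1"
          using h[of i] h[of 4] ij 3 by (auto simp: x_def arc_imp_path)
        have neg_path: "path (uminus \<circ> u)" if "path u" for u :: "real \<Rightarrow> real^3"
          using that by (auto simp: path_def intro!: continuous_intros)
        \<comment> \<open>Route: \<open>x i\<close> along \<open>f\<close> to \<open>- x 4\<close>,
          by antipodal edges through \<open>- x0\<close> to \<open>- x i\<close>, and along the
          antipode of \<open>f\<close> to \<open>x 4\<close>. It may run into edges with an end in
          common with it, which the obstruction ignores.\<close>
        define q where "q = f +++ ((uminus \<circ> reversepath (h 4)) +++ (uminus \<circ> h i)) +++ (uminus \<circ> f)"
        have q: "path q" "pathstart q = x i" "pathfinish q = x 4"
          using hi f neg neg_path by (simp_all add: q_def arc_imp_path pathstart_compose pathfinish_compose)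
        have im: "path_image q = path_image f \<union> (uminus ` path_image (h 4) \<union> uminus ` path_image (h i)) \<union> uminus ` path_image f"
          using hi f neg by (simp add: q_def path_image_join pathstart_compose pathfinish_compose path_image_compose Un_assoc)
        have "arc (uminus \<circ> f)"
          using f(1) by (auto simp: arc_def path_def inj_on_def intro!: continuous_intros)
        then have "thin (uminus ` path_image f)" using thin_arc by (fastforce simp: path_image_compose)
        then have "thin (path_image q)"
          unfolding im using thinh[of i] thinh[of 4] f(1) ij 3 by (intro thin_Un thin_arc) auto
        moreover have "path_image q \<subseteq> sphere 0 1"
          unfolding im using f(2) hi(7,8) by (auto simp: image_subset_iff subset_iff)
        moreover have "path_image f \<union> uminus ` path_image f \<subseteq> antipodal_pair -` C {i, 4}"
          using f(5) by auto
        then have "path_image q \<subseteq> W i j"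
          unfolding im W_def using 3 by (simp add: image_Un) blast
        ultimately show ?thesis using q 3 by blast
      qed
    qed
  qed
  then obtain p where p: "\<And>i j. i < j \<Longrightarrow> j < 5 \<Longrightarrow> path (p i j) \<and> pathstart (p i j) = x i \<and> pathfinish (p i j) = x j \<and>
     path_image (p i j) \<subseteq> sphere 0 1 \<and> path_image (p i j) \<subseteq> W i j \<and> thin (path_image (p i j))"
    by metis
  show False
  proof (rule no_almost_embedding_K5_sphere[where p = p and x = x])
    fix i j k l :: nat assume ij: "i < j" "j < 5" and kl: "k < l" "l < 5" "{i, j} \<inter> {k, l} = {}"
    show "path_image (p i j) \<inter> path_image (p k l) = {}"
      using W_disj[OF ij kl] p[OF ij] p[OF kl(1,2)] by blast
  qed (use p in auto)
qed

section \<open>Cliques that do not embed\<close>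

text \<open>Exposes the drawing, so that one-sided triangles found in different cliques belong to
  one and the same drawing and can be compared.\<close>

definition is_drawing :: "'v set \<times> 'v set set \<Rightarrow> 'a topology \<Rightarrow> ('v \<Rightarrow> 'a) \<Rightarrow> ('v set \<Rightarrow> real \<Rightarrow> 'a) \<Rightarrow> bool" where
  "is_drawing G S \<phi> \<gamma> \<longleftrightarrow> inj_on \<phi> (fst G) \<and> \<phi> ` fst G \<subseteq> topspace S \<and>
     (\<forall>e \<in> snd G. pathin S (\<gamma> e) \<and> inj_on (\<gamma> e) {0..1} \<and>
        {\<gamma> e 0, \<gamma> e 1} = \<phi> ` e \<and> \<gamma> e ` {0<..<1} \<inter> \<phi> ` fst G = {}) \<and>
     (\<forall>e \<in> snd G. \<forall>e' \<in> snd G. e \<noteq> e' \<longrightarrow> \<gamma> e ` {0<..<1} \<inter> \<gamma> e' ` {0<..<1} = {})"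

lemma embeds_in_iff_drawing: "embeds_in G S \<longleftrightarrow> (\<exists>\<phi> \<gamma>. is_drawing G S \<phi> \<gamma>)"
  unfolding embeds_in_def is_drawing_def ..

lemma embeds_in_homeomorphic:
  assumes "embeds_in G S" "S homeomorphic_space T"
  shows "embeds_in G T"
proof -
  obtain \<phi> \<gamma> where d: "is_drawing G S \<phi> \<gamma>" using assms(1) embeds_in_iff_drawing by blast
  obtain f where f: "homeomorphic_map S T f" using assms(2) homeomorphic_space by blast
  have fi: "inj_on f (topspace S)" and fs: "f ` topspace S = topspace T" and fc: "continuous_map S T f"
    using f homeomorphic_imp_injective_map homeomorphic_imp_surjective_map homeomorphic_imp_continuous_map by blast+
  have V: "\<phi> ` fst G \<subseteq> topspace S" using d by (simp add: is_drawing_def)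
  have P: "\<gamma> e ` {0..1} \<subseteq> topspace S" if "e \<in> snd G" for e
  proof -
    have "pathin S (\<gamma> e)" using d that by (simp add: is_drawing_def)
    then show ?thesis unfolding pathin_def continuous_map_def by auto
  qed
  have P': "\<gamma> e ` {0<..<1} \<subseteq> topspace S" if "e \<in> snd G" for e
    using P[OF that] by (auto simp: image_subset_iff)
  have "is_drawing G T (f \<circ> \<phi>) (\<lambda>e. f \<circ> \<gamma> e)"
    unfolding is_drawing_def
  proof (intro conjI ballI impI)
    show "inj_on (f \<circ> \<phi>) (fst G)"
      using d V fi by (intro comp_inj_on) (auto simp: is_drawing_def intro: inj_on_subset)
    show "(f \<circ> \<phi>) ` fst G \<subseteq> topspace T" using V fs by auto
    fix e assume e: "e \<in> snd G"
    then have de: "pathin S (\<gamma> e)" "inj_on (\<gamma> e) {0..1}" "{\<gamma> e 0, \<gamma> e 1} = \<phi> ` e" "\<gamma> e ` {0<..<1} \<inter> \<phi> ` fst G = {}"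
      using d by (auto simp: is_drawing_def)
    show "pathin T (f \<circ> \<gamma> e)" using de(1) fc by (rule pathin_compose)
    show "inj_on (f \<circ> \<gamma> e) {0..1}"
      using de(2) inj_on_subset[OF fi P[OF e]] by (rule comp_inj_on)
    have "f ` {\<gamma> e 0, \<gamma> e 1} = f ` \<phi> ` e" using de(3) by simp
    then show "{(f \<circ> \<gamma> e) 0, (f \<circ> \<gamma> e) 1} = (f \<circ> \<phi>) ` e" by (simp add: image_comp)
    show "(f \<circ> \<gamma> e) ` {0<..<1} \<inter> (f \<circ> \<phi>) ` fst G = {}"
      unfolding image_comp[symmetric] using inj_on_image_Int[OF fi P'[OF e] V] de(4) by simp
    fix e' assume e': "e' \<in> snd G" "e \<noteq> e'"
    have "\<gamma> e ` {0<..<1} \<inter> \<gamma> e' ` {0<..<1} = {}" using d e e' by (simp add: is_drawing_def)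
    then show "(f \<circ> \<gamma> e) ` {0<..<1} \<inter> (f \<circ> \<gamma> e') ` {0<..<1} = {}"
      unfolding image_comp[symmetric] using inj_on_image_Int[OF fi P'[OF e] P'[OF e'(1)]] by simp
  qed
  then show ?thesis using embeds_in_iff_drawing by blast
qed

lemma embeds_in_mono:
  assumes H: "embeds_in H S" and f: "inj_on f (fst G)" "f ` fst G \<subseteq> fst H"
    and G: "snd G \<subseteq> Pow (fst G)" "\<And>e. e \<in> snd G \<Longrightarrow> f ` e \<in> snd H"
  shows "embeds_in G S"
proof -
  obtain \<phi> \<gamma> where d: "is_drawing H S \<phi> \<gamma>" using H embeds_in_iff_drawing by blast
  have "is_drawing G S (\<phi> \<circ> f) (\<lambda>e. \<gamma> (f ` e))"
    unfolding is_drawing_def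
  proof (intro conjI ballI impI)
    show "inj_on (\<phi> \<circ> f) (fst G)"
      using d f by (intro comp_inj_on) (auto simp: is_drawing_def intro: inj_on_subset)
    show "(\<phi> \<circ> f) ` fst G \<subseteq> topspace S" using d f by (auto simp: is_drawing_def)
    fix e assume e: "e \<in> snd G"
    note He = G(2)[OF e]
    show "pathin S (\<gamma> (f ` e))" "inj_on (\<gamma> (f ` e)) {0..1}" using d He by (auto simp: is_drawing_def)
    show "{\<gamma> (f ` e) 0, \<gamma> (f ` e) 1} = (\<phi> \<circ> f) ` e"
      unfolding image_comp[symmetric] using d He by (simp add: is_drawing_def)
    have "\<gamma> (f ` e) ` {0<..<1} \<inter> \<phi> ` fst H = {}" using d He by (simp add: is_drawing_def)
    then show "\<gamma> (f ` e) ` {0<..<1} \<inter> (\<phi> \<circ> f) ` fst G = {}" using f(2) by fastforce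
    fix e' assume e': "e' \<in> snd G" "e \<noteq> e'"
    have "f ` e \<noteq> f ` e'" using inj_on_image_eq_iff[OF f(1)] e e' G(1) by blast
    then show "\<gamma> (f ` e) ` {0<..<1} \<inter> \<gamma> (f ` e') ` {0<..<1} = {}"
      using d He G(2)[OF e'(1)] unfolding is_drawing_def by blast
  qed
  then show ?thesis using embeds_in_iff_drawing by blast
qed

lemma drawing_edges_meet:
  assumes d: "is_drawing G S \<phi> \<gamma>" and G: "snd G \<subseteq> Pow (fst G)"
    and e: "e \<in> snd G" "e' \<in> snd G" "e \<noteq> e'"
  shows "\<gamma> e ` {0..1} \<inter> \<gamma> e' ` {0..1} \<subseteq> \<phi> ` (e \<inter> e')"
proof
  have de: "{\<gamma> e 0, \<gamma> e 1} = \<phi> ` e" "\<gamma> e ` {0<..<1} \<inter> \<phi> ` fst G = {}"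
    "{\<gamma> e' 0, \<gamma> e' 1} = \<phi> ` e'" "\<gamma> e' ` {0<..<1} \<inter> \<phi> ` fst G = {}"
    "\<gamma> e ` {0<..<1} \<inter> \<gamma> e' ` {0<..<1} = {}" "inj_on \<phi> (fst G)"
    using d e unfolding is_drawing_def by auto
  have split: "{0..1} = {0, 1} \<union> {0<..<1::real}" by auto
  have im: "\<gamma> u ` {0..1} = {\<gamma> u 0, \<gamma> u 1} \<union> \<gamma> u ` {0<..<1}" for u
    unfolding split image_Un by simp
  have eV: "e \<subseteq> fst G" "e' \<subseteq> fst G" using G e by auto
  have V: "\<phi> ` e \<subseteq> \<phi> ` fst G" "\<phi> ` e' \<subseteq> \<phi> ` fst G"
    by (rule image_mono[OF eV(1)], rule image_mono[OF eV(2)])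
  fix z assume "z \<in> \<gamma> e ` {0..1} \<inter> \<gamma> e' ` {0..1}"
  then have z: "z \<in> (\<phi> ` e \<union> \<gamma> e ` {0<..<1}) \<inter> (\<phi> ` e' \<union> \<gamma> e' ` {0<..<1})"
    unfolding im de(1) de(3) .
  have "x \<in> P \<inter> P'" if "x \<in> (P \<union> I) \<inter> (P' \<union> I')" "I \<inter> F = {}" "I' \<inter> F = {}" "I \<inter> I' = {}" "P \<subseteq> F" "P' \<subseteq> F"
    for x and P P' I I' F :: "'b set"
    using that by blast
  from this[OF z de(2,4,5) V] have "z \<in> \<phi> ` e \<inter> \<phi> ` e'" .
  also have "\<phi> ` e \<inter> \<phi> ` e' = \<phi> ` (e \<inter> e')"
    by (rule inj_on_image_Int[OF de(6) eV, symmetric])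
  finally show "z \<in> \<phi> ` (e \<inter> e')" .
qed

definition clique :: "'v set \<times> 'v set set \<Rightarrow> 'v set \<Rightarrow> bool" where
  "clique G K \<longleftrightarrow> K \<subseteq> fst G \<and> (\<forall>u\<in>K. \<forall>v\<in>K. u \<noteq> v \<longrightarrow> {u, v} \<in> snd G)"

lemma clique_subset: "clique G K \<Longrightarrow> L \<subseteq> K \<Longrightarrow> clique G L"
  by (auto simp: clique_def)

lemma not_embeds_sphere_if_K5:
  assumes G: "snd G \<subseteq> Pow (fst G)" and K: "clique G K" "card K = 5"
  shows "\<not> embeds_in G two_sphere"
proof
  assume "embeds_in G two_sphere"
  then obtain \<phi> \<gamma> where d: "is_drawing G two_sphere \<phi> \<gamma>" using embeds_in_iff_drawing by blast
  have "finite K" using K(2) by (metis card.infinite zero_neq_numeral)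
  then obtain b where b: "bij_betw b {..<5::nat} K"
    using K(2) ex_bij_betw_nat_finite[of K] by (auto simp: atLeast0LessThan)
  have bi: "b i \<noteq> b j" if "i < 5" "j < 5" "i \<noteq> j" for i j
    using b that by (auto simp: bij_betw_def dest: inj_onD)
  have E: "{b i, b j} \<in> snd G" if "i < 5" "j < 5" "i \<noteq> j" for i j
    using K(1) bi[OF that] that b unfolding clique_def by (auto simp: bij_betw_def)
  have "\<exists>p. arc p \<and> pathstart p = \<phi> (b i) \<and> pathfinish p = \<phi> (b j) \<and> path_image p = \<gamma> {b i, b j} ` {0..1} \<and> path_image p \<subseteq> sphere 0 1"
    if "i < j" "j < 5" for i j
  proof -
    have e: "{b i, b j} \<in> snd G" using E that by auto
    define q where "q = \<gamma> {b i, b j}"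
    have q: "pathin two_sphere q" "inj_on q {0..1}" "{q 0, q 1} = {\<phi> (b i), \<phi> (b j)}"
      using d e by (auto simp: is_drawing_def q_def)
    have aq: "arc q" "path_image q \<subseteq> sphere 0 1"
      using q(1,2) by (auto simp: pathin_def arc_def path_def path_image_def continuous_map_in_subtopology)
    show ?thesis
    proof (cases "q 0 = \<phi> (b i)")
      case True
      then show ?thesis using q aq
        by (intro exI[of _ q]) (auto simp: q_def[symmetric] pathstart_def pathfinish_def path_image_def doubleton_eq_iff)
    next
      case False
      then show ?thesis using q aq
        by (intro exI[of _ "reversepath q"])
          (auto simp: q_def[symmetric] arc_reversepath path_image_def[symmetric] doubleton_eq_iff, auto simp: pathstart_def pathfinish_def)
    qed
  qed
  then obtain p where p: "\<And>i j. i < j \<Longrightarrow> j < 5 \<Longrightarrow> arc (p i j) \<and> pathstart (p i j) = \<phi> (b i) \<and> pathfinish (p i j) = \<phi> (b j) \<and>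
    path_image (p i j) = \<gamma> {b i, b j} ` {0..1} \<and> path_image (p i j) \<subseteq> sphere 0 1"
    by metis
  show False
  proof (rule no_almost_embedding_K5_sphere[where p = p and x = "\<phi> \<circ> b"])
    fix i j k l :: nat assume ij: "i < j" "j < 5" and kl: "k < l" "l < 5" "{i, j} \<inter> {k, l} = {}"
    have "{b i, b j} \<inter> {b k, b l} = {}" using bi ij kl by auto
    then show "path_image (p i j) \<inter> path_image (p k l) = {}"
      using drawing_edges_meet[OF d G E E, of i j k l] p[OF ij] p[OF kl(1,2)] ij kl by auto
  next
    fix i j :: nat assume ij: "i < j" "j < 5"
    show "path (p i j)" "thin (path_image (p i j))" "path_image (p i j) \<subseteq> sphere 0 1"
      "pathstart (p i j) = (\<phi> \<circ> b) i \<and> pathfinish (p i j) = (\<phi> \<circ> b) j"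
      unfolding o_apply using p[OF ij] arc_imp_path thin_arc by blast+
  qed
qed

lemma K5_one_sided_triangle_in_drawing:
  assumes G: "snd G \<subseteq> Pow (fst G)" and K: "clique G K" "card K = 5" "v \<in> K"
    and d: "is_drawing G projective_plane \<phi> \<gamma>"
  shows "\<exists>T\<subseteq>K - {v}. card T = 3 \<and> one_sided (\<Union>e\<in>{e. e \<subseteq> T \<and> card e = 2}. \<gamma> e ` {0..1})"
proof -
  have fin: "finite K" using K(2) by (metis card.infinite zero_neq_numeral)
  then have "card (K - {v}) = 4" "finite (K - {v})" using K by auto
  then obtain b' where b': "bij_betw b' {..<4::nat} (K - {v})"
    using ex_bij_betw_nat_finite[of "K - {v}"] by (auto simp: atLeast0LessThan)
  \<comment> \<open>\<open>v\<close> takes position 4, since the triangle is found among the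
    positions 0 to 3.\<close>
  define b where "b = b'(4 := v)"
  have ins: "{..<5} = insert 4 {..<4::nat}" by auto
  have "bij_betw b {..<4} (K - {v})"
    using bij_betw_cong[of "{..<4}" b b'] b' by (simp add: b_def)
  moreover have "b 4 = v" by (simp add: b_def)
  ultimately have "bij_betw b (insert 4 {..<4}) (insert v (K - {v}))"
    using notIn_Un_bij_betw[of 4 "{..<4}" b "K - {v}"] by simp
  then have b: "bij_betw b {..<5} K" unfolding ins using K(3) by (simp add: insert_absorb)
  have bi: "b i \<noteq> b j" if "i < 5" "j < 5" "i \<noteq> j" for i j
    using b that by (auto simp: bij_betw_def dest: inj_onD)
  have bK: "b i \<in> K" if "i < 5" for i using b that by (auto simp: bij_betw_def)
  have E: "{b i, b j} \<in> snd G" if "i < 5" "j < 5" "i \<noteq> j" for i j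
    using K(1) bi[OF that] bK that unfolding clique_def by auto
  have b_pair: "b ` {i, j} = {b i, b j}" for i j by simp
  have "\<exists>i j k. i < j \<and> j < k \<and> k < 4 \<and> one_sided (\<gamma> (b ` {i, j}) ` {0..1} \<union> \<gamma> (b ` {j, k}) ` {0..1} \<union> \<gamma> (b ` {i, k}) ` {0..1})"
  proof (rule K5_one_sided_triangle[where \<phi> = "\<phi> \<circ> b" and C = "\<lambda>e. \<gamma> (b ` e) ` {0..1}"])
    show "(\<phi> \<circ> b) 0 \<in> antipodal_pair ` sphere 0 1"
    proof -
      have "b 0 \<in> fst G" using bK[of 0] K(1) by (auto simp: clique_def)
      moreover have "\<phi> ` fst G \<subseteq> antipodal_pair ` sphere 0 1"
        using d by (simp add: is_drawing_def topspace_projective_plane)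
      ultimately show ?thesis by (simp only: o_apply image_subset_iff)
    qed
    fix i j x assume ij: "i < (5::nat)" "j < (5::nat)" "i \<noteq> j" and x: "x \<in> sphere 0 1" "antipodal_pair x = (\<phi> \<circ> b) i"
    have \<gamma>: "pathin projective_plane (\<gamma> {b i, b j})" "inj_on (\<gamma> {b i, b j}) {0..1}"
      "{\<gamma> {b i, b j} 0, \<gamma> {b i, b j} 1} = {\<phi> (b i), \<phi> (b j)}"
      using d E[OF ij] by (auto simp: is_drawing_def)
    have "antipodal_pair x \<in> {\<gamma> {b i, b j} 0, \<gamma> {b i, b j} 1}" unfolding \<gamma>(3) using x by simp
    then obtain g where g: "arc g" "path_image g \<subseteq> sphere 0 1" "pathstart g = x"
      "antipodal_pair ` path_image g = \<gamma> {b i, b j} ` {0..1}" "inj_on antipodal_pair (path_image g)"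
      "{antipodal_pair x, antipodal_pair (pathfinish g)} = {\<phi> (b i), \<phi> (b j)}"
      using lift_arc_projective_plane[OF \<gamma>(1,2) x(1)] unfolding \<gamma>(3) by metis
    have "antipodal_pair (pathfinish g) = \<phi> (b j)"
      using g(6) x(2) by (auto simp: doubleton_eq_iff)
    then show "\<exists>g. arc g \<and> path_image g \<subseteq> sphere 0 1 \<and> pathstart g = x \<and>
       antipodal_pair (pathfinish g) = (\<phi> \<circ> b) j \<and>
       antipodal_pair ` path_image g = \<gamma> (b ` {i, j}) ` {0..1} \<and> inj_on antipodal_pair (path_image g)"
      unfolding b_pair using g(1-5) by auto
  next
    fix i j k l :: nat assume ij: "i < 5" "j < 5" "i \<noteq> j" and kl: "k < 5" "l < 5" "k \<noteq> l" and ne: "{i, j} \<noteq> {k, l}"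
    have inj: "inj_on b {..<5}" using b by (simp add: bij_betw_def)
    have sub: "{i, j} \<subseteq> {..<5}" "{k, l} \<subseteq> {..<5}" using ij kl by auto
    have "b ` {i, j} \<noteq> b ` {k, l}" using inj_on_image_eq_iff[OF inj sub] ne by simp
    then have "\<gamma> (b ` {i, j}) ` {0..1} \<inter> \<gamma> (b ` {k, l}) ` {0..1} \<subseteq> \<phi> ` (b ` {i, j} \<inter> b ` {k, l})"
      using E ij kl by (intro drawing_edges_meet[OF d G]) auto
    also have "b ` {i, j} \<inter> b ` {k, l} = b ` ({i, j} \<inter> {k, l})"
      using inj_on_image_Int[OF inj sub] by simp
    finally show "\<gamma> (b ` {i, j}) ` {0..1} \<inter> \<gamma> (b ` {k, l}) ` {0..1} \<subseteq> (\<phi> \<circ> b) ` ({i, j} \<inter> {k, l})"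
      by (simp only: image_comp)
  qed
  then obtain i j k where ijk: "i < j" "j < k" "k < 4"
    and os: "one_sided (\<gamma> {b i, b j} ` {0..1} \<union> \<gamma> {b j, b k} ` {0..1} \<union> \<gamma> {b i, b k} ` {0..1})"
    by auto
  define T where "T = {b i, b j, b k}"
  have dist: "b i \<noteq> b j" "b j \<noteq> b k" "b i \<noteq> b k" using bi ijk by auto
  have "b n \<in> K - {v}" if "n < 4" for n using b' that by (auto simp: b_def bij_betw_def)
  then have "T \<subseteq> K - {v}" unfolding T_def using ijk by simp
  moreover have "card T = 3" using dist by (simp add: T_def)
  moreover have "one_sided (\<Union>e\<in>{e. e \<subseteq> T \<and> card e = 2}. \<gamma> e ` {0..1})"
  proof -
    have "{b i, b j} \<in> {e. e \<subseteq> T \<and> card e = 2}" "{b j, b k} \<in> {e. e \<subseteq> T \<and> card e = 2}"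
      "{b i, b k} \<in> {e. e \<subseteq> T \<and> card e = 2}"
      using dist by (auto simp: T_def)
    then have "\<gamma> {b i, b j} ` {0..1} \<union> \<gamma> {b j, b k} ` {0..1} \<union> \<gamma> {b i, b k} ` {0..1} \<subseteq>
      (\<Union>e\<in>{e. e \<subseteq> T \<and> card e = 2}. \<gamma> e ` {0..1})" by blast
    then show ?thesis using os unfolding one_sided_def by (meson subset_trans)
  qed
  ultimately show ?thesis by blast
qed

text \<open>Vertex-disjoint triangles are drawn disjointly, whereas two one-sided curves always
  meet.\<close>

lemma one_sided_triangles_meet:
  assumes G: "snd G \<subseteq> Pow (fst G)" and d: "is_drawing G projective_plane \<phi> \<gamma>"
    and T: "clique G T" "clique G T'"
    and os: "one_sided (\<Union>e\<in>{e. e \<subseteq> T \<and> card e = 2}. \<gamma> e ` {0..1})"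
      "one_sided (\<Union>e\<in>{e. e \<subseteq> T' \<and> card e = 2}. \<gamma> e ` {0..1})"
  shows "T \<inter> T' \<noteq> {}"
proof
  assume dis: "T \<inter> T' = {}"
  obtain z e e' where e: "e \<subseteq> T" "card e = 2" "z \<in> \<gamma> e ` {0..1}" and e': "e' \<subseteq> T'" "card e' = 2" "z \<in> \<gamma> e' ` {0..1}"
    using one_sided_meet[OF os] by blast
  have "e \<in> snd G" using e T(1) by (auto simp: card_2_iff clique_def)
  moreover have "e' \<in> snd G" using e' T(2) by (auto simp: card_2_iff clique_def)
  moreover have "e \<inter> e' = {}" using dis e e' by blast
  moreover have "e \<noteq> {}" using e(2) by auto
  ultimately show False using drawing_edges_meet[OF d G, of e e'] e(3) e'(3) by blast
qed

text \<open>Each clique has a one-sided triangle avoiding a vertex of choice. Choosing the shared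
  vertices as \<open>v\<close> and \<open>w\<close> makes the two triangles disjoint.\<close>

lemma not_embeds_projective_plane_if_two_K5:
  assumes G: "snd G \<subseteq> Pow (fst G)" and K: "clique G K" "card K = 5" "clique G L" "card L = 5"
    and v: "v \<in> K" "w \<in> L" "(K - {v}) \<inter> (L - {w}) = {}"
  shows "\<not> embeds_in G projective_plane"
proof
  assume "embeds_in G projective_plane"
  then obtain \<phi> \<gamma> where d: "is_drawing G projective_plane \<phi> \<gamma>" using embeds_in_iff_drawing by blast
  obtain T where T: "T \<subseteq> K - {v}" "one_sided (\<Union>e\<in>{e. e \<subseteq> T \<and> card e = 2}. \<gamma> e ` {0..1})"
    using K5_one_sided_triangle_in_drawing[OF G K(1,2) v(1) d] by blast
  obtain U where U: "U \<subseteq> L - {w}" "one_sided (\<Union>e\<in>{e. e \<subseteq> U \<and> card e = 2}. \<gamma> e ` {0..1})"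
    using K5_one_sided_triangle_in_drawing[OF G K(3,4) v(2) d] by blast
  have "clique G T" "clique G U" using K T U clique_subset by blast+
  then show False using one_sided_triangles_meet[OF G d _ _ T(2) U(2)] T U v by blast
qed

text \<open>Outside the triangle \<open>T\<close> at least \<open>7 - 3 = 4\<close> vertices remain.
  Together with one vertex \<open>w\<close> of \<open>T\<close> they form a second
  \<open>K\<^sub>5\<close>, whose triangle avoiding \<open>w\<close> is disjoint from
  \<open>T\<close>.\<close>

lemma not_embeds_projective_plane_if_K7:
  assumes G: "snd G \<subseteq> Pow (fst G)" and K: "clique G K" "card K \<ge> 7"
  shows "\<not> embeds_in G projective_plane"
proof
  assume "embeds_in G projective_plane"
  then obtain \<phi> \<gamma> where d: "is_drawing G projective_plane \<phi> \<gamma>" using embeds_in_iff_drawing by blast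
  obtain L where L: "L \<subseteq> K" "card L = 5" using K(2) obtain_subset_with_card_n[of 5 K] by auto
  then obtain v where v: "v \<in> L" by fastforce
  obtain T where T: "T \<subseteq> L - {v}" "card T = 3" "one_sided (\<Union>e\<in>{e. e \<subseteq> T \<and> card e = 2}. \<gamma> e ` {0..1})"
    using K5_one_sided_triangle_in_drawing[OF G clique_subset[OF K(1) L(1)] L(2) v d] by blast
  have TK: "T \<subseteq> K" using T L by blast
  have "finite T" using T(2) by (metis card.infinite zero_neq_numeral)
  then have "card (K - T) \<ge> 4" using card_Diff_subset[of T K] TK T(2) K(2) by auto
  then obtain M where M: "M \<subseteq> K - T" "card M = 4" by (metis obtain_subset_with_card_n)
  obtain w where w: "w \<in> T" using T(2) by fastforce
  have "finite M" using M(2) by (metis card.infinite zero_neq_numeral)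
  moreover have "w \<notin> M" using M w by blast
  ultimately have "card (insert w M) = 5" using M(2) by simp
  moreover have "insert w M \<subseteq> K" using M w TK by blast
  ultimately obtain U where U: "U \<subseteq> insert w M - {w}" "one_sided (\<Union>e\<in>{e. e \<subseteq> U \<and> card e = 2}. \<gamma> e ` {0..1})"
    using K5_one_sided_triangle_in_drawing[OF G clique_subset[OF K(1)] _ _ d, of "insert w M" w] by blast
  have "clique G T" "clique G U" using K(1) TK U(1) M(1) clique_subset by blast+
  then show False using one_sided_triangles_meet[OF G d _ _ T(3) U(2)] U(1) M(1) by blast
qed

section \<open>Crosscap one\<close>

text \<open>The surfaces over which \<open>crosscap\<close> ranges have points of type
  \<open>(real^3) set\<close>, so the sphere itself is not among them; its singletons form a copy
  that is.\<close>

lemma sphere_homeomorphic_set_type: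
  "\<exists>S :: (real^3) set topology. S homeomorphic_space two_sphere"
proof -
  define S where "S = pullback_topology ((\<lambda>x. {x}) ` sphere (0::real^3) 1) the_elem two_sphere"
  have top: "topspace S = (\<lambda>x. {x}) ` sphere 0 1"
    by (auto simp: S_def topspace_pullback_topology)
  have "homeomorphic_maps S two_sphere the_elem (\<lambda>x. {x})"
    unfolding homeomorphic_maps_def
  proof (intro conjI)
    show "continuous_map S two_sphere the_elem"
      unfolding S_def using continuous_map_pullback[of two_sphere two_sphere id] by simp
    show "continuous_map two_sphere S (\<lambda>x. {x})"
      unfolding S_def by (rule continuous_map_pullback') (auto simp: o_def)
  qed (auto simp: top)
  then show ?thesis
    using homeomorphic_space_def by blast
qed

lemma nonorientable_surface_0: "nonorientable_surface 0 S \<longleftrightarrow> S homeomorphic_space two_sphere"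
  by (auto intro: nonorientable_surface.zero elim: nonorientable_surface.cases)

lemma nonorientable_surface_1: "nonorientable_surface (Suc 0) S \<longleftrightarrow> S homeomorphic_space projective_plane"
  by (auto intro: nonorientable_surface.one elim: nonorientable_surface.cases)

text \<open>The infimum of a nonempty set in \<open>enat\<close> is attained, and the empty set
  would give infinity. So the value 1 means that 1 is admissible and 0 is not; both cases are
  determined up to homeomorphism.\<close>

lemma crosscap_eq_1_iff:
  "crosscap G = 1 \<longleftrightarrow> embeds_in G projective_plane \<and> \<not> embeds_in G two_sphere"
proof -
  define N where "N = {k. \<exists>S. nonorientable_surface k S \<and> embeds_in G S}"
  have 0: "0 \<in> N \<longleftrightarrow> embeds_in G two_sphere"
  proof
    assume "0 \<in> N"
    then show "embeds_in G two_sphere"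
      using embeds_in_homeomorphic[of G] unfolding N_def mem_Collect_eq nonorientable_surface_0 by blast
  next
    assume G: "embeds_in G two_sphere"
    obtain S :: "(real^3) set topology" where S: "S homeomorphic_space two_sphere"
      using sphere_homeomorphic_set_type by blast
    then have "embeds_in G S" using embeds_in_homeomorphic[OF G] homeomorphic_space_sym by blast
    then show "0 \<in> N" using S by (auto simp: N_def nonorientable_surface_0)
  qed
  have 1: "1 \<in> N \<longleftrightarrow> embeds_in G projective_plane"
  proof
    assume "1 \<in> N"
    then show "embeds_in G projective_plane"
      using embeds_in_homeomorphic[of G] unfolding N_def mem_Collect_eq nonorientable_surface_1 One_nat_def by blast
  qed (use homeomorphic_space_refl in \<open>auto simp: N_def nonorientable_surface_1\<close>)
  have "crosscap G = 1 \<longleftrightarrow> 1 \<in> N \<and> 0 \<notin> N"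
  proof
    assume c: "crosscap G = 1"
    then have c': "(INF k\<in>N. enat k) = 1" by (simp add: crosscap_def N_def)
    have "0 \<notin> N"
    proof
      assume "0 \<in> N"
      then have "(INF k\<in>N. enat k) \<le> enat 0" by (rule INF_lower)
      then show False using c' by (simp add: zero_enat_def[symmetric])
    qed
    moreover have "enat ` N \<noteq> {}"
      using c' by (metis Inf_enat_def infinity_ne_i1 image_is_empty)
    then have "(INF k\<in>N. enat k) \<in> enat ` N"
      unfolding Inf_enat_def by (auto intro: LeastI)
    then have "1 \<in> N" using c' by (auto simp: one_enat_def)
    ultimately show "1 \<in> N \<and> 0 \<notin> N" by simp
  next
    assume N: "1 \<in> N \<and> 0 \<notin> N"
    have "(INF k\<in>N. enat k) \<le> 1" using N by (auto intro: INF_lower2 simp: one_enat_def)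
    moreover have "1 \<le> (INF k\<in>N. enat k)"
    proof (rule INF_greatest)
      fix k assume "k \<in> N"
      then have "k \<noteq> 0" using N by metis
      then show "1 \<le> enat k" by (simp add: one_enat_def)
    qed
    ultimately show "crosscap G = 1" by (simp add: crosscap_def N_def)
  qed
  then show ?thesis using 0 1 by simp
qed

section \<open>Geodesic drawings\<close>

text \<open>Its sign tells on which side of the plane through 0, \<open>x\<close> and
  \<open>y\<close> the point \<open>z\<close> lies. It is linear in \<open>z\<close>, so points need
  not be normalised before signs are compared.\<close>

definition det3 :: "real^3 \<Rightarrow> real^3 \<Rightarrow> real^3 \<Rightarrow> real" where
  "det3 x y z = x$1 * (y$2 * z$3 - y$3 * z$2) - x$2 * (y$1 * z$3 - y$3 * z$1) + x$3 * (y$1 * z$2 - y$2 * z$1)"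

lemma det3_linear:
  "det3 x y (\<alpha> *\<^sub>R z + \<beta> *\<^sub>R w) = \<alpha> * det3 x y z + \<beta> * det3 x y w"
  "det3 x y (\<alpha> *\<^sub>R z) = \<alpha> * det3 x y z"
  by (simp_all add: det3_def algebra_simps)

lemma det3_zero [simp]: "det3 x y x = 0" "det3 x y y = 0" "det3 x y 0 = 0"
  by (simp_all add: det3_def algebra_simps)

text \<open>The sign \<open>\<sigma>\<close> selects one of the two geodesics between two points of the projective plane;
  on the sphere it must be \<open>1\<close>. Two geodesics do not cross if the end points of one lie strictly on
  the same side of the plane spanned by the other.\<close>

lemma geodesic_drawing:
  fixes a :: "nat \<Rightarrow> real^3" and \<sigma> :: "nat \<times> nat \<Rightarrow> real" and \<pi> :: "real^3 \<Rightarrow> 'a"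
  assumes gp: "\<And>u v w. u \<in> V \<Longrightarrow> v \<in> V \<Longrightarrow> w \<in> V \<Longrightarrow> u \<noteq> v \<Longrightarrow> v \<noteq> w \<Longrightarrow> u \<noteq> w \<Longrightarrow> det3 (a u) (a v) (a w) \<noteq> 0"
    and third: "\<And>u v. u \<in> V \<Longrightarrow> v \<in> V \<Longrightarrow> \<exists>w\<in>V. w \<noteq> u \<and> w \<noteq> v"
    and E: "\<And>u v. (u, v) \<in> E \<Longrightarrow> u \<in> V \<and> v \<in> V \<and> u < v"
    and sep: "\<And>u v w x. (u, v) \<in> E \<Longrightarrow> (w, x) \<in> E \<Longrightarrow> {u, v} \<inter> {w, x} = {} \<Longrightarrow>
      \<sigma> (w, x) * (det3 (a u) (a v) (a w) * det3 (a u) (a v) (a x)) > 0 \<or>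
      \<sigma> (u, v) * (det3 (a w) (a x) (a u) * det3 (a w) (a x) (a v)) > 0"
    and \<sigma>: "\<And>e. e \<in> E \<Longrightarrow> \<sigma> e = 1 \<or> \<sigma> e = - 1"
    and \<pi>: "continuous_map two_sphere S \<pi>"
      "\<And>x y. x \<in> sphere 0 1 \<Longrightarrow> y \<in> sphere 0 1 \<Longrightarrow> \<pi> x = \<pi> y \<Longrightarrow> x = y \<or> x = - y"
      "\<And>e x. e \<in> E \<Longrightarrow> \<pi> (\<sigma> e *\<^sub>R x) = \<pi> x"
  shows "embeds_in (V, {{u, v} | u v. (u, v) \<in> E}) S"
proof -
  \<comment> \<open>A chord from \<open>a u\<close> to \<open>a v\<close> or to
    \<open>- a v\<close>; \<open>sgn\<close> projects it radially to an arc of a great circle. All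
    comparisons below are made up to a scalar factor, so the normalisation never has to be
    computed.\<close>
  define q where "q u v t = (1 - t) *\<^sub>R a u + (t * \<sigma> (u, v)) *\<^sub>R a v" for u v t
  define \<phi> where "\<phi> u = \<pi> (sgn (a u))" for u
  \<comment> \<open>An edge is a mere set; \<open>Min\<close> and \<open>Max\<close> restore the
    order \<open>u < v\<close> in which \<open>E\<close> lists it.\<close>
  define \<gamma> where "\<gamma> e t = \<pi> (sgn (q (Min e) (Max e) t))" for e t
  have \<sigma>0: "\<sigma> e \<noteq> 0" if "e \<in> E" for e using \<sigma>[OF that] by auto
  have par: "\<exists>m. x = m *\<^sub>R y" if "\<pi> (sgn x) = \<pi> (sgn y)" "x \<noteq> 0" "y \<noteq> 0" for x y
  proof -
    have "sgn x = sgn y \<or> sgn x = - sgn y"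
      using that by (intro \<pi>(2)) (auto simp: norm_sgn)
    moreover have "norm x *\<^sub>R sgn x = x" using that by (simp add: sgn_div_norm)
    ultimately have "norm x *\<^sub>R sgn y = x \<or> norm x *\<^sub>R (- sgn y) = x"
      by metis
    then have "x = (norm x * inverse (norm y)) *\<^sub>R y \<or> x = (- (norm x * inverse (norm y))) *\<^sub>R y"
      by (auto simp: sgn_div_norm)
    then show ?thesis by blast
  qed
  have a0: "a u \<noteq> 0" if u: "u \<in> V" for u
  proof
    assume "a u = 0"
    obtain v where "v \<in> V" "v \<noteq> u" using third[of u u] u by auto
    moreover from this obtain w where "w \<in> V" "w \<noteq> u" "w \<noteq> v" using third[of u v] u by auto
    ultimately show False using gp[of v w u] u \<open>a u = 0\<close> by auto
  qed
  have det_q: "det3 y z (q u v t) = (1 - t) * det3 y z (a u) + t * \<sigma> (u, v) * det3 y z (a v)" for y z u v t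
    by (simp add: q_def det3_linear)
  have vert: "t = 0 \<or> t = 1" if "q u v t = m *\<^sub>R a w" "(u, v) \<in> E" "w \<in> V" for u v t w m
  proof -
    note uv = E[OF that(2)]
    obtain z where z: "z \<in> V" "z \<noteq> u" "z \<noteq> v" using third[of u v] uv by auto
    consider "w = u" | "w = v" | "w \<noteq> u" "w \<noteq> v" by blast
    then show ?thesis
    proof cases
      case 1
      then have "t * \<sigma> (u, v) * det3 (a u) (a z) (a v) = 0"
        using det_q[of "a u" "a z" u v t] by (simp add: that(1) det3_linear)
      then show ?thesis using gp[of u z v] z uv \<sigma>0[OF that(2)] by auto
    next
      case 2
      then have "(1 - t) * det3 (a v) (a z) (a u) = 0"
        using det_q[of "a v" "a z" u v t] by (simp add: that(1) det3_linear)
      then show ?thesis using gp[of v z u] z uv by auto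
    next
      case 3
      then have "m * det3 (a u) (a v) (a w) = 0"
        using det_q[of "a u" "a v" u v t] by (simp add: that(1) det3_linear)
      then have "m = 0" using gp[of u v w] 3 uv that(3) by auto
      then have "t * \<sigma> (u, v) * det3 (a u) (a z) (a v) = 0"
        using det_q[of "a u" "a z" u v t] by (simp add: that(1))
      then show ?thesis using gp[of u z v] z uv \<sigma>0[OF that(2)] by auto
    qed
  qed
  have q0: "q u v t \<noteq> 0" if uv: "(u, v) \<in> E" for u v t
  proof
    assume 0: "q u v t = 0"
    have V: "u \<in> V" "v \<in> V" using E[OF uv] by auto
    have "t = 0 \<or> t = 1" using vert[of u v t 0 u] 0 uv V by simp
    then show False using 0 a0 V \<sigma>0[OF uv] by (auto simp: q_def)
  qed
  have inj: "s = t" if "q u v s = m *\<^sub>R q u v t" and uv: "(u, v) \<in> E" for u v s t m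
  proof -
    note uvV = E[OF uv]
    obtain z where z: "z \<in> V" "z \<noteq> u" "z \<noteq> v" using third[of u v] uvV by auto
    have "det3 (a u) (a z) (a v) \<noteq> 0" "det3 (a v) (a z) (a u) \<noteq> 0"
      using gp[of u z v] gp[of v z u] z uvV by auto
    moreover have "s * \<sigma> (u, v) * det3 (a u) (a z) (a v) = m * (t * \<sigma> (u, v) * det3 (a u) (a z) (a v))"
      using det_q[of "a u" "a z" u v s] det_q[of "a u" "a z" u v t] by (auto simp: that(1) det3_linear)
    moreover have "(1 - s) * det3 (a v) (a z) (a u) = m * ((1 - t) * det3 (a v) (a z) (a u))"
      using det_q[of "a v" "a z" u v s] det_q[of "a v" "a z" u v t] by (auto simp: that(1) det3_linear)
    ultimately have "s = m * t" "1 - s = m * (1 - t)" using \<sigma>0[OF uv] by auto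
    then have "m = 1" by (simp add: algebra_simps)
    then show ?thesis using \<open>s = m * t\<close> by simp
  qed
  have disj: False if eq: "q u v s = m *\<^sub>R q w x t" and e: "(u, v) \<in> E" "(w, x) \<in> E" "(u, v) \<noteq> (w, x)"
    and st: "0 < s" "s < 1" "0 < t" "t < 1" for u v s w x t m
  proof -
    note uv = E[OF e(1)] and wx = E[OF e(2)]
    have m: "m \<noteq> 0" using eq q0[OF e(1)] by auto
    have f: "(1 - t) * det3 (a u) (a v) (a w) + t * \<sigma> (w, x) * det3 (a u) (a v) (a x) = 0"
      using arg_cong[OF eq, of "det3 (a u) (a v)"] m by (simp add: det_q det3_linear)
    have g: "(1 - s) * det3 (a w) (a x) (a u) + s * \<sigma> (u, v) * det3 (a w) (a x) (a v) = 0"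
      using arg_cong[OF eq, of "det3 (a w) (a x)"] m by (simp add: det_q det3_linear)
    \<comment> \<open>\<open>A\<close> and \<open>c * B\<close> have the same strict sign, so no
      point strictly between them is 0; multiplying by \<open>A\<close> makes both terms nonnegative
      and one positive.\<close>
    have pos: "(1 - r) * A + r * c * B \<noteq> 0" if "c * (A * B) > 0" "0 < r" "r < 1" for r c A B :: real
    proof
      assume "(1 - r) * A + r * c * B = 0"
      then have "(1 - r) * (A * A) + r * (c * (A * B)) = 0"
        by (metis (no_types, opaque_lifting) distrib_left mult.assoc mult.left_commute mult_zero_right)
      moreover have "(1 - r) * (A * A) \<ge> 0" "r * (c * (A * B)) > 0" using that by auto
      ultimately show False by linarith
    qed
    show False
    proof (cases "{u, v} \<inter> {w, x} = {}")
      case True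
      then show False using sep[OF e(1,2)] pos f g st by blast
    next
      \<comment> \<open>For edges with one common vertex, that vertex contributes determinant 0, and
        general position keeps the remaining term nonzero in the open range of the
        parameter.\<close>
      case False
      have x: "w \<notin> {u, v} \<Longrightarrow> x \<notin> {u, v} \<Longrightarrow> False" using False by auto
      have "\<not> (w \<in> {u, v} \<and> x \<in> {u, v})" using e(3) uv wx by auto
      then consider "w \<notin> {u, v}" "x \<in> {u, v}" | "w \<in> {u, v}" "x \<notin> {u, v}" using x by blast
      then show False
      proof cases
        case 1
        then have "(1 - t) * det3 (a u) (a v) (a w) = 0" using f by auto
        then show False using gp[of u v w] 1 uv wx st by auto
      next
        case 2
        then have "t * \<sigma> (w, x) * det3 (a u) (a v) (a x) = 0" using f by auto
        then show False using gp[of u v x] 2 uv wx st \<sigma>0[OF e(2)] by auto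
      qed
    qed
  qed
  have mm: "Min {u, v} = u" "Max {u, v} = v" if "(u, v) \<in> E" for u v
    using E[OF that] by auto
  have "is_drawing (V, {{u, v} | u v. (u, v) \<in> E}) S \<phi> \<gamma>"
    unfolding is_drawing_def fst_conv snd_conv
  proof (intro conjI ballI impI)
    show "inj_on \<phi> V"
    proof (rule inj_onI, rule ccontr)
      fix u v assume uv: "u \<in> V" "v \<in> V" "\<phi> u = \<phi> v" "u \<noteq> v"
      then obtain m where l: "a u = m *\<^sub>R a v" using par a0 unfolding \<phi>_def by blast
      obtain w where "w \<in> V" "w \<noteq> u" "w \<noteq> v" using third uv by blast
      then show False using gp[of v w u] uv by (simp add: l det3_linear)
    qed
    have sph: "sgn x \<in> sphere 0 1" if "x \<noteq> 0" for x :: "real^3" using that by (simp add: norm_sgn)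
    have top: "\<pi> x \<in> topspace S" if "x \<in> sphere 0 1" for x
      using \<pi>(1) that by (auto simp: continuous_map_def)
    show "\<phi> ` V \<subseteq> topspace S" using top sph a0 by (auto simp: \<phi>_def)
    fix e assume "e \<in> {{u, v} | u v. (u, v) \<in> E}"
    then obtain u v where e: "e = {u, v}" "(u, v) \<in> E" by blast
    have \<gamma>e: "\<gamma> e = (\<lambda>t. \<pi> (sgn (q u v t)))" by (rule ext) (simp only: \<gamma>_def e(1) mm[OF e(2)])
    show "pathin S (\<gamma> e)"
    proof -
      have "continuous_on {0..1} (\<lambda>t. sgn (q u v t))"
        unfolding sgn_div_norm using q0[OF e(2)] unfolding q_def by (intro continuous_intros) auto
      then have "pathin two_sphere (\<lambda>t. sgn (q u v t))"
        using sph q0[OF e(2)] by (auto simp: pathin_def continuous_map_in_subtopology)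
      from pathin_compose[OF this \<pi>(1)] show ?thesis by (simp only: \<gamma>e o_def)
    qed
    show "inj_on (\<gamma> e) {0..1}"
      unfolding \<gamma>e using par q0[OF e(2)] inj[OF _ e(2)] by (intro inj_onI) blast
    have "sgn (\<sigma> (u, v) *\<^sub>R a v) = \<sigma> (u, v) *\<^sub>R sgn (a v)"
      using \<sigma>[OF e(2)] by (auto simp: sgn_minus)
    then have "\<gamma> e 0 = \<phi> u" "\<gamma> e 1 = \<phi> v"
      using \<pi>(3)[OF e(2)] unfolding \<gamma>e by (simp_all add: q_def \<phi>_def)
    then show "{\<gamma> e 0, \<gamma> e 1} = \<phi> ` e" by (simp add: e(1))
    have "\<gamma> e t \<noteq> \<phi> w" if "t \<in> {0<..<1}" "w \<in> V" for t w
      using par[of "q u v t" "a w"] q0[OF e(2)] a0[OF that(2)] vert[OF _ e(2) that(2)] that(1)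
      unfolding \<gamma>e \<phi>_def by fastforce
    then show "\<gamma> e ` {0<..<1} \<inter> \<phi> ` V = {}" by blast
    fix e' assume "e' \<in> {{u, v} | u v. (u, v) \<in> E}" and ne: "e \<noteq> e'"
    then obtain w x where e': "e' = {w, x}" "(w, x) \<in> E" by blast
    have \<gamma>e': "\<gamma> e' = (\<lambda>t. \<pi> (sgn (q w x t)))" by (rule ext) (simp only: \<gamma>_def e'(1) mm[OF e'(2)])
    have "(u, v) \<noteq> (w, x)" using ne e e' by auto
    then have "\<gamma> e s \<noteq> \<gamma> e' t" if "s \<in> {0<..<1}" "t \<in> {0<..<1}" for s t
      using par[of "q u v s" "q w x t"] q0[OF e(2)] q0[OF e'(2)] disj[OF _ e(2) e'(2)] that
      unfolding \<gamma>e \<gamma>e' by fastforce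
    then show "\<gamma> e ` {0<..<1} \<inter> \<gamma> e' ` {0<..<1} = {}" by blast
  qed
  then show ?thesis using embeds_in_iff_drawing by blast
qed

type_synonym int3 = "int \<times> int \<times> int"

section \<open>Two integer drawings and their evaluation\<close>

text \<open>Over the integers all sign conditions can be evaluated; \<open>vec3_of\<close> then
  carries the result to real vectors.\<close>

fun idet :: "int3 \<Rightarrow> int3 \<Rightarrow> int3 \<Rightarrow> int" where
  "idet (x1, x2, x3) (y1, y2, y3) (z1, z2, z3) =
     x1 * (y2 * z3 - y3 * z2) - x2 * (y1 * z3 - y3 * z1) + x3 * (y1 * z2 - y2 * z1)"

fun vec3_of :: "int3 \<Rightarrow> real^3" where
  "vec3_of (x, y, z) = vector [of_int x, of_int y, of_int z]"

lemma det3_vec3_of: "det3 (vec3_of p) (vec3_of q) (vec3_of r) = of_int (idet p q r)"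
  by (cases p; cases q; cases r) (simp add: det3_def)

definition general_position :: "int3 list \<Rightarrow> bool" where
  "general_position ps \<longleftrightarrow> (\<forall>u\<in>set [0..<length ps]. \<forall>v\<in>set [0..<length ps]. \<forall>w\<in>set [0..<length ps].
     u \<noteq> v \<longrightarrow> v \<noteq> w \<longrightarrow> u \<noteq> w \<longrightarrow> idet (ps ! u) (ps ! v) (ps ! w) \<noteq> 0)"

definition separated_edges :: "int3 list \<Rightarrow> (nat \<times> nat \<times> int) list \<Rightarrow> bool" where
  "separated_edges ps es \<longleftrightarrow> (\<forall>(u, v, r)\<in>set es. \<forall>(w, x, s)\<in>set es. u = w \<or> u = x \<or> v = w \<or> v = x \<or>
     s * (idet (ps ! u) (ps ! v) (ps ! w) * idet (ps ! u) (ps ! v) (ps ! x)) > 0 \<or>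
     r * (idet (ps ! w) (ps ! x) (ps ! u) * idet (ps ! w) (ps ! x) (ps ! v)) > 0)"

text \<open>Listing no pair of ends twice makes the sign a function of the edge, as the real-valued
  \<open>\<sigma>\<close> requires.\<close>

definition valid_edges :: "nat \<Rightarrow> (nat \<times> nat \<times> int) list \<Rightarrow> bool" where
  "valid_edges n es \<longleftrightarrow> distinct (map (\<lambda>(u, v, r). (u, v)) es) \<and> (\<forall>(u, v, r)\<in>set es. u < v \<and> v < n \<and> (r = 1 \<or> r = - 1))"

definition edge_list_graph :: "nat \<Rightarrow> (nat \<times> nat \<times> int) list \<Rightarrow> nat set \<times> nat set set" where
  "edge_list_graph n es = ({..<n}, {{u, v} | u v. \<exists>r. (u, v, r) \<in> set es})"

lemma geodesic_drawing_list:
  fixes \<pi> :: "real^3 \<Rightarrow> 'a"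
  assumes check: "general_position ps" "separated_edges ps es" "valid_edges (length ps) es" "length ps \<ge> 3"
    and \<pi>: "continuous_map two_sphere S \<pi>"
      "\<And>x y. x \<in> sphere 0 1 \<Longrightarrow> y \<in> sphere 0 1 \<Longrightarrow> \<pi> x = \<pi> y \<Longrightarrow> x = y \<or> x = - y"
      "(\<forall>(u, v, r)\<in>set es. r = 1) \<or> (\<forall>x. \<pi> (- x) = \<pi> x)"
  shows "embeds_in (edge_list_graph (length ps) es) S"
proof -
  define E where "E = (\<lambda>(u, v, r). (u, v)) ` set es"
  define \<sigma> :: "nat \<times> nat \<Rightarrow> real" where "\<sigma> e = of_int (THE r. (fst e, snd e, r) \<in> set es)" for e
  have unique: "r = s" if "(u, v, r) \<in> set es" "(u, v, s) \<in> set es" for u v r s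
  proof -
    have "inj_on (\<lambda>(u, v, r). (u, v)) (set es)"
      using check(3) by (auto simp: valid_edges_def distinct_map)
    from inj_onD[OF this _ that] show ?thesis by simp
  qed
  have \<sigma>: "\<sigma> (u, v) = of_int r" if "(u, v, r) \<in> set es" for u v r
  proof -
    have "(THE r. (u, v, r) \<in> set es) = r" using that unique by blast
    then show ?thesis by (simp add: \<sigma>_def)
  qed
  have E: "\<exists>r. (u, v, r) \<in> set es" if "(u, v) \<in> E" for u v
    using that by (auto simp: E_def)
  have "embeds_in ({..<length ps}, {{u, v} | u v. (u, v) \<in> E}) S"
  proof (rule geodesic_drawing[where a = "\<lambda>u. vec3_of (ps ! u)" and \<sigma> = \<sigma> and \<pi> = \<pi>])
    fix u v w assume "u \<in> {..<length ps}" "v \<in> {..<length ps}" "w \<in> {..<length ps}" "u \<noteq> v" "v \<noteq> w" "u \<noteq> w"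
    then show "det3 (vec3_of (ps ! u)) (vec3_of (ps ! v)) (vec3_of (ps ! w)) \<noteq> 0"
      using check(1) by (auto simp: det3_vec3_of general_position_def)
  next
    fix u v assume "u \<in> {..<length ps}" "v \<in> {..<length ps}"
    have "\<exists>w<3. w \<noteq> u \<and> w \<noteq> v" by presburger
    then show "\<exists>w\<in>{..<length ps}. w \<noteq> u \<and> w \<noteq> v" using check(4) by (meson lessThan_iff less_le_trans)
  next
    fix u v assume "(u, v) \<in> E"
    then show "u \<in> {..<length ps} \<and> v \<in> {..<length ps} \<and> u < v"
      using check(3) E by (fastforce simp: valid_edges_def)
  next
    fix u v w x assume e: "(u, v) \<in> E" "(w, x) \<in> E" "{u, v} \<inter> {w, x} = {}"
    obtain r s where rs: "(u, v, r) \<in> set es" "(w, x, s) \<in> set es" using E e by blast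
    have "s * (idet (ps ! u) (ps ! v) (ps ! w) * idet (ps ! u) (ps ! v) (ps ! x)) > 0 \<or>
     r * (idet (ps ! w) (ps ! x) (ps ! u) * idet (ps ! w) (ps ! x) (ps ! v)) > 0"
      using check(2) rs e(3) unfolding separated_edges_def by fastforce
    then show "\<sigma> (w, x) * (det3 (vec3_of (ps ! u)) (vec3_of (ps ! v)) (vec3_of (ps ! w)) * det3 (vec3_of (ps ! u)) (vec3_of (ps ! v)) (vec3_of (ps ! x))) > 0 \<or>
      \<sigma> (u, v) * (det3 (vec3_of (ps ! w)) (vec3_of (ps ! x)) (vec3_of (ps ! u)) * det3 (vec3_of (ps ! w)) (vec3_of (ps ! x)) (vec3_of (ps ! v))) > 0"
      unfolding det3_vec3_of \<sigma>[OF rs(1)] \<sigma>[OF rs(2)] of_int_mult[symmetric] of_int_0_less_iff .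
  next
    fix e assume "e \<in> E"
    then obtain u v r where e: "e = (u, v)" "(u, v, r) \<in> set es" by (auto simp: E_def)
    have r: "r = 1 \<or> r = - 1" using check(3) e by (auto simp: valid_edges_def)
    then show "\<sigma> e = 1 \<or> \<sigma> e = - 1" using \<sigma>[OF e(2)] e(1) by auto
    show "\<pi> (\<sigma> e *\<^sub>R x) = \<pi> x" for x using \<sigma>[OF e(2)] e \<pi>(3) r by auto
  qed (use \<pi>(1,2) in auto)
  moreover have "{{u, v} | u v. (u, v) \<in> E} = {{u, v} | u v. \<exists>r. (u, v, r) \<in> set es}"
    by (force simp: E_def)
  ultimately show ?thesis by (simp add: edge_list_graph_def)
qed

text \<open>A planar straight-line drawing, moved to height \<open>1\<close>.\<close>

definition planar_points :: "int3 list" where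
  "planar_points = [(-2, 2, 1), (0, 28, 1), (-31, -22, 1), (29, -18, 1), (-11, 3, 1), (8, 4, 1), (-1, -10, 1), (1, 7, 1), (4, 7, 1), (2, 11, 1)]"

text \<open>\<open>K\<^sub>4\<close> on 0 to 3, with 4, 5, 6 joined to the three triangles at 0, and
  a second \<open>K\<^sub>4\<close> attached at 0. The vertices 0 to 6 carry the graph of three
  copies of the field with two elements; inside the whole graph there are also two copies of
  \<open>K\<^sub>4\<close> sharing an edge, and two sharing a single vertex.\<close>

definition planar_edges :: "(nat \<times> nat \<times> int) list" where
  "planar_edges = map (\<lambda>(u, v). (u, v, 1)) [(0, 1), (0, 2), (0, 3), (0, 4), (0, 5), (0, 6), (0, 7), (0, 8), (0, 9),
     (1, 2), (1, 3), (1, 4), (1, 5), (2, 3), (2, 4), (2, 6), (3, 5), (3, 6), (7, 8), (7, 9), (8, 9)]"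

lemma planar_checks: "general_position planar_points" "separated_edges planar_points planar_edges"
  "valid_edges (length planar_points) planar_edges"
  by code_simp+

lemma embeds_planar_graph: "embeds_in (edge_list_graph 10 planar_edges) two_sphere"
proof -
  have "embeds_in (edge_list_graph (length planar_points) planar_edges) two_sphere"
    by (rule geodesic_drawing_list[OF planar_checks, where \<pi> = id])
      (auto simp: planar_points_def planar_edges_def)
  moreover have "length planar_points = 10" by (simp add: planar_points_def)
  ultimately show ?thesis by simp
qed

text \<open>The first six points are close to the six axes of the icosahedron.\<close>

definition projective_points :: "int3 list" where
  "projective_points = [(0, 6, 7), (1, -5, 9), (6, 8, 0), (-4, 8, 0), (8, -1, 4), (-8, 0, 5), (4, 1, 9), (8, -3, 9)]"

text \<open>\<open>K\<^sub>6\<close> on 0 to 5 and \<open>K\<^sub>4\<close> on 0, 1, 6, 7, sharing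
  the edge 01: the exact shape needed for a product of rings of order 3 and 4. Without vertex 1 in
  the larger clique it serves the products with a field of order 5. Sign -1 selects the geodesic
  that reaches the antipodal representative of the second end.\<close>

definition projective_edges :: "(nat \<times> nat \<times> int) list" where
  "projective_edges = [(0, 1, 1), (0, 2, 1), (0, 3, 1), (0, 4, 1), (0, 5, 1), (0, 6, 1), (0, 7, 1), (1, 2, -1), (1, 3, -1),
     (1, 4, 1), (1, 5, 1), (1, 6, 1), (1, 7, 1), (2, 3, 1), (2, 4, 1), (2, 5, -1), (3, 4, -1), (3, 5, 1), (4, 5, -1), (6, 7, 1)]"

lemma projective_checks: "general_position projective_points" "separated_edges projective_points projective_edges"
  "valid_edges (length projective_points) projective_edges"
  by code_simp+

lemma embeds_projective_graph: "embeds_in (edge_list_graph 8 projective_edges) projective_plane"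
proof -
  have "embeds_in (edge_list_graph (length projective_points) projective_edges) projective_plane"
  proof (rule geodesic_drawing_list[OF projective_checks, where \<pi> = antipodal_pair])
    show "continuous_map two_sphere projective_plane antipodal_pair"
      using quotient_map_antipodal_pair by (rule quotient_imp_continuous_map)
  qed (auto simp: projective_points_def antipodal_pair_eq_iff)
  moreover have "length projective_points = 8" by (simp add: projective_points_def)
  ultimately show ?thesis by simp
qed

section \<open>The graph of a ring\<close>

lemma nonunits_iff:
  assumes "cring R"
  shows "z \<in> nonunits R \<longleftrightarrow> z \<in> carrier R \<and> (\<forall>r\<in>carrier R. r \<otimes>\<^bsub>R\<^esub> z \<noteq> \<one>\<^bsub>R\<^esub>)"
proof -
  interpret cring R by fact
  show ?thesis unfolding nonunits_def Units_def using m_comm by auto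
qed

lemma mem_cgenideal: "x \<in> PIdl\<^bsub>R\<^esub> z \<longleftrightarrow> (\<exists>r\<in>carrier R. x = r \<otimes>\<^bsub>R\<^esub> z)"
  by (auto simp: cgenideal_def)

lemma cgenideal_nonunits:
  assumes "cring R" "z \<in> nonunits R"
  shows "PIdl\<^bsub>R\<^esub> z \<subseteq> nonunits R"
proof
  interpret cring R by fact
  fix x assume "x \<in> PIdl\<^bsub>R\<^esub> z"
  then obtain r where r: "r \<in> carrier R" "x = r \<otimes>\<^bsub>R\<^esub> z" by (auto simp: mem_cgenideal)
  have z: "z \<in> carrier R" using assms by (simp add: nonunits_iff)
  have "s \<otimes>\<^bsub>R\<^esub> x \<noteq> \<one>\<^bsub>R\<^esub>" if "s \<in> carrier R" for s
  proof -
    have "s \<otimes>\<^bsub>R\<^esub> x = (s \<otimes>\<^bsub>R\<^esub> r) \<otimes>\<^bsub>R\<^esub> z" using that r z m_assoc by simp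
    then show ?thesis using assms that r by (simp add: nonunits_iff)
  qed
  then show "x \<in> nonunits R" using assms r z by (simp add: nonunits_iff)
qed

text \<open>Inclusion of generated ideals becomes membership in a principal ideal. The vertex
  conditions disappear, because multiples of a nonunit are nonunits.\<close>

lemma upper_graph_edge_iff:
  assumes "cring R"
  shows "e \<in> snd (upper_ideal_relation_graph R) \<longleftrightarrow>
    (\<exists>x y. e = {x, y} \<and> x \<noteq> y \<and> (\<exists>z\<in>nonunits R. x \<in> PIdl\<^bsub>R\<^esub> z \<and> y \<in> PIdl\<^bsub>R\<^esub> z))"
proof -
  interpret cring R by fact
  have sub: "Idl\<^bsub>R\<^esub> {x} \<subseteq> Idl\<^bsub>R\<^esub> {z} \<longleftrightarrow> x \<in> PIdl\<^bsub>R\<^esub> z" if "x \<in> carrier R" "z \<in> carrier R" for x z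
  proof
    assume "Idl\<^bsub>R\<^esub> {x} \<subseteq> Idl\<^bsub>R\<^esub> {z}"
    then show "x \<in> PIdl\<^bsub>R\<^esub> z"
      using genideal_self'[OF that(1)] cgenideal_eq_genideal[OF that(2)] by auto
  next
    assume "x \<in> PIdl\<^bsub>R\<^esub> z"
    then show "Idl\<^bsub>R\<^esub> {x} \<subseteq> Idl\<^bsub>R\<^esub> {z}"
      using genideal_minimal[OF cgenideal_ideal[OF that(2)], of "{x}"] cgenideal_eq_genideal[OF that(2)] by simp
  qed
  have car: "x \<in> carrier R" if "x \<in> nonunits R" for x
    using that by (simp add: nonunits_def)
  show ?thesis
  proof
    assume "e \<in> snd (upper_ideal_relation_graph R)"
    then obtain x y z where e: "e = {x, y}" "x \<in> nonunits R" "y \<in> nonunits R" "x \<noteq> y" "z \<in> nonunits R"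
      "Idl\<^bsub>R\<^esub> {x} \<subseteq> Idl\<^bsub>R\<^esub> {z}" "Idl\<^bsub>R\<^esub> {y} \<subseteq> Idl\<^bsub>R\<^esub> {z}"
      unfolding upper_ideal_relation_graph_def upper_ideal_adj_def by auto
    then show "\<exists>x y. e = {x, y} \<and> x \<noteq> y \<and> (\<exists>z\<in>nonunits R. x \<in> PIdl\<^bsub>R\<^esub> z \<and> y \<in> PIdl\<^bsub>R\<^esub> z)"
      using sub[OF car car] by blast
  next
    assume "\<exists>x y. e = {x, y} \<and> x \<noteq> y \<and> (\<exists>z\<in>nonunits R. x \<in> PIdl\<^bsub>R\<^esub> z \<and> y \<in> PIdl\<^bsub>R\<^esub> z)"
    then obtain x y z where e: "e = {x, y}" "x \<noteq> y" "z \<in> nonunits R" "x \<in> PIdl\<^bsub>R\<^esub> z" "y \<in> PIdl\<^bsub>R\<^esub> z"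
      by blast
    have xy: "x \<in> nonunits R" "y \<in> nonunits R" using cgenideal_nonunits[OF assms e(3)] e(4,5) by auto
    then have "upper_ideal_adj R x y"
      unfolding upper_ideal_adj_def using e sub car by auto
    then show "e \<in> snd (upper_ideal_relation_graph R)"
      unfolding upper_ideal_relation_graph_def using e(1) xy by auto
  qed
qed

lemma fst_upper_graph [simp]: "fst (upper_ideal_relation_graph R) = nonunits R"
  by (simp add: upper_ideal_relation_graph_def)

lemma upper_graph_edges: "snd (upper_ideal_relation_graph R) \<subseteq> Pow (fst (upper_ideal_relation_graph R))"
  by (auto simp: upper_ideal_relation_graph_def)

lemma clique_cgenideal:
  assumes "cring R" "z \<in> nonunits R"
  shows "clique (upper_ideal_relation_graph R) (PIdl\<^bsub>R\<^esub> z)"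
  unfolding clique_def upper_graph_edge_iff[OF assms(1)]
  using cgenideal_nonunits[OF assms] assms(2) by auto

lemma embeds_upper_graph_iso:
  assumes "cring R" "cring S" "R \<simeq> S" "embeds_in (upper_ideal_relation_graph S) T"
  shows "embeds_in (upper_ideal_relation_graph R) T"
proof -
  obtain h where h: "h \<in> ring_iso R S" using assms(3) by (auto simp: is_ring_iso_def)
  interpret R: cring R by fact
  interpret S: cring S by fact
  have bij: "bij_betw h (carrier R) (carrier S)" using ring_iso_memE(5)[OF h] .
  then have inj: "inj_on h (carrier R)" by (simp add: bij_betw_def)
  have hc: "h x \<in> carrier S" if "x \<in> carrier R" for x using ring_iso_memE(1)[OF h that] .
  have nu: "h z \<in> nonunits S" if z: "z \<in> nonunits R" for z
  proof -
    have zc: "z \<in> carrier R" using z by (simp add: nonunits_def)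
    have "s \<otimes>\<^bsub>S\<^esub> h z \<noteq> \<one>\<^bsub>S\<^esub>" if s: "s \<in> carrier S" for s
    proof
      assume *: "s \<otimes>\<^bsub>S\<^esub> h z = \<one>\<^bsub>S\<^esub>"
      obtain r where r: "r \<in> carrier R" "s = h r" using s bij by (auto simp: bij_betw_def)
      have "h (r \<otimes>\<^bsub>R\<^esub> z) = h \<one>\<^bsub>R\<^esub>"
        using * ring_iso_memE(2)[OF h r(1) zc] ring_iso_memE(4)[OF h] r(2) by simp
      then have "r \<otimes>\<^bsub>R\<^esub> z = \<one>\<^bsub>R\<^esub>" using inj r zc by (auto dest: inj_onD)
      then show False using z r(1) by (simp add: nonunits_iff[OF assms(1)])
    qed
    then show ?thesis using hc[OF zc] by (simp add: nonunits_iff[OF assms(2)])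
  qed
  have pid: "h x \<in> PIdl\<^bsub>S\<^esub> (h z)" if "x \<in> PIdl\<^bsub>R\<^esub> z" "z \<in> carrier R" for x z
    using that ring_iso_memE(2)[OF h] hc by (force simp: mem_cgenideal)
  show ?thesis
  proof (rule embeds_in_mono[OF assms(4), where f = h])
    show "inj_on h (fst (upper_ideal_relation_graph R))"
      using inj by (rule inj_on_subset) (auto simp: nonunits_def)
    show "h ` fst (upper_ideal_relation_graph R) \<subseteq> fst (upper_ideal_relation_graph S)"
      using nu by auto
    show "snd (upper_ideal_relation_graph R) \<subseteq> Pow (fst (upper_ideal_relation_graph R))"
      by (rule upper_graph_edges)
    fix e assume "e \<in> snd (upper_ideal_relation_graph R)"
    then obtain x y z where e: "e = {x, y}" "x \<noteq> y" "z \<in> nonunits R" "x \<in> PIdl\<^bsub>R\<^esub> z" "y \<in> PIdl\<^bsub>R\<^esub> z"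
      unfolding upper_graph_edge_iff[OF assms(1)] by blast
    have zc: "z \<in> carrier R" using e(3) by (simp add: nonunits_def)
    have "x \<in> carrier R" "y \<in> carrier R" using e(4,5) zc by (auto simp: mem_cgenideal)
    then have "h x \<noteq> h y" using inj e(2) by (auto dest: inj_onD)
    then show "h ` e \<in> snd (upper_ideal_relation_graph S)"
      unfolding upper_graph_edge_iff[OF assms(2)] using e nu pid zc by (intro exI[of _ "h x"] exI[of _ "h y"]) auto
  qed
qed

lemma not_embeds_projective_plane_if_large_principal_ideal:
  assumes "cring R" "z \<in> nonunits R" "card (PIdl\<^bsub>R\<^esub> z) \<ge> 7"
  shows "\<not> embeds_in (upper_ideal_relation_graph R) projective_plane"
  using not_embeds_projective_plane_if_K7[OF upper_graph_edges clique_cgenideal[OF assms(1,2)] assms(3)] .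

text \<open>Three private elements and two common ones make a \<open>K\<^sub>5\<close> in each
  ideal. A third common element allows the two cliques to share \<open>a\<close> only.\<close>

lemma not_embeds_projective_plane_if_two_principal_ideals:
  assumes R: "cring R" "finite (carrier R)" and z: "z \<in> nonunits R" "w \<in> nonunits R"
    and card: "card (PIdl\<^bsub>R\<^esub> z - PIdl\<^bsub>R\<^esub> w) \<ge> 3" "card (PIdl\<^bsub>R\<^esub> w - PIdl\<^bsub>R\<^esub> z) \<ge> 3" "card (PIdl\<^bsub>R\<^esub> z \<inter> PIdl\<^bsub>R\<^esub> w) \<ge> 3"
  shows "\<not> embeds_in (upper_ideal_relation_graph R) projective_plane"
proof -
  obtain A where A: "A \<subseteq> PIdl\<^bsub>R\<^esub> z - PIdl\<^bsub>R\<^esub> w" "card A = 3" using obtain_subset_with_card_n[OF card(1)] by metis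
  obtain B where B: "B \<subseteq> PIdl\<^bsub>R\<^esub> w - PIdl\<^bsub>R\<^esub> z" "card B = 3" using obtain_subset_with_card_n[OF card(2)] by metis
  obtain C where C: "C \<subseteq> PIdl\<^bsub>R\<^esub> z \<inter> PIdl\<^bsub>R\<^esub> w" "card C = 3" using obtain_subset_with_card_n[OF card(3)] by metis
  then obtain a b c where abc: "C = {a, b, c}" "a \<noteq> b" "b \<noteq> c" "a \<noteq> c" by (auto simp: card_3_iff)
  have fin: "finite A" "finite B" using A B by (metis card.infinite zero_neq_numeral)+
  have notin: "a \<notin> A" "b \<notin> A" "a \<notin> B" "c \<notin> B" using A B C abc by auto
  show ?thesis
  proof (rule not_embeds_projective_plane_if_two_K5[OF upper_graph_edges])
    show "clique (upper_ideal_relation_graph R) (insert a (insert b A))"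
      by (rule clique_subset[OF clique_cgenideal[OF R(1) z(1)]]) (use A C abc in auto)
    show "clique (upper_ideal_relation_graph R) (insert a (insert c B))"
      by (rule clique_subset[OF clique_cgenideal[OF R(1) z(2)]]) (use B C abc in auto)
    show "card (insert a (insert b A)) = 5" "card (insert a (insert c B)) = 5"
      using fin notin abc A(2) B(2) by simp_all
    show "(insert a (insert b A) - {a}) \<inter> (insert a (insert c B) - {a}) = {}"
      using A B notin abc C by auto
  qed auto
qed

section \<open>Nonunits and principal ideals of a product\<close>

lemma RDirProd_simps [simp]:
  "carrier (RDirProd R S) = carrier R \<times> carrier S"
  "\<one>\<^bsub>RDirProd R S\<^esub> = (\<one>\<^bsub>R\<^esub>, \<one>\<^bsub>S\<^esub>)"
  "\<zero>\<^bsub>RDirProd R S\<^esub> = (\<zero>\<^bsub>R\<^esub>, \<zero>\<^bsub>S\<^esub>)"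
  "(a, b) \<otimes>\<^bsub>RDirProd R S\<^esub> (c, d) = (a \<otimes>\<^bsub>R\<^esub> c, b \<otimes>\<^bsub>S\<^esub> d)"
  "(a, b) \<oplus>\<^bsub>RDirProd R S\<^esub> (c, d) = (a \<oplus>\<^bsub>R\<^esub> c, b \<oplus>\<^bsub>S\<^esub> d)"
  by (auto simp: RDirProd_def DirProd_def monoid.defs)

lemma RDirProd_cring:
  assumes "cring R" "cring S"
  shows "cring (RDirProd R S)"
proof -
  interpret R: cring R by fact
  interpret S: cring S by fact
  interpret P: ring "RDirProd R S" by (rule RDirProd_ring) unfold_locales
  show ?thesis
    by unfold_locales (auto simp: R.m_comm S.m_comm)
qed

lemma RDirProd_nonunits:
  assumes "cring R" "cring S"
  shows "(a, b) \<in> nonunits (RDirProd R S) \<longleftrightarrow>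
    a \<in> nonunits R \<and> b \<in> carrier S \<or> a \<in> carrier R \<and> b \<in> nonunits S"
  unfolding nonunits_iff[OF assms(1)] nonunits_iff[OF assms(2)] nonunits_iff[OF RDirProd_cring[OF assms]]
  by fastforce

lemma RDirProd_cgenideal: "PIdl\<^bsub>RDirProd R S\<^esub> (a, b) = (PIdl\<^bsub>R\<^esub> a) \<times> (PIdl\<^bsub>S\<^esub> b)"
  unfolding cgenideal_def by (auto 0 4)

lemma cgenideal_one:
  assumes "cring R"
  shows "PIdl\<^bsub>R\<^esub> \<one>\<^bsub>R\<^esub> = carrier R"
proof -
  interpret cring R by fact
  show ?thesis by (force simp: cgenideal_def)
qed

lemma cgenideal_zero:
  assumes "cring R"
  shows "PIdl\<^bsub>R\<^esub> \<zero>\<^bsub>R\<^esub> = {\<zero>\<^bsub>R\<^esub>}"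
proof -
  interpret cring R by fact
  show ?thesis by (force simp: cgenideal_def)
qed

section \<open>Idempotents\<close>

definition trivial_idempotents :: "('a, 'b) ring_scheme \<Rightarrow> bool" where
  "trivial_idempotents R \<longleftrightarrow> (\<forall>e\<in>carrier R. e \<otimes>\<^bsub>R\<^esub> e = e \<longrightarrow> e = \<zero>\<^bsub>R\<^esub> \<or> e = \<one>\<^bsub>R\<^esub>)"

lemma nonunits_mult_closed:
  fixes R (structure)
  assumes "cring R" "r \<in> carrier R" "x \<in> nonunits R"
  shows "r \<otimes> x \<in> nonunits R"
  by (rule subsetD[OF cgenideal_nonunits[OF assms(1,3)]]) (use assms(2) in \<open>auto simp: mem_cgenideal\<close>)

text \<open>The powers of \<open>x\<close> are eventually periodic, and an exponent beyond the
  preperiod that is a multiple of the period can be doubled without changing the power.\<close>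

lemma power_idempotent_exists:
  fixes R (structure)
  assumes "cring R" "finite (carrier R)" and x: "x \<in> carrier R"
  shows "\<exists>n::nat. n > 0 \<and> (x [^]\<^bsub>R\<^esub> n) \<otimes>\<^bsub>R\<^esub> (x [^]\<^bsub>R\<^esub> n) = x [^]\<^bsub>R\<^esub> n"
proof -
  interpret cring R by fact
  have "range (\<lambda>n::nat. x [^] n) \<subseteq> carrier R" using x by auto
  then have "\<not> inj (\<lambda>n::nat. x [^] n)"
    using finite_subset[OF _ assms(2)] finite_imageD[of "\<lambda>n::nat. x [^] n" UNIV] infinite_UNIV_nat by blast
  then obtain i j :: nat where ij: "i < j" "x [^] i = x [^] j"
    unfolding inj_def by (metis linorder_neqE_nat)
  define p where "p = j - i"
  have p: "p > 0" "x [^] (i + p) = x [^] i" using ij by (simp_all add: p_def)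
  have step: "x [^] (m + p) = x [^] m" if "i \<le> m" for m
  proof -
    have "x [^] (m + p) = x [^] (i + p) \<otimes> x [^] (m - i)"
      using that x by (simp only: nat_pow_mult) (simp add: algebra_simps)
    also have "\<dots> = x [^] m" using that x by (simp only: p(2) nat_pow_mult) simp
    finally show ?thesis .
  qed
  have mult: "x [^] (m + k * p) = x [^] m" if "i \<le> m" for m k
  proof (induction k)
    case (Suc k)
    have "x [^] (m + Suc k * p) = x [^] ((m + k * p) + p)" by (simp add: algebra_simps)
    then show ?case using step[of "m + k * p"] that Suc by simp
  qed simp
  \<comment> \<open>A multiple of the period \<open>p\<close> that is at least the preperiod
    \<open>i\<close>; the successor keeps it positive when \<open>i = 0\<close>.\<close>
  define n where "n = Suc i * p"
  have "i \<le> n" "n > 0" using p(1) by (auto simp: n_def intro: le_trans[of _ "i * p"])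
  moreover have "x [^] (n + Suc i * p) = x [^] n" using mult \<open>i \<le> n\<close> by blast
  then have "x [^] n \<otimes> x [^] n = x [^] n" using x by (simp only: n_def nat_pow_mult)
  ultimately show ?thesis by blast
qed

text \<open>Some positive power is idempotent, hence \<open>\<zero>\<close> or
  \<open>\<one>\<close>; the latter would make \<open>x\<close> a unit.\<close>

lemma nonunit_nilpotent:
  fixes R (structure)
  assumes R: "cring R" "finite (carrier R)" "trivial_idempotents R" and x: "x \<in> nonunits R"
  shows "\<exists>n::nat. x [^]\<^bsub>R\<^esub> n = \<zero>\<^bsub>R\<^esub>"
proof -
  interpret cring R by fact
  have xc: "x \<in> carrier R" using x by (simp add: nonunits_def)
  obtain n :: nat where n: "n > 0" "(x [^] n) \<otimes> (x [^] n) = x [^] n"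
    using power_idempotent_exists[OF R(1,2) xc] by blast
  then consider "x [^] n = \<zero>" | "x [^] n = \<one>"
    using R(3) xc unfolding trivial_idempotents_def by blast
  then show ?thesis
  proof cases
    case 2
    have "x [^] n = x [^] (n - 1) \<otimes> x" using n(1) nat_pow_Suc[of x "n - 1"] by simp
    then have "False" using 2 x xc unfolding nonunits_iff[OF R(1)] by auto
    then show ?thesis ..
  qed blast
qed

text \<open>If both were nonunits, both would be nilpotent. But nilpotency of \<open>x\<close> makes
  \<open>\<one> \<ominus> x\<close> cancellable, so none of its powers vanishes.\<close>

lemma one_minus_nonunit:
  fixes R (structure)
  assumes R: "cring R" "finite (carrier R)" "trivial_idempotents R" "\<one>\<^bsub>R\<^esub> \<noteq> \<zero>\<^bsub>R\<^esub>"
    and x: "x \<in> nonunits R"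
  shows "\<one>\<^bsub>R\<^esub> \<ominus>\<^bsub>R\<^esub> x \<notin> nonunits R"
proof
  interpret cring R by fact
  assume y: "\<one> \<ominus> x \<in> nonunits R"
  have xc: "x \<in> carrier R" using x by (simp add: nonunits_def)
  obtain n :: nat where n: "x [^] n = \<zero>" using nonunit_nilpotent[OF R(1-3) x] ..
  obtain m :: nat where m: "(\<one> \<ominus> x) [^] m = \<zero>" using nonunit_nilpotent[OF R(1-3) y] ..
  have inj: "a = \<zero>" if a: "a \<in> carrier R" "(\<one> \<ominus> x) \<otimes> a = \<zero>" for a
  proof -
    have "a \<ominus> x \<otimes> a = \<zero>" using a xc by (simp add: l_distr a_minus_def l_minus)
    then have ax: "a = x \<otimes> a" using a xc by simp
    have "a = x [^] k \<otimes> a" for k :: nat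
    proof (induction k)
      case (Suc k)
      have "x [^] Suc k \<otimes> a = x [^] k \<otimes> (x \<otimes> a)" using xc a by (simp add: m_assoc)
      then show ?case using Suc ax by simp
    qed (use a in simp)
    from this[of n] show ?thesis using n a by simp
  qed
  have "(\<one> \<ominus> x) [^] k \<noteq> \<zero>" for k :: nat
  proof (induction k)
    case (Suc k)
    have "(\<one> \<ominus> x) [^] Suc k = (\<one> \<ominus> x) \<otimes> (\<one> \<ominus> x) [^] k"
      using xc by (simp add: m_comm)
    then show ?case using Suc inj[of "(\<one> \<ominus> x) [^] k"] xc by auto
  qed (use R(4) in simp)
  then show False using m by blast
qed

text \<open>A unit sum can be scaled to \<open>\<one>\<close>, which would write
  \<open>\<one>\<close> as a sum of two nonunits.\<close>

lemma nonunits_add_closed: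
  fixes R (structure)
  assumes R: "cring R" "finite (carrier R)" "trivial_idempotents R" "\<one>\<^bsub>R\<^esub> \<noteq> \<zero>\<^bsub>R\<^esub>"
    and x: "x \<in> nonunits R" "y \<in> nonunits R"
  shows "x \<oplus>\<^bsub>R\<^esub> y \<in> nonunits R"
proof (rule ccontr)
  interpret cring R by fact
  assume no: "x \<oplus> y \<notin> nonunits R"
  have c: "x \<in> carrier R" "y \<in> carrier R" using x by (simp_all add: nonunits_def)
  then obtain r where r: "r \<in> carrier R" "r \<otimes> (x \<oplus> y) = \<one>"
    using no unfolding nonunits_iff[OF R(1)] by auto
  have rx: "r \<otimes> x \<in> nonunits R" "r \<otimes> y \<in> nonunits R"
    using nonunits_mult_closed[OF R(1) r(1)] x by auto
  have "\<one> = r \<otimes> y \<oplus> r \<otimes> x" using r c by (simp add: r_distr a_comm)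
  then have "\<one> \<ominus> r \<otimes> x = r \<otimes> y" using r(1) c by (simp add: a_minus_def a_assoc r_neg)
  then show False using one_minus_nonunit[OF R rx(1)] rx(2) by simp
qed

text \<open>Closed under addition, the nonunits form an ideal that contains every proper ideal. Read
  backwards, this turns non-locality into a nontrivial idempotent.\<close>

lemma local_ring_if_trivial_idempotents:
  fixes R (structure)
  assumes R: "cring R" "finite (carrier R)" "trivial_idempotents R" "\<one>\<^bsub>R\<^esub> \<noteq> \<zero>\<^bsub>R\<^esub>"
  shows "local_ring R"
proof -
  interpret cring R by fact
  have mult: "r \<otimes> x \<in> nonunits R" if "r \<in> carrier R" "x \<in> nonunits R" for r x
    using nonunits_mult_closed[OF R(1) that] .
  have car: "x \<in> carrier R" if "x \<in> nonunits R" for x using that by (simp add: nonunits_def)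
  have mult': "x \<otimes> r \<in> nonunits R" if "r \<in> carrier R" "x \<in> nonunits R" for r x
    using mult[OF that] m_comm[OF car[OF that(2)] that(1)] by simp
  have zero: "\<zero> \<in> nonunits R" using R(4) by (simp add: nonunits_iff[OF R(1)])
  have neg: "\<ominus> x \<in> nonunits R" if "x \<in> nonunits R" for x
    using mult[OF _ that, of "\<ominus> \<one>"] car[OF that] by (simp add: l_minus)
  have ideal: "ideal (nonunits R) R"
  proof (rule idealI)
    show "subgroup (nonunits R) (add_monoid R)"
      by (rule add.subgroupI) (use car zero neg nonunits_add_closed[OF R] in \<open>auto simp: a_inv_def\<close>)
  qed (use mult mult' ring_axioms in auto)
  have one: "\<one> \<notin> nonunits R" by (simp add: nonunits_def)
  have proper: "I \<subseteq> nonunits R" if "ideal I R" "carrier R \<noteq> I" for I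
  proof
    interpret I: ideal I R by fact
    fix x assume x: "x \<in> I"
    show "x \<in> nonunits R"
    proof (rule ccontr)
      assume "x \<notin> nonunits R"
      then obtain r where "r \<in> carrier R" "r \<otimes> x = \<one>"
        using x I.a_subset unfolding nonunits_iff[OF R(1)] by blast
      then have "\<one> \<in> I" using I.I_l_closed[OF x] by metis
      then show False using that(2) I.one_imp_carrier by simp
    qed
  qed
  have "maximalideal (nonunits R) R"
  proof (rule maximalidealI[OF ideal])
    show "carrier R \<noteq> nonunits R" using one by auto
    show "J = nonunits R \<or> J = carrier R" if "ideal J R" "nonunits R \<subseteq> J" "J \<subseteq> carrier R" for J
      using proper[OF that(1)] that(2) by blast
  qed
  moreover have "M = nonunits R" if M: "maximalideal M R" for M
  proof -
    interpret M: maximalideal M R by fact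
    have "M \<subseteq> nonunits R" using proper[OF M.is_ideal M.I_notcarr] .
    then show ?thesis using M.I_maximal[OF ideal] one car by blast
  qed
  ultimately show ?thesis unfolding local_ring_def by blast
qed

section \<open>Splitting a ring by an idempotent\<close>

text \<open>The ring \<open>e R\<close> with \<open>e\<close> as its unity, on the element type of
  \<open>R\<close>, so that a factor can be split again.\<close>

definition corner :: "('a, 'b) ring_scheme \<Rightarrow> 'a \<Rightarrow> 'a ring" where
  "corner R e = \<lparr>carrier = {x \<in> carrier R. e \<otimes>\<^bsub>R\<^esub> x = x}, monoid.mult = mult R, one = e, zero = \<zero>\<^bsub>R\<^esub>, add = add R\<rparr>"

lemma corner_simps [simp]:
  "carrier (corner R e) = {x \<in> carrier R. e \<otimes>\<^bsub>R\<^esub> x = x}" "mult (corner R e) = mult R" "\<one>\<^bsub>corner R e\<^esub> = e"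
  "\<zero>\<^bsub>corner R e\<^esub> = \<zero>\<^bsub>R\<^esub>" "add (corner R e) = add R"
  by (simp_all add: corner_def)

lemma corner_cring:
  fixes R (structure)
  assumes "cring R" "e \<in> carrier R" "e \<otimes>\<^bsub>R\<^esub> e = e"
  shows "cring (corner R e)"
proof -
  interpret cring R by fact
  have neg: "\<exists>y. y \<in> carrier R \<and> e \<otimes> y = y \<and> y \<oplus> x = \<zero>"
    "\<exists>y. y \<in> carrier R \<and> e \<otimes> y = y \<and> x \<oplus> y = \<zero>" if "x \<in> carrier R" "e \<otimes> x = x" for x
    using that assms(2) by (auto intro!: exI[of _ "\<ominus> x"] simp: r_minus l_neg r_neg)
  show ?thesis
  proof (rule cringI)
    show "abelian_group (corner R e)"
      by (rule abelian_groupI) (use assms(2) neg in \<open>auto simp: r_distr a_ac\<close>)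
    show "comm_monoid (corner R e)"
      by (rule comm_monoidI) (use assms(2,3) in \<open>auto simp: m_assoc[symmetric] intro: m_comm\<close>)
  qed (use assms(2) in \<open>auto simp: l_distr\<close>)
qed

text \<open>Peirce decomposition by the orthogonal idempotents \<open>e\<close> and
  \<open>f\<close>: \<open>x\<close> corresponds to its two components, and addition is the inverse
  map.\<close>

lemma corner_decomposition:
  fixes R (structure)
  assumes "cring R" "e \<in> carrier R" "e \<otimes>\<^bsub>R\<^esub> e = e"
  defines "f \<equiv> \<one>\<^bsub>R\<^esub> \<ominus>\<^bsub>R\<^esub> e"
  shows "f \<in> carrier R" "f \<otimes>\<^bsub>R\<^esub> f = f" "R \<simeq> RDirProd (corner R e) (corner R f)"
proof -
  interpret cring R by fact
  show f: "f \<in> carrier R" using assms(2) by (simp add: f_def)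
  have ef: "e \<otimes> f = \<zero>" using assms(2,3) by (simp add: f_def a_minus_def r_distr r_minus r_neg)
  then have fe: "f \<otimes> e = \<zero>" using f assms(2) m_comm by simp
  have sum: "e \<oplus> f = \<one>" using assms(2) by (simp add: f_def a_minus_def a_ac r_neg2 a_lcomm[of e] r_neg)
  show ff: "f \<otimes> f = f"
  proof -
    have "f = (e \<oplus> f) \<otimes> f" using sum f by simp
    then show ?thesis using ef f assms(2) by (simp add: l_distr)
  qed
  have split: "e \<otimes> x \<oplus> f \<otimes> x = x" if "x \<in> carrier R" for x
    using that assms(2) f by (simp add: l_distr[symmetric] sum)
  have "(\<lambda>x. (e \<otimes> x, f \<otimes> x)) \<in> ring_iso R (RDirProd (corner R e) (corner R f))"
  proof (rule ring_iso_memI)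
    fix x y assume xy: "x \<in> carrier R" "y \<in> carrier R"
    have "g \<otimes> (x \<otimes> y) = (g \<otimes> x) \<otimes> (g \<otimes> y)" if "g \<in> carrier R" "g \<otimes> g = g" for g
    proof -
      have "(g \<otimes> x) \<otimes> (g \<otimes> y) = (g \<otimes> g) \<otimes> (x \<otimes> y)" using that(1) xy by (simp add: m_ac)
      then show ?thesis using that by simp
    qed
    then show "(e \<otimes> (x \<otimes> y), f \<otimes> (x \<otimes> y)) = (e \<otimes> x, f \<otimes> x) \<otimes>\<^bsub>RDirProd (corner R e) (corner R f)\<^esub> (e \<otimes> y, f \<otimes> y)"
      using assms(2,3) f ff by simp
    show "(e \<otimes> (x \<oplus> y), f \<otimes> (x \<oplus> y)) = (e \<otimes> x, f \<otimes> x) \<oplus>\<^bsub>RDirProd (corner R e) (corner R f)\<^esub> (e \<otimes> y, f \<otimes> y)"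
      using assms(2) f xy by (simp add: r_distr)
  next
    show "bij_betw (\<lambda>x. (e \<otimes> x, f \<otimes> x)) (carrier R) (carrier (RDirProd (corner R e) (corner R f)))"
    proof (rule bij_betw_byWitness[where f' = "\<lambda>(x, y). x \<oplus> y"])
      show "\<forall>z\<in>carrier (RDirProd (corner R e) (corner R f)).
          (e \<otimes> (case z of (x, y) \<Rightarrow> x \<oplus> y), f \<otimes> (case z of (x, y) \<Rightarrow> x \<oplus> y)) = z"
      proof clarsimp
        fix x y assume x: "x \<in> carrier R" "e \<otimes> x = x" and y: "y \<in> carrier R" "f \<otimes> y = y"
        have "e \<otimes> y = (e \<otimes> f) \<otimes> y" "f \<otimes> x = (f \<otimes> e) \<otimes> x"
          using x y assms(2) f by (simp_all add: m_assoc)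
        then show "e \<otimes> (x \<oplus> y) = x \<and> f \<otimes> (x \<oplus> y) = y"
          using x y assms(2) f ef fe by (simp add: r_distr)
      qed
    qed (use split assms(2,3) f ff in \<open>auto simp: m_assoc[symmetric]\<close>)
  qed (use assms(2,3) f ff in \<open>auto simp: m_assoc[symmetric]\<close>)
  then show "R \<simeq> RDirProd (corner R e) (corner R f)" by (auto simp: is_ring_iso_def)
qed

lemma nontrivial_decomposition:
  fixes R :: "('a, 'b) ring_scheme" (structure)
  assumes R: "cring R" "finite (carrier R)" "\<not> trivial_idempotents R"
  obtains A B :: "'a ring" where "cring A" "finite (carrier A)" "\<one>\<^bsub>A\<^esub> \<noteq> \<zero>\<^bsub>A\<^esub>"
    "cring B" "finite (carrier B)" "\<one>\<^bsub>B\<^esub> \<noteq> \<zero>\<^bsub>B\<^esub>" "R \<simeq> RDirProd A B"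
proof -
  interpret cring R by fact
  obtain e where e: "e \<in> carrier R" "e \<otimes> e = e" "e \<noteq> \<zero>" "e \<noteq> \<one>"
    using R(3) by (auto simp: trivial_idempotents_def)
  note d = corner_decomposition[OF R(1) e(1,2)]
  have "\<one> \<ominus> e \<noteq> \<zero>" using e by simp
  then show thesis
    using that[of "corner R e" "corner R (\<one> \<ominus> e)"] corner_cring[OF R(1) e(1,2)] corner_cring[OF R(1) d(1,2)] d(3) e(3) R(2)
    by simp
qed

section \<open>Rings with few elements\<close>

lemma card_cgenideal_dvd:
  fixes R (structure)
  assumes "cring R" "finite (carrier R)" "z \<in> carrier R"
  shows "card (PIdl z) dvd card (carrier R)"
proof -
  interpret cring R by fact
  have "subgroup (PIdl z) (add_monoid R)"
    using cgenideal_ideal[OF assms(3)] ideal.axioms(1) additive_subgroup.a_subgroup by blast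
  then show ?thesis
    using add.lagrange_finite[of "PIdl z"] assms(2) by (metis dvd_triv_right order_def partial_object.select_convs(1))
qed

lemma zero_mem_cgenideal: "cring R \<Longrightarrow> z \<in> carrier R \<Longrightarrow> {\<zero>\<^bsub>R\<^esub>, z} \<subseteq> PIdl\<^bsub>R\<^esub> z"
proof -
  assume "cring R" and z: "z \<in> carrier R"
  then interpret cring R by simp
  show ?thesis
    using cgenideal_self[OF z] additive_subgroup.zero_closed[OF ideal.axioms(1)[OF cgenideal_ideal[OF z]]] by simp
qed

lemma one_not_zero_if_card:
  fixes R (structure)
  assumes "cring R" "card (carrier R) \<ge> 2"
  shows "\<one> \<noteq> \<zero>"
proof
  interpret cring R by fact
  assume "\<one> = \<zero>"
  then have "carrier R = {\<zero>}" by (rule one_zeroD)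
  then show False using assms(2) by simp
qed

lemma zero_nonunit:
  fixes R (structure)
  assumes "cring R" "\<one> \<noteq> \<zero>"
  shows "\<zero> \<in> nonunits R"
proof -
  interpret cring R by fact
  show ?thesis using assms(2) by (simp add: nonunits_iff[OF assms(1)])
qed

text \<open>A principal ideal is an additive subgroup, so its order is 1 or \<open>p\<close>; a
  nonzero nonunit excludes 1, and order \<open>p\<close> would put \<open>\<one>\<close> into the
  ideal.\<close>

lemma nonunits_prime_card:
  fixes R (structure)
  assumes R: "cring R" "card (carrier R) = p" "Factorial_Ring.prime (p::nat)"
  shows "nonunits R = {\<zero>}"
proof -
  interpret cring R by fact
  have fin: "finite (carrier R)" using R(2,3) by (metis card.infinite not_prime_0)
  have one: "\<one> \<noteq> \<zero>" by (rule one_not_zero_if_card[OF R(1)]) (use R(2,3) prime_ge_2_nat in auto)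
  have "z = \<zero>" if z: "z \<in> nonunits R" for z
  proof (rule ccontr)
    assume nz: "z \<noteq> \<zero>"
    have zc: "z \<in> carrier R" using z by (simp add: nonunits_def)
    have sub: "PIdl z \<subseteq> carrier R" using cgenideal_nonunits[OF R(1) z] by (auto simp: nonunits_def)
    have "card {\<zero>, z} \<le> card (PIdl z)"
      by (rule card_mono[OF finite_subset[OF sub fin] zero_mem_cgenideal[OF R(1) zc]])
    then have "card (PIdl z) \<noteq> 1" using nz by simp
    then have "card (PIdl z) = card (carrier R)"
      using card_cgenideal_dvd[OF R(1) fin zc] R(2,3) by (metis prime_nat_iff)
    then have "PIdl z = carrier R" using card_subset_eq[OF fin sub] by simp
    then show False using cgenideal_nonunits[OF R(1) z] by (auto simp: nonunits_def)
  qed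
  then show ?thesis using zero_nonunit[OF R(1) one] by blast
qed

lemma field_if_nonunits_zero:
  fixes R (structure)
  assumes "cring R" "nonunits R = {\<zero>}"
  shows "field R"
proof -
  interpret cring R by fact
  show ?thesis
    using assms(2) Units_closed by (intro cring_fieldI) (auto simp: nonunits_def)
qed

lemma Cauchy_additive:
  fixes R (structure)
  assumes R: "ring R" "finite (carrier R)" "Factorial_Ring.prime (p::nat)" "card (carrier R) = p * m"
  shows "\<exists>x\<in>carrier R. x \<noteq> \<zero> \<and> [p] \<cdot> x = \<zero>"
proof -
  interpret ring R by fact
  obtain H where H: "subgroup H (add_monoid R)" "card H = p"
    using sylow_thm[OF R(3) add.is_group, of 1 m] R(2,4) by (auto simp: order_def)
  have "H \<noteq> {\<zero>}" using H(2) R(3) by auto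
  moreover have "\<zero> \<in> H" using subgroup.one_closed[OF H(1)] by simp
  ultimately obtain x where x: "x \<in> H" "x \<noteq> \<zero>" by blast
  have xc: "x \<in> carrier R" using x(1) subgroup.subset[OF H(1)] by auto
  interpret H: group "(add_monoid R)\<lparr>carrier := H\<rparr>"
    using subgroup.subgroup_is_group[OF H(1) add.is_group] .
  have "x [^]\<^bsub>(add_monoid R)\<lparr>carrier := H\<rparr>\<^esub> order ((add_monoid R)\<lparr>carrier := H\<rparr>) = \<zero>"
    using H.pow_order_eq_1[of x] x(1) by simp
  then have "x [^]\<^bsub>add_monoid R\<^esub> p = \<zero>"
    using H(2) by (simp add: order_def nat_pow_def)
  then show ?thesis using x(2) xc by (auto simp: add_pow_def)
qed

text \<open>As 9 and 3 agree modulo 6, three times \<open>\<one>\<close> is idempotent. It is not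
  \<open>\<zero>\<close> because of an element of additive order 2, and not \<open>\<one>\<close>
  because of one of order 3.\<close>

lemma card_6_idempotents:
  fixes R (structure)
  assumes R: "cring R" "card (carrier R) = 6"
  shows "\<not> trivial_idempotents R"
proof
  interpret cring R by fact
  assume triv: "trivial_idempotents R"
  have fin: "finite (carrier R)" using R(2) by (metis card.infinite zero_neq_numeral)
  obtain x where x: "x \<in> carrier R" "x \<noteq> \<zero>" "[(2::nat)] \<cdot> x = \<zero>"
    using Cauchy_additive[OF ring_axioms fin, of 2 3] R(2) by auto
  obtain y where y: "y \<in> carrier R" "y \<noteq> \<zero>" "[(3::nat)] \<cdot> y = \<zero>"
    using Cauchy_additive[OF ring_axioms fin, of 3 2] R(2) by auto
  have mult: "[k] \<cdot> a = ([k] \<cdot> \<one>) \<otimes> a" if "a \<in> carrier R" for k :: nat and a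
    using add_pow_ldistr[of \<one> a k] that by simp
  have six: "[(6::nat)] \<cdot> \<one> = \<zero>"
    using add.pow_order_eq_1[of \<one>] R(2) by (simp add: order_def)
  have add: "[(m + n)] \<cdot> \<one> = [m] \<cdot> \<one> \<oplus> [n] \<cdot> \<one>" for m n :: nat
    by (simp add: add.nat_pow_mult)
  have "([(3::nat)] \<cdot> \<one>) \<otimes> ([(3::nat)] \<cdot> \<one>) = [(3 * 3 :: nat)] \<cdot> \<one>"
    using add_pow_ldistr[of \<one> "[(3::nat)] \<cdot> \<one>" 3] add.nat_pow_pow[of \<one> 3 3] by simp
  also have "\<dots> = [(3::nat)] \<cdot> \<one>" using add[of 6 3] six by simp
  finally consider "[(3::nat)] \<cdot> \<one> = \<zero>" | "[(3::nat)] \<cdot> \<one> = \<one>"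
    using triv unfolding trivial_idempotents_def by auto
  then show False
  proof cases
    case 1
    then have "[(3::nat)] \<cdot> x = \<zero>" using mult[OF x(1)] x(1) by simp
    moreover have "[(2 + 1::nat)] \<cdot> x = [(2::nat)] \<cdot> x \<oplus> x"
      using add.nat_pow_mult[OF x(1), of 2 1] x(1) by simp
    ultimately show False using x by simp
  next
    case 2
    have "[(3::nat)] \<cdot> y = y" using mult[OF y(1)] 2 y(1) by simp
    then show False using y by simp
  qed
qed

text \<open>The nonunits form an additive subgroup that contains \<open>\<zero>\<close> but not
  \<open>\<one>\<close>, so their number is a proper divisor of 4.\<close>

lemma nonunits_card_4:
  fixes R (structure)
  assumes R: "cring R" "card (carrier R) = 4" "trivial_idempotents R"
  shows "nonunits R = {\<zero>} \<or> card (nonunits R) = 2"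
proof -
  interpret cring R by fact
  have fin: "finite (carrier R)" using R(2) by (metis card.infinite zero_neq_numeral)
  have one: "\<one> \<noteq> \<zero>" by (rule one_not_zero_if_card[OF R(1)]) (use R(2) in simp)
  have sub: "nonunits R \<subseteq> carrier R" "\<one> \<notin> nonunits R" by (auto simp: nonunits_def)
  have zero: "\<zero> \<in> nonunits R" using zero_nonunit[OF R(1) one] .
  have neg: "\<ominus> x \<in> nonunits R" if "x \<in> nonunits R" for x
  proof -
    have "x \<in> carrier R" using that sub by auto
    then show ?thesis using nonunits_mult_closed[OF R(1) _ that, of "\<ominus> \<one>"] by (simp add: l_minus)
  qed
  have "subgroup (nonunits R) (add_monoid R)"
    by (rule add.subgroupI) (use sub zero neg nonunits_add_closed[OF R(1) fin R(3) one] in \<open>auto simp: a_inv_def\<close>)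
  then have "card (nonunits R) dvd 4"
    using add.lagrange_finite[of "nonunits R"] fin R(2) by (metis dvd_triv_right order_def partial_object.select_convs(1))
  moreover have "card (nonunits R) < 4"
    using psubset_card_mono[OF fin] sub one_closed R(2) by (metis psubsetI)
  moreover have "card (nonunits R) \<noteq> 3"
    using \<open>card (nonunits R) dvd 4\<close> by auto
  moreover have "card (nonunits R) \<noteq> 0"
    using zero finite_subset[OF sub(1) fin] by auto
  ultimately consider "card (nonunits R) = 1" | "card (nonunits R) = 2" by linarith
  then show ?thesis
    using zero by cases (auto simp: card_1_singleton_iff)
qed

text \<open>\<open>\<one>\<close> has additive order \<open>n\<close>, so its multiples exhaust the
  ring. The hypothesis is about this order rather than primality of \<open>n\<close>, so as to cover
  order 4 as well.\<close>

lemma iso_residue_ring: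
  fixes R (structure)
  assumes R: "cring R" "card (carrier R) = n" "n \<ge> 2"
    and ord: "\<And>k. 0 < k \<Longrightarrow> k < n \<Longrightarrow> [(k::nat)] \<cdot> \<one> \<noteq> \<zero>"
  shows "R \<simeq> residue_ring (int n)"
proof -
  interpret cring R by fact
  interpret res: residues "int n" "residue_ring (int n)"
    using R(3) by unfold_locales simp_all
  have fin: "finite (carrier R)" using R(2,3) by (metis card.infinite not_numeral_le_zero)
  define f where "f k = [(nat k)] \<cdot> \<one>" for k :: int
  have n0: "[n] \<cdot> \<one> = \<zero>"
    using add.pow_order_eq_1[of \<one>] R(2) by (simp add: order_def)
  have add: "[(a + b)] \<cdot> \<one> = [a] \<cdot> \<one> \<oplus> [b] \<cdot> \<one>" for a b :: nat
    by (simp add: add.nat_pow_mult)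
  have mult: "[(a * b)] \<cdot> \<one> = [a] \<cdot> \<one> \<otimes> [b] \<cdot> \<one>" for a b :: nat
    using add_pow_ldistr[of \<one> "[b] \<cdot> \<one>" a] add.nat_pow_pow[of \<one> a b] by (simp add: mult.commute)
  have md: "[(m mod n)] \<cdot> \<one> = [m] \<cdot> \<one>" for m :: nat
  proof -
    have "[m] \<cdot> \<one> = [(m mod n + n * (m div n))] \<cdot> \<one>" by simp
    also have "\<dots> = [(m mod n)] \<cdot> \<one>" unfolding add mult n0 by simp
    finally show ?thesis ..
  qed
  have car: "carrier (residue_ring (int n)) = {0..int n - 1}" by (simp add: residue_ring_def)
  have inj: "inj_on f {0..int n - 1}"
  proof -
    have less: "f a \<noteq> f b" if "0 \<le> a" "a < b" "b < int n" for a b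
    proof
      assume "f a = f b"
      moreover have "nat b = nat a + nat (b - a)" using that by simp
      ultimately have "[(nat a)] \<cdot> \<one> = [(nat a)] \<cdot> \<one> \<oplus> [(nat (b - a))] \<cdot> \<one>"
        unfolding f_def add[symmetric] by simp
      then have "[(nat (b - a))] \<cdot> \<one> = \<zero>" by simp
      then show False using ord[of "nat (b - a)"] that by simp
    qed
    show ?thesis
      by (rule inj_onI) (metis less atLeastAtMost_iff linorder_neqE_linordered_idom zle_diff1_eq)
  qed
  have "f \<in> ring_iso (residue_ring (int n)) R"
  proof (rule ring_iso_memI)
    fix x y assume "x \<in> carrier (residue_ring (int n))" "y \<in> carrier (residue_ring (int n))"
    then have xy: "0 \<le> x" "0 \<le> y" by (auto simp: car)
    show "f (x \<otimes>\<^bsub>residue_ring (int n)\<^esub> y) = f x \<otimes> f y"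
      using xy md[of "nat x * nat y"] by (simp add: residue_ring_def f_def mult nat_mod_distrib nat_mult_distrib)
    show "f (x \<oplus>\<^bsub>residue_ring (int n)\<^esub> y) = f x \<oplus> f y"
      using xy md[of "nat x + nat y"] by (simp add: residue_ring_def f_def add nat_mod_distrib nat_add_distrib)
  next
    have "f ` {0..int n - 1} \<subseteq> carrier R" by (auto simp: f_def)
    moreover have "card (f ` {0..int n - 1}) = card (carrier R)"
      using card_image[OF inj] R(2) by simp
    ultimately have "f ` {0..int n - 1} = carrier R" using card_subset_eq[OF fin] by blast
    then show "bij_betw f (carrier (residue_ring (int n))) (carrier R)"
      using inj by (simp add: bij_betw_def car)
  qed (auto simp: f_def residue_ring_def)
  then have "residue_ring (int n) \<simeq> R" by (auto simp: is_ring_iso_def)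
  then show ?thesis by (rule ring_iso_sym[OF cring.axioms(1)[OF res.cring]])
qed

lemma prime_card_iso_residue_ring:
  fixes R (structure)
  assumes R: "cring R" "card (carrier R) = p" "Factorial_Ring.prime (p::nat)"
  shows "R \<simeq> residue_ring (int p)"
proof (rule iso_residue_ring[OF R(1,2) prime_ge_2_nat[OF R(3)]])
  interpret cring R by fact
  have one: "\<one> \<noteq> \<zero>" by (rule one_not_zero_if_card[OF R(1)]) (use R(2,3) prime_ge_2_nat in auto)
  fix k :: nat assume k: "0 < k" "k < p"
  show "[k] \<cdot> \<one> \<noteq> \<zero>"
  proof
    assume k0: "[k] \<cdot> \<one> = \<zero>"
    have p0: "[p] \<cdot> \<one> = \<zero>"
      using add.pow_order_eq_1[of \<one>] R(2) by (simp add: order_def)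
    have "coprime p k" using k R(3) by (simp add: prime_imp_coprime nat_dvd_not_less)
    then obtain a b where "k * a = p * b + 1"
      using bezout_nat[of k p] k by (auto simp: coprime_commute)
    then have *: "[(k * a)] \<cdot> \<one> = [(p * b)] \<cdot> \<one> \<oplus> \<one>"
      using add.nat_pow_mult[of \<one> "p * b" 1] by simp
    have zero: "[(m * n)] \<cdot> \<one> = \<zero>" if "[m] \<cdot> \<one> = \<zero>" for m n :: nat
      using add.nat_pow_pow[of \<one> n m] that by simp
    show False using * zero[OF k0, of a] zero[OF p0, of b] one by simp
  qed
qed

section \<open>Local rings of order four\<close>

text \<open>The pair \<open>(a, b)\<close> stands for a + b X with X squared equal to 0, and
  \<open>\<noteq>\<close> is addition modulo 2. This finite model mediates between the polynomial
  quotient and an abstract ring of order four.\<close>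

definition dual_numbers_Z2 :: "(bool \<times> bool) ring" where
  "dual_numbers_Z2 = \<lparr>carrier = UNIV, monoid.mult = \<lambda>(a, b) (c, d). (a \<and> c, (a \<and> d) \<noteq> (b \<and> c)),
     one = (True, False), zero = (False, False), add = \<lambda>(a, b) (c, d). (a \<noteq> c, b \<noteq> d)\<rparr>"

lemma dual_numbers_Z2_cring: "cring dual_numbers_Z2"
proof (rule cringI)
  show "abelian_group dual_numbers_Z2"
  proof (rule abelian_groupI)
    fix x assume "x \<in> carrier dual_numbers_Z2"
    show "\<exists>y\<in>carrier dual_numbers_Z2. y \<oplus>\<^bsub>dual_numbers_Z2\<^esub> x = \<zero>\<^bsub>dual_numbers_Z2\<^esub>"
      by (cases x, rule bexI[of _ x]) (auto simp: dual_numbers_Z2_def)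
  qed (auto simp: dual_numbers_Z2_def)
  show "comm_monoid dual_numbers_Z2"
    by (rule comm_monoidI) (auto simp: dual_numbers_Z2_def)
qed (auto simp: dual_numbers_Z2_def)

lemma iso_dual_numbers_Z2:
  fixes R (structure)
  assumes R: "cring R" "card (carrier R) = 4" and two: "\<one> \<oplus> \<one> = \<zero>"
    and z: "z \<in> carrier R" "z \<noteq> \<zero>" "z \<noteq> \<one>" "z \<otimes> z = \<zero>"
  shows "R \<simeq> dual_numbers_Z2"
proof -
  interpret cring R by fact
  have fin: "finite (carrier R)" using R(2) by (metis card.infinite zero_neq_numeral)
  have one: "\<one> \<noteq> \<zero>" by (rule one_not_zero_if_card[OF R(1)]) (use R(2) in simp)
  have dbl: "x \<oplus> x = \<zero>" if "x \<in> carrier R" for x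
  proof -
    have "x \<oplus> x = (\<one> \<oplus> \<one>) \<otimes> x" using that by (simp add: l_distr del: two)
    then show ?thesis using two that by simp
  qed
  have dbl2: "x \<oplus> (x \<oplus> y) = y" if "x \<in> carrier R" "y \<in> carrier R" for x y
    using that dbl by (simp add: a_assoc[symmetric])
  define f where "f = (\<lambda>(a, b). (if a then \<one> else \<zero>) \<oplus> (if b then z else \<zero>))"
  have oz: "\<one> \<oplus> z \<noteq> \<zero>" "\<one> \<oplus> z \<noteq> \<one>" "\<one> \<oplus> z \<noteq> z"
    using dbl2[of \<one> z] z one by auto
  have "f \<in> ring_iso dual_numbers_Z2 R"
  proof (rule ring_iso_memI)
    fix x y :: "bool \<times> bool"
    show "f x \<in> carrier R" using z by (auto simp: f_def split: prod.splits)
    show "f (x \<otimes>\<^bsub>dual_numbers_Z2\<^esub> y) = f x \<otimes> f y"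
      using z dbl dbl2 by (cases x; cases y) (auto simp: f_def dual_numbers_Z2_def l_distr r_distr a_ac)
    show "f (x \<oplus>\<^bsub>dual_numbers_Z2\<^esub> y) = f x \<oplus> f y"
      using z dbl dbl2 by (cases x; cases y) (auto simp: f_def dual_numbers_Z2_def a_ac)
  next
    have inj: "inj f"
    proof (rule injI)
      fix x y assume eq: "f x = f y"
      have vals: "f (False, False) = \<zero>" "f (True, False) = \<one>" "f (False, True) = z" "f (True, True) = \<one> \<oplus> z"
        using z(1) by (simp_all add: f_def)
      note ne = one one[symmetric] z(2,3) z(2,3)[symmetric] oz oz[symmetric]
      obtain a b c d where "x = (a, b)" "y = (c, d)" by (metis prod.exhaust)
      then show "x = y"
        using eq by (cases a; cases b; cases c; cases d) (simp_all only: vals ne)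
    qed
    have "f ` UNIV \<subseteq> carrier R" using z by (auto simp: f_def split: prod.splits)
    moreover have "card (f ` UNIV) = card (carrier R)"
      using card_image[OF inj] R(2) by (simp add: card_UNIV_bool UNIV_Times_UNIV[symmetric] card_cartesian_product del: UNIV_Times_UNIV)
    ultimately have "f ` UNIV = carrier R" using card_subset_eq[OF fin] by blast
    then show "bij_betw f (carrier dual_numbers_Z2) (carrier R)"
      using inj by (simp add: bij_betw_def dual_numbers_Z2_def)
  qed (use z in \<open>auto simp: f_def dual_numbers_Z2_def\<close>)
  then have "dual_numbers_Z2 \<simeq> R" by (auto simp: is_ring_iso_def)
  then show ?thesis by (rule ring_iso_sym[OF cring.axioms(1)[OF dual_numbers_Z2_cring]])
qed

text \<open>The only nonzero nonunit \<open>z\<close> has square \<open>\<zero>\<close>, since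
  \<open>z \<otimes> z = z\<close> would be a nontrivial idempotent. If
  \<open>\<one> \<oplus> \<one>\<close> vanishes, \<open>\<one>\<close> and \<open>z\<close> span
  the dual numbers; otherwise \<open>\<one>\<close> has additive order 4.\<close>

lemma card_4_nonfield_iso:
  fixes R (structure)
  assumes R: "cring R" "card (carrier R) = 4" "trivial_idempotents R" "card (nonunits R) = 2"
  shows "R \<simeq> residue_ring 4 \<or> R \<simeq> dual_numbers_Z2"
proof -
  interpret cring R by fact
  have one: "\<one> \<noteq> \<zero>" by (rule one_not_zero_if_card[OF R(1)]) (use R(2) in simp)
  have zero: "\<zero> \<in> nonunits R" using zero_nonunit[OF R(1) one] .
  obtain z where z: "nonunits R = {\<zero>, z}" "z \<noteq> \<zero>"
  proof -
    obtain a b where "nonunits R = {a, b}" "a \<noteq> b" using R(4) unfolding card_2_iff by blast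
    then show thesis using zero that[of a] that[of b] by auto
  qed
  have zc: "z \<in> carrier R" "z \<noteq> \<one>" using z by (auto simp: nonunits_def)
  have "z \<otimes> z \<in> {\<zero>, z}"
    using nonunits_mult_closed[OF R(1) zc(1), of z] z(1) by simp
  moreover have "z \<otimes> z \<noteq> z" using R(3) z(2) zc unfolding trivial_idempotents_def by auto
  ultimately have zz: "z \<otimes> z = \<zero>" by simp
  show ?thesis
  proof (cases "\<one> \<oplus> \<one> = \<zero>")
    case True
    then show ?thesis using iso_dual_numbers_Z2[OF R(1,2) True zc(1) z(2) zc(2) zz] by simp
  next
    case False
    have four: "[(4::nat)] \<cdot> \<one> = \<zero>"
      using add.pow_order_eq_1[of \<one>] R(2) by (simp add: order_def)
    have one': "[(1::nat)] \<cdot> \<one> = \<one>" by simp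
    have two: "[(2::nat)] \<cdot> \<one> = \<one> \<oplus> \<one>" using add.nat_pow_mult[of \<one> 1 1] by (simp add: numeral_2_eq_2)
    have three: "[(3::nat)] \<cdot> \<one> \<oplus> \<one> = \<zero>" using add.nat_pow_mult[of \<one> 3 1] four by simp
    have "R \<simeq> residue_ring (int 4)"
    proof (rule iso_residue_ring[OF R(1,2)])
      fix k :: nat assume "0 < k" "k < 4"
      then consider "k = 1" | "k = 2" | "k = 3" by linarith
      then show "[k] \<cdot> \<one> \<noteq> \<zero>"
        using one one' two three False by cases auto
    qed simp
    then show ?thesis by simp
  qed
qed

text \<open>The list of rings describes the field of order 4 as some field on natural numbers, so a
  factor of another type has to be transported there.\<close>

lemma field_nat_copy:
  fixes R (structure)
  assumes "field R" "finite (carrier R)"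
  shows "\<exists>F :: nat ring. field F \<and> card (carrier F) = card (carrier R) \<and> R \<simeq> F"
proof -
  interpret field R by fact
  obtain f :: "'a \<Rightarrow> nat" where f: "inj_on f (carrier R)"
    using finite_imp_inj_to_nat_seg[OF assms(2)] by blast
  have iso: "R \<simeq> image_ring f R" using inj_imp_image_ring_iso[OF f] by (auto simp: is_ring_iso_def)
  then show ?thesis
    using inj_imp_image_ring_is_field[OF f] ring_iso_same_card[OF iso] by metis
qed

text \<open>\<open>h\<close> reads off the two lowest coefficients; it is onto, and its kernel
  consists of the multiples of the square of the variable.\<close>

lemma Z2_X_mod_X_squared_iso:
  "cring Z2_X_mod_X_squared" "Z2_X_mod_X_squared \<simeq> dual_numbers_Z2"
proof -
  define K where "K = residue_ring 2"
  have "residues_prime 2" by unfold_locales (rule two_is_prime_nat)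
  then have "field (residue_ring (int 2))" by (rule residues_prime.is_field)
  then interpret F: field K by (simp add: K_def)
  have K: "carrier K = {0, 1}" "\<one>\<^bsub>K\<^esub> = 1" "\<zero>\<^bsub>K\<^esub> = 0"
    "\<And>x y. x \<otimes>\<^bsub>K\<^esub> y = (x * y) mod 2" "\<And>x y. x \<oplus>\<^bsub>K\<^esub> y = (x + y) mod 2"
    by (auto simp: K_def residue_ring_def)
  define P where "P = poly_ring K"
  interpret P: cring P
    unfolding P_def by (rule F.univ_poly_is_cring[OF F.carrier_is_subring])
  interpret D: cring dual_numbers_Z2 by (rule dual_numbers_Z2_cring)
  have set_P: "set p \<subseteq> carrier K" if "p \<in> carrier P" for p
    using that F.polynomial_in_carrier[OF F.carrier_is_subring] unfolding P_def univ_poly_carrier[symmetric] by blast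
  have co: "F.coeff p i = 0 \<or> F.coeff p i = 1" if "p \<in> carrier P" for p i
    using F.coeff_in_carrier[OF set_P[OF that]] K(1) by blast
  define h where "h p = (F.coeff p 0 = 1, F.coeff p 1 = 1)" for p
  have "h \<in> ring_hom P dual_numbers_Z2"
  proof (rule ring_hom_memI)
    fix p q assume pq: "p \<in> carrier P" "q \<in> carrier P"
    have add: "F.coeff (p \<oplus>\<^bsub>P\<^esub> q) = (\<lambda>i. F.coeff p i \<oplus>\<^bsub>K\<^esub> F.coeff q i)"
      using F.poly_add_coeff[OF set_P[OF pq(1)] set_P[OF pq(2)]] by (simp add: P_def univ_poly_add)
    show "h (p \<oplus>\<^bsub>P\<^esub> q) = h p \<oplus>\<^bsub>dual_numbers_Z2\<^esub> h q"
      using co[OF pq(1), of 0] co[OF pq(1), of 1] co[OF pq(2), of 0] co[OF pq(2), of 1]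
      by (auto simp: h_def add K dual_numbers_Z2_def)
    have mult: "F.coeff (p \<otimes>\<^bsub>P\<^esub> q) = (\<lambda>i. \<Oplus>\<^bsub>K\<^esub>k\<in>{..i}. F.coeff p k \<otimes>\<^bsub>K\<^esub> F.coeff q (i - k))"
      using F.poly_mult_coeff[OF set_P[OF pq(1)] set_P[OF pq(2)]] by (simp add: P_def univ_poly_mult)
    have c: "F.coeff p i \<in> carrier K" "F.coeff q i \<in> carrier K" for i
      using set_P pq by auto
    have m0: "F.coeff (p \<otimes>\<^bsub>P\<^esub> q) 0 = F.coeff p 0 \<otimes>\<^bsub>K\<^esub> F.coeff q 0"
      unfolding mult using c by simp
    have "{..1::nat} = insert 1 {0}" by auto
    then have m1: "F.coeff (p \<otimes>\<^bsub>P\<^esub> q) 1 = (F.coeff p 1 \<otimes>\<^bsub>K\<^esub> F.coeff q 0) \<oplus>\<^bsub>K\<^esub> (F.coeff p 0 \<otimes>\<^bsub>K\<^esub> F.coeff q 1)"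
      unfolding mult using c F.finsum_insert[of "{0}" 1 "\<lambda>k. F.coeff p k \<otimes>\<^bsub>K\<^esub> F.coeff q (1 - k)"] by simp
    show "h (p \<otimes>\<^bsub>P\<^esub> q) = h p \<otimes>\<^bsub>dual_numbers_Z2\<^esub> h q"
      using co[OF pq(1), of 0] co[OF pq(1), of 1] co[OF pq(2), of 0] co[OF pq(2), of 1]
      unfolding h_def m0 m1 by (auto simp: K dual_numbers_Z2_def)
  next
    show "h \<one>\<^bsub>P\<^esub> = \<one>\<^bsub>dual_numbers_Z2\<^esub>"
      by (simp add: h_def P_def univ_poly_one K dual_numbers_Z2_def)
  qed (simp add: dual_numbers_Z2_def)
  then interpret h: ring_hom_ring P dual_numbers_Z2 h
    by (intro ring_hom_ringI2) unfold_locales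
  have mem: "[1] \<in> carrier P" "[1, 0] \<in> carrier P" "[1, 1] \<in> carrier P" "[] \<in> carrier P"
    unfolding P_def univ_poly_carrier[symmetric] polynomial_def by (auto simp: K)
  have surj: "h ` carrier P = carrier dual_numbers_Z2"
  proof -
    have "h [1] = (True, False)" "h [1, 0] = (False, True)" "h [1, 1] = (True, True)" "h [] = (False, False)"
      by (simp_all add: h_def K)
    then have "(a, b) \<in> h ` carrier P" for a b
      using mem by (cases a; cases b) (metis image_eqI)+
    then show ?thesis by (auto simp: dual_numbers_Z2_def)
  qed
  let ?X2 = "X\<^bsub>K\<^esub> [^]\<^bsub>P\<^esub> (2::nat)"
  have X: "X\<^bsub>K\<^esub> \<in> carrier P" unfolding P_def by (rule F.var_closed(1)[OF F.carrier_is_subring])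
  have X2: "?X2 \<in> carrier P" using X by simp
  have X2_mult: "?X2 = X\<^bsub>K\<^esub> \<otimes>\<^bsub>P\<^esub> X\<^bsub>K\<^esub>" using X by (simp add: numeral_2_eq_2)
  have hX2: "h ?X2 = \<zero>\<^bsub>dual_numbers_Z2\<^esub>"
  proof -
    have "h X\<^bsub>K\<^esub> = (False, True)" by (simp add: h_def var_def K)
    then show ?thesis unfolding X2_mult h.hom_mult[OF X X] by (simp add: dual_numbers_Z2_def)
  qed
  have kernel: "a_kernel P dual_numbers_Z2 h = Idl\<^bsub>P\<^esub> {?X2}"
  proof
    show "Idl\<^bsub>P\<^esub> {?X2} \<subseteq> a_kernel P dual_numbers_Z2 h"
    proof (rule P.genideal_minimal[OF h.kernel_is_ideal])
      have "?X2 \<in> a_kernel P dual_numbers_Z2 h" unfolding a_kernel_def' using X2 hX2 by blast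
      then show "{?X2} \<subseteq> a_kernel P dual_numbers_Z2 h" by blast
    qed
    show "a_kernel P dual_numbers_Z2 h \<subseteq> Idl\<^bsub>P\<^esub> {?X2}"
    proof
      fix p assume "p \<in> a_kernel P dual_numbers_Z2 h"
      then have p: "p \<in> carrier P" "h p = \<zero>\<^bsub>dual_numbers_Z2\<^esub>"
        unfolding a_kernel_def' by blast+
      then have "h p = (False, False)" by (simp add: dual_numbers_Z2_def)
      with co[OF p(1), of 0] co[OF p(1), of 1] have c: "F.coeff p 0 = 0" "F.coeff p 1 = 0"
        by (auto simp: h_def)
      have poly: "polynomial\<^bsub>K\<^esub> (carrier K) p" using p(1) by (simp add: P_def univ_poly_carrier)
      have "\<exists>q\<in>carrier P. p = q \<otimes>\<^bsub>P\<^esub> ?X2"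
      proof (cases "p = []")
        case True
        have "[] \<otimes>\<^bsub>P\<^esub> ?X2 = []"
          using P.l_null[OF X2] by (simp add: P_def univ_poly_zero)
        then show ?thesis using True mem(4) by force
      next
        case False
        then have lead: "hd p \<noteq> 0" using poly by (simp add: polynomial_def K)
        \<comment> \<open>Coefficient lists start with the leading coefficient. At length 1 or 2
          that nonzero entry would be one of the two vanishing coefficients.\<close>
        have n: "length p \<noteq> 1" "length p \<noteq> 2"
        proof -
          have "F.coeff p (length p - 1) \<noteq> 0" using F.lead_coeff_simp[OF False] lead by simp
          then show "length p \<noteq> 1" "length p \<noteq> 2" using c by auto
        qed
        then have len: "length p > 2" using False by (cases "length p") auto
        \<comment> \<open>Low coefficients stand at the end, so \<open>p\<close> ends in
          \<open>[0, 0]\<close>; multiplying by the variable appends a 0, and dropping the two zeros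
          divides by its square.\<close>
        define q where "q = take (length p - 2) p"
        have "p ! (length p - 1) = 0" "p ! (length p - 2) = 0"
          using F.coeff_nth[of 0 p] F.coeff_nth[of 1 p] c len False by (simp_all add: numeral_2_eq_2)
        then have "drop (length p - 2) p = [0, 0]"
          using len by (intro nth_equalityI) (auto simp: nth_Cons' less_Suc_eq numeral_2_eq_2)
        then have pq: "p = q @ [0, 0]" unfolding q_def by (metis append_take_drop_id)
        have q0: "q \<noteq> []" using len by (auto simp: q_def)
        have qc: "q \<in> carrier P"
          unfolding P_def univ_poly_carrier[symmetric]
          using poly pq q0 by (auto simp: polynomial_def)
        have "q \<otimes>\<^bsub>P\<^esub> X\<^bsub>K\<^esub> = q @ [0]"
          using F.poly_mult_var[OF F.carrier_is_subring] qc q0 by (simp add: P_def K)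
        moreover from this have "(q @ [0]) \<otimes>\<^bsub>P\<^esub> X\<^bsub>K\<^esub> = p"
          using F.poly_mult_var[OF F.carrier_is_subring, of "q @ [0]"] P.m_closed[OF qc X] pq by (simp add: P_def K)
        ultimately have "q \<otimes>\<^bsub>P\<^esub> ?X2 = p"
          unfolding X2_mult P.m_assoc[OF qc X X, symmetric] by simp
        then show ?thesis using qc by blast
      qed
      then show "p \<in> Idl\<^bsub>P\<^esub> {?X2}"
        unfolding P.cgenideal_eq_genideal[OF X2, symmetric] mem_cgenideal .
    qed
  qed
  have D: "Z2_X_mod_X_squared = P Quot (Idl\<^bsub>P\<^esub> {?X2})"
    by (simp add: Z2_X_mod_X_squared_def Let_def P_def K_def)
  show "Z2_X_mod_X_squared \<simeq> dual_numbers_Z2"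
    unfolding D using h.FactRing_iso[OF surj] unfolding kernel .
  show "cring Z2_X_mod_X_squared"
    unfolding D by (rule ideal.quotient_is_cring[OF P.genideal_ideal P.cring_axioms]) (use X2 in simp)
qed

section \<open>Graphs of products\<close>

text \<open>Every edge lies inside \<open>P\<close> or inside \<open>Q\<close>, so any injection
  respecting the three regions of the overlap diagram maps edges to edges of the two cliques of
  \<open>H\<close>. Only cardinalities remain to be compared.\<close>

lemma embeds_in_if_two_cliques:
  assumes G: "fst G = P \<union> Q" "finite P" "finite Q"
    and edges: "\<And>e. e \<in> snd G \<Longrightarrow> \<exists>x y. e = {x, y} \<and> x \<noteq> y \<and> ({x, y} \<subseteq> P \<or> {x, y} \<subseteq> Q)"
    and H: "clique H P'" "clique H Q'" "finite P'" "finite Q'"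
    and card: "card (P \<inter> Q) \<le> card (P' \<inter> Q')" "card (P - Q) \<le> card (P' - Q')" "card (Q - P) \<le> card (Q' - P')"
    and S: "embeds_in H S"
  shows "embeds_in G S"
proof -
  obtain f g h where f: "f ` (P \<inter> Q) \<subseteq> P' \<inter> Q'" "inj_on f (P \<inter> Q)"
    and g: "g ` (P - Q) \<subseteq> P' - Q'" "inj_on g (P - Q)"
    and h: "h ` (Q - P) \<subseteq> Q' - P'" "inj_on h (Q - P)"
    using card_le_inj[OF _ _ card(1)] card_le_inj[OF _ _ card(2)] card_le_inj[OF _ _ card(3)] G H by auto
  define k where "k x = (if x \<in> P \<inter> Q then f x else if x \<in> P then g x else h x)" for x
  have kf: "k x = f x" "k x \<in> P' \<inter> Q'" if "x \<in> P \<inter> Q" for x using that f(1) by (auto simp: k_def)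
  have kg: "k x = g x" "k x \<in> P' - Q'" if "x \<in> P - Q" for x using that g(1) by (auto simp: k_def)
  have kh: "k x = h x" "k x \<in> Q' - P'" if "x \<in> Q - P" for x using that h(1) by (auto simp: k_def)
  have kP: "k x \<in> P'" if "x \<in> P" for x using kf(2) kg(2) that by blast
  have kQ: "k x \<in> Q'" if "x \<in> Q" for x using kf(2) kh(2) that by blast
  have inj: "inj_on k (P \<union> Q)"
  proof (rule inj_onI)
    fix x y assume xy: "x \<in> P \<union> Q" "y \<in> P \<union> Q" "k x = k y"
    have x: "x \<in> P \<inter> Q \<or> x \<in> P - Q \<or> x \<in> Q - P" and y: "y \<in> P \<inter> Q \<or> y \<in> P - Q \<or> y \<in> Q - P" using xy by auto
    show "x = y"
      using x y
    proof (elim disjE)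
      assume "x \<in> P \<inter> Q" "y \<in> P \<inter> Q" then show ?thesis using inj_onD[OF f(2)] kf(1) xy(3) by metis
    next
      assume "x \<in> P - Q" "y \<in> P - Q" then show ?thesis using inj_onD[OF g(2)] kg(1) xy(3) by metis
    next
      assume "x \<in> Q - P" "y \<in> Q - P" then show ?thesis using inj_onD[OF h(2)] kh(1) xy(3) by metis
    qed (use kf(2) kg(2) kh(2) xy(3) in \<open>metis DiffE IntE\<close>)+
  qed
  show ?thesis
  proof (rule embeds_in_mono[OF S, where f = k])
    show "inj_on k (fst G)" using inj G(1) by simp
    have PQ': "P' \<subseteq> fst H" "Q' \<subseteq> fst H" using H(1,2) by (simp_all add: clique_def)
    show "k ` fst G \<subseteq> fst H"
    proof (rule image_subsetI)
      fix x assume "x \<in> fst G"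
      then show "k x \<in> fst H" using subsetD[OF PQ'(1) kP] subsetD[OF PQ'(2) kQ] unfolding G(1) by blast
    qed
    show "snd G \<subseteq> Pow (fst G)"
    proof
      fix e assume "e \<in> snd G"
      then show "e \<in> Pow (fst G)" using edges[of e] unfolding G(1) by blast
    qed
    fix e assume "e \<in> snd G"
    then obtain x y where e: "e = {x, y}" "x \<noteq> y" "{x, y} \<subseteq> P \<or> {x, y} \<subseteq> Q" using edges by blast
    have "k x \<noteq> k y" using e inj_onD[OF inj, of x y] by blast
    moreover have "{k x, k y} \<subseteq> P' \<or> {k x, k y} \<subseteq> Q'"
      using e(3) kP[of x] kP[of y] kQ[of x] kQ[of y] by auto
    ultimately have "{k x, k y} \<in> snd H" using H(1,2) unfolding clique_def by blast
    then show "k ` e \<in> snd H" by (simp add: e(1))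
  qed
qed

lemma clique_edge_list_graph:
  assumes "\<forall>u\<in>K. u < n" "\<forall>u\<in>K. \<forall>v\<in>K. u < v \<longrightarrow> (u, v) \<in> (\<lambda>(u, v, r). (u, v)) ` set es"
  shows "clique (edge_list_graph n es) K"
  unfolding clique_def
proof (intro conjI ballI impI)
  fix u v assume uv: "u \<in> K" "v \<in> K" "u \<noteq> v"
  have *: "{u, v} \<in> snd (edge_list_graph n es)" if "u \<in> K" "v \<in> K" "u < v" for u v
    using assms(2) that by (fastforce simp: edge_list_graph_def)
  show "{u, v} \<in> snd (edge_list_graph n es)"
    using *[of u v] *[of v u] uv by (auto simp: insert_commute linorder_neq_iff)
qed (use assms(1) in \<open>auto simp: edge_list_graph_def\<close>)

lemma planar_cliques:
  "clique (edge_list_graph 10 planar_edges) {0, 1, 2, 3}" "clique (edge_list_graph 10 planar_edges) {0, 7, 8, 9}"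
  "clique (edge_list_graph 10 planar_edges) {0, 1, 2, 4}" "clique (edge_list_graph 10 planar_edges) {0, 1, 3, 5}"
  "clique (edge_list_graph 10 planar_edges) {0, 2, 3, 6}"
  by (rule clique_edge_list_graph; simp add: planar_edges_def)+

lemma projective_cliques:
  "clique (edge_list_graph 8 projective_edges) {0, 1, 2, 3, 4, 5}" "clique (edge_list_graph 8 projective_edges) {0, 1, 6, 7}"
  by (rule clique_edge_list_graph; simp add: projective_edges_def)+

lemma embeds_product_with_field:
  assumes A: "cring A" "finite (carrier A)" "nonunits A = {\<zero>\<^bsub>A\<^esub>}" and B: "cring B" "finite (carrier B)"
    and H: "clique H P'" "clique H Q'" "finite P'" "finite Q'" "embeds_in H S"
    and card: "card (nonunits B) \<le> card (P' \<inter> Q')" "(card (carrier A) - 1) * card (nonunits B) \<le> card (P' - Q')"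
      "card (carrier B) - card (nonunits B) \<le> card (Q' - P')"
  shows "embeds_in (upper_ideal_relation_graph (RDirProd A B)) S"
proof -
  interpret A: cring A by fact
  let ?P = "carrier A \<times> nonunits B" and ?Q = "{\<zero>\<^bsub>A\<^esub>} \<times> carrier B"
  have sub: "nonunits B \<subseteq> carrier B" by (auto simp: nonunits_def)
  then have fin: "finite (nonunits B)" using B(2) finite_subset by blast
  have "?P \<inter> ?Q = {\<zero>\<^bsub>A\<^esub>} \<times> nonunits B" "?P - ?Q = (carrier A - {\<zero>\<^bsub>A\<^esub>}) \<times> nonunits B"
    "?Q - ?P = {\<zero>\<^bsub>A\<^esub>} \<times> (carrier B - nonunits B)"
    using sub by auto
  then have cards: "card (?P \<inter> ?Q) = card (nonunits B)" "card (?P - ?Q) = (card (carrier A) - 1) * card (nonunits B)"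
    "card (?Q - ?P) = card (carrier B) - card (nonunits B)"
    using fin sub A(2) by (simp_all add: card_cartesian_product card_Diff_subset)
  show ?thesis
  proof (rule embeds_in_if_two_cliques[where P = ?P and Q = ?Q])
    show "fst (upper_ideal_relation_graph (RDirProd A B)) = ?P \<union> ?Q"
      using A(3) sub by (auto simp: RDirProd_nonunits[OF A(1) B(1)])
    fix e assume "e \<in> snd (upper_ideal_relation_graph (RDirProd A B))"
    then obtain x y z where e: "e = {x, y}" "x \<noteq> y" "z \<in> nonunits (RDirProd A B)"
      "x \<in> PIdl\<^bsub>RDirProd A B\<^esub> z" "y \<in> PIdl\<^bsub>RDirProd A B\<^esub> z"
      unfolding upper_graph_edge_iff[OF RDirProd_cring[OF A(1) B(1)]] by blast
    obtain c d where z: "z = (c, d)" by (cases z)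
    have cd: "c = \<zero>\<^bsub>A\<^esub> \<and> d \<in> carrier B \<or> c \<in> carrier A \<and> d \<in> nonunits B"
      using e(3) A(3) by (simp add: z RDirProd_nonunits[OF A(1) B(1)])
    have car: "PIdl\<^bsub>A\<^esub> c \<subseteq> carrier A" if "c \<in> carrier A" for c
      using that by (auto simp: mem_cgenideal)
    have carB: "PIdl\<^bsub>B\<^esub> d \<subseteq> carrier B" if "d \<in> carrier B" for d
      using that B(1) by (auto simp: mem_cgenideal cring.cring_simprules)
    have "PIdl\<^bsub>RDirProd A B\<^esub> z \<subseteq> ?P \<or> PIdl\<^bsub>RDirProd A B\<^esub> z \<subseteq> ?Q"
      unfolding z RDirProd_cgenideal using cd car cgenideal_nonunits[OF B(1)] cgenideal_zero[OF A(1)] carB by blast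
    then show "\<exists>x y. e = {x, y} \<and> x \<noteq> y \<and> ({x, y} \<subseteq> ?P \<or> {x, y} \<subseteq> ?Q)"
      using e by blast
  qed (use H A(2) B(2) fin card in \<open>simp_all only: cards finite_cartesian_product finite.intros\<close>)
qed

lemma not_embeds_sphere_if_large_principal_ideal:
  assumes "cring R" "z \<in> nonunits R" "card (PIdl\<^bsub>R\<^esub> z) \<ge> 5"
  shows "\<not> embeds_in (upper_ideal_relation_graph R) two_sphere"
proof -
  obtain K where K: "K \<subseteq> PIdl\<^bsub>R\<^esub> z" "card K = 5" using obtain_subset_with_card_n[OF assms(3)] by metis
  show ?thesis
    using not_embeds_sphere_if_K5[OF upper_graph_edges clique_subset[OF clique_cgenideal[OF assms(1,2)] K(1)] K(2)] .
qed

abbreviation crosscap_one :: "('a, 'b) ring_scheme \<Rightarrow> bool" where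
  "crosscap_one R \<equiv> embeds_in (upper_ideal_relation_graph R) projective_plane \<and>
    \<not> embeds_in (upper_ideal_relation_graph R) two_sphere"

lemma crosscap_one_iso:
  assumes "cring R" "cring S" "R \<simeq> S"
  shows "crosscap_one R \<longleftrightarrow> crosscap_one S"
proof -
  have "S \<simeq> R" using ring_iso_sym[OF cring.axioms(1)[OF assms(1)] assms(3)] .
  then have "embeds_in (upper_ideal_relation_graph R) T \<longleftrightarrow> embeds_in (upper_ideal_relation_graph S) T"
    for T :: "'e topology"
    using embeds_upper_graph_iso[OF assms, of T] embeds_upper_graph_iso[OF assms(2,1), of T] by argo
  note this[of projective_plane] this[of two_sphere]
  then show ?thesis by simp
qed

lemma is_ring_iso_trans: "R \<simeq> S \<Longrightarrow> S \<simeq> T \<Longrightarrow> R \<simeq> T"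
  using ring_iso_set_trans unfolding is_ring_iso_def by blast

lemma RDirProd_iso_cong:
  assumes "R \<simeq> R'" "S \<simeq> S'"
  shows "RDirProd R S \<simeq> RDirProd R' S'"
  using RDirProd_iso6 assms unfolding is_ring_iso_def by blast

lemma RDirProd_iso_commute: "RDirProd R S \<simeq> RDirProd S R"
  using RDirProd_iso1 unfolding is_ring_iso_def by blast

lemma RDirProd_iso_assoc: "RDirProd (RDirProd R S) T \<simeq> RDirProd R (RDirProd S T)"
  using RDirProd_iso3 unfolding is_ring_iso_def by blast

lemma card_ge_2:
  assumes "cring R" "finite (carrier R)" "\<one>\<^bsub>R\<^esub> \<noteq> \<zero>\<^bsub>R\<^esub>"
  shows "card (carrier R) \<ge> 2"
proof -
  interpret cring R by fact
  have "card {\<zero>\<^bsub>R\<^esub>, \<one>\<^bsub>R\<^esub>} \<le> card (carrier R)" by (rule card_mono[OF assms(2)]) simp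
  then show ?thesis using assms(3) by simp
qed

section \<open>Products of crosscap one\<close>

lemma field_product_crosscap_one:
  assumes A: "cring A" "nonunits A = {\<zero>\<^bsub>A\<^esub>}" "finite (carrier A)" "card (carrier A) \<le> 4"
    and B: "cring B" "nonunits B = {\<zero>\<^bsub>B\<^esub>}" "card (carrier B) = 5"
  shows "crosscap_one (RDirProd A B)"
proof
  have fin: "finite (carrier B)" using B(3) by (metis card.infinite zero_neq_numeral)
  show "embeds_in (upper_ideal_relation_graph (RDirProd A B)) projective_plane"
    \<comment> \<open>Vertex 1 is left out of the larger clique, so that the two cliques share only
      0, just as the two ideals share only zero.\<close>
    by (rule embeds_product_with_field[OF A(1,3,2) B(1) fin projective_cliques(2)
        clique_subset[OF projective_cliques(1), of "{0, 2, 3, 4, 5}"] _ _ embeds_projective_graph])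
      (use A(4) in \<open>auto simp: B(2,3)\<close>)
  interpret A: cring A by fact
  interpret B: cring B by fact
  have "(\<zero>\<^bsub>A\<^esub>, \<one>\<^bsub>B\<^esub>) \<in> nonunits (RDirProd A B)"
    by (simp add: RDirProd_nonunits[OF A(1) B(1)] A(2))
  then show "\<not> embeds_in (upper_ideal_relation_graph (RDirProd A B)) two_sphere"
    by (rule not_embeds_sphere_if_large_principal_ideal[OF RDirProd_cring[OF A(1) B(1)]])
      (simp add: RDirProd_cgenideal cgenideal_zero[OF A(1)] cgenideal_one[OF B(1)] card_cartesian_product B(3))
qed

text \<open>The regions have 2, 4 and 2 elements, which fills the projective drawing exactly.
  Against the sphere, the ideal generated by \<open>\<one>\<close> and a nonzero nonunit has at
  least \<open>3 * 2\<close> elements.\<close>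

lemma mixed_product_crosscap_one:
  assumes A: "cring A" "nonunits A = {\<zero>\<^bsub>A\<^esub>}" "card (carrier A) = 3"
    and B: "cring B" "card (nonunits B) = 2" "card (carrier B) = 4"
  shows "crosscap_one (RDirProd A B)"
proof
  have fin: "finite (carrier A)" "finite (carrier B)" using A(3) B(3) by (metis card.infinite zero_neq_numeral)+
  show "embeds_in (upper_ideal_relation_graph (RDirProd A B)) projective_plane"
    by (rule embeds_product_with_field[OF A(1) fin(1) A(2) B(1) fin(2) projective_cliques _ _ embeds_projective_graph])
      (auto simp: A(3) B(2,3))
  interpret A: cring A by fact
  interpret B: cring B by fact
  have one: "\<one>\<^bsub>B\<^esub> \<noteq> \<zero>\<^bsub>B\<^esub>" by (rule one_not_zero_if_card[OF B(1)]) (simp add: B(3))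
  obtain z where z: "z \<in> nonunits B" "z \<noteq> \<zero>\<^bsub>B\<^esub>"
  proof -
    obtain a b where "nonunits B = {a, b}" "a \<noteq> b" using B(2) unfolding card_2_iff by blast
    then show thesis using that[of a] that[of b] by auto
  qed
  have zc: "z \<in> carrier B" using z(1) by (simp add: nonunits_def)
  have "PIdl\<^bsub>B\<^esub> z \<subseteq> carrier B" using zc by (auto simp: mem_cgenideal)
  then have "card {\<zero>\<^bsub>B\<^esub>, z} \<le> card (PIdl\<^bsub>B\<^esub> z)"
    using card_mono[OF finite_subset[OF _ fin(2)] zero_mem_cgenideal[OF B(1) zc]] by blast
  then have 2: "card (PIdl\<^bsub>B\<^esub> z) \<ge> 2" using z(2) by simp
  have "(\<one>\<^bsub>A\<^esub>, z) \<in> nonunits (RDirProd A B)"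
    using z by (simp add: RDirProd_nonunits[OF A(1) B(1)])
  then show "\<not> embeds_in (upper_ideal_relation_graph (RDirProd A B)) two_sphere"
    by (rule not_embeds_sphere_if_large_principal_ideal[OF RDirProd_cring[OF A(1) B(1)]])
      (use 2 in \<open>simp add: RDirProd_cgenideal cgenideal_one[OF A(1)] card_cartesian_product A(3)\<close>)
qed

section \<open>Bounds and excluded products\<close>

lemma product_card_bound:
  assumes A: "cring A" "\<one>\<^bsub>A\<^esub> \<noteq> \<zero>\<^bsub>A\<^esub>" and B: "cring B" "z \<in> nonunits B"
    and emb: "embeds_in (upper_ideal_relation_graph (RDirProd A B)) projective_plane"
  shows "card (carrier A) * card (PIdl\<^bsub>B\<^esub> z) \<le> 6"
proof (rule ccontr)
  assume big: "\<not> ?thesis"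
  interpret A: cring A by fact
  have "(\<one>\<^bsub>A\<^esub>, z) \<in> nonunits (RDirProd A B)"
    using B(2) by (simp add: RDirProd_nonunits[OF A(1) B(1)])
  moreover have "card (PIdl\<^bsub>RDirProd A B\<^esub> (\<one>\<^bsub>A\<^esub>, z)) \<ge> 7"
    using big by (simp add: RDirProd_cgenideal cgenideal_one[OF A(1)] card_cartesian_product)
  ultimately show False
    using not_embeds_projective_plane_if_large_principal_ideal[OF RDirProd_cring[OF A(1) B(1)]] emb by blast
qed

lemma nonunits_carrier_zero_one:
  assumes "cring D" "carrier D = {\<zero>\<^bsub>D\<^esub>, \<one>\<^bsub>D\<^esub>}" "\<one>\<^bsub>D\<^esub> \<noteq> \<zero>\<^bsub>D\<^esub>"
  shows "nonunits D = {\<zero>\<^bsub>D\<^esub>}"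
  by (rule nonunits_prime_card[OF assms(1), of 2]) (use assms(3) in \<open>simp_all add: assms(2) two_is_prime_nat\<close>)

lemma carrier_card_2:
  assumes "cring D" "card (carrier D) = 2" "\<one>\<^bsub>D\<^esub> \<noteq> \<zero>\<^bsub>D\<^esub>"
  shows "carrier D = {\<zero>\<^bsub>D\<^esub>, \<one>\<^bsub>D\<^esub>}"
proof -
  interpret cring D by fact
  have "finite (carrier D)" using assms(2) by (metis card.infinite zero_neq_numeral)
  then show ?thesis using card_subset_eq[of "carrier D" "{\<zero>\<^bsub>D\<^esub>, \<one>\<^bsub>D\<^esub>}"] assms by simp
qed

lemma embeds_sphere_Z2_cubed:
  assumes A: "cring A" "carrier A = {\<zero>\<^bsub>A\<^esub>, \<one>\<^bsub>A\<^esub>}" "\<one>\<^bsub>A\<^esub> \<noteq> \<zero>\<^bsub>A\<^esub>"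
    and B: "cring B" "carrier B = {\<zero>\<^bsub>B\<^esub>, \<one>\<^bsub>B\<^esub>}" "\<one>\<^bsub>B\<^esub> \<noteq> \<zero>\<^bsub>B\<^esub>"
    and C: "cring C" "carrier C = {\<zero>\<^bsub>C\<^esub>, \<one>\<^bsub>C\<^esub>}" "\<one>\<^bsub>C\<^esub> \<noteq> \<zero>\<^bsub>C\<^esub>"
  shows "embeds_in (upper_ideal_relation_graph (RDirProd A (RDirProd B C))) two_sphere"
proof -
  let ?R = "RDirProd A (RDirProd B C)"
  note nu = nonunits_carrier_zero_one
  note BC = RDirProd_cring[OF B(1) C(1)]
  note R = RDirProd_cring[OF A(1) BC]
  \<comment> \<open>The elements with one nonzero component go to 1, 2, 3, and the sums of two of
    them to 4, 5, 6. The value 7 is taken at the unit only, which is not a vertex.\<close>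
  define f where "f = (\<lambda>(a, b, c). if a = \<zero>\<^bsub>A\<^esub>
     then (if b = \<zero>\<^bsub>B\<^esub> then (if c = \<zero>\<^bsub>C\<^esub> then 0 else 3) else (if c = \<zero>\<^bsub>C\<^esub> then 2 else 6))
     else (if b = \<zero>\<^bsub>B\<^esub> then (if c = \<zero>\<^bsub>C\<^esub> then 1 else 5) else (if c = \<zero>\<^bsub>C\<^esub> then 4 else (7::nat))))"
  have nuR: "nonunits ?R = {(a, b, c). a \<in> carrier A \<and> b \<in> carrier B \<and> c \<in> carrier C \<and>
      (a = \<zero>\<^bsub>A\<^esub> \<or> b = \<zero>\<^bsub>B\<^esub> \<or> c = \<zero>\<^bsub>C\<^esub>)}"
    by (auto simp: RDirProd_nonunits[OF A(1) BC] RDirProd_nonunits[OF B(1) C(1)] nu[OF A] nu[OF B] nu[OF C])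
      (auto simp: A(2) B(2) C(2))
  have inj: "inj_on f (nonunits ?R)"
    unfolding nuR A(2) B(2) C(2) using A(3) B(3) C(3) by (auto simp: inj_on_def f_def)
  have planar: "fst (edge_list_graph 10 planar_edges) = {..<10}" by (simp add: edge_list_graph_def)
  show ?thesis
  proof (rule embeds_in_mono[OF embeds_planar_graph, where f = f])
    show "inj_on f (fst (upper_ideal_relation_graph ?R))" using inj by simp
    show "f ` fst (upper_ideal_relation_graph ?R) \<subseteq> fst (edge_list_graph 10 planar_edges)"
      by (auto simp: planar f_def)
    show "snd (upper_ideal_relation_graph ?R) \<subseteq> Pow (fst (upper_ideal_relation_graph ?R))"
      by (rule upper_graph_edges)
    fix e assume "e \<in> snd (upper_ideal_relation_graph ?R)"
    then obtain x y z where e: "e = {x, y}" "x \<noteq> y" "z \<in> nonunits ?R" "x \<in> PIdl\<^bsub>?R\<^esub> z" "y \<in> PIdl\<^bsub>?R\<^esub> z"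
      unfolding upper_graph_edge_iff[OF R] by blast
    obtain a b c where z: "z = (a, b, c)" by (metis prod.exhaust)
    have cases: "a = \<zero>\<^bsub>A\<^esub> \<or> b = \<zero>\<^bsub>B\<^esub> \<or> c = \<zero>\<^bsub>C\<^esub>" using e(3) by (simp add: nuR z)
    have xy: "x \<in> nonunits ?R" "y \<in> nonunits ?R" using cgenideal_nonunits[OF R e(3)] e(4,5) by auto
    have "(fst x = \<zero>\<^bsub>A\<^esub> \<and> fst y = \<zero>\<^bsub>A\<^esub>) \<or> (fst (snd x) = \<zero>\<^bsub>B\<^esub> \<and> fst (snd y) = \<zero>\<^bsub>B\<^esub>) \<or>
      (snd (snd x) = \<zero>\<^bsub>C\<^esub> \<and> snd (snd y) = \<zero>\<^bsub>C\<^esub>)"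
      using cases e(4,5) unfolding z RDirProd_cgenideal
      by (auto simp: cgenideal_zero[OF A(1)] cgenideal_zero[OF B(1)] cgenideal_zero[OF C(1)])
    then have "{f x, f y} \<subseteq> {0, 2, 3, 6} \<or> {f x, f y} \<subseteq> {0, 1, 3, 5} \<or> {f x, f y} \<subseteq> {0, 1, 2, 4}"
      by (cases x; cases y) (auto simp: f_def)
    then obtain K where "clique (edge_list_graph 10 planar_edges) K" "{f x, f y} \<subseteq> K"
      using planar_cliques(3-5) by meson
    moreover have "f x \<noteq> f y" using inj_onD[OF inj _ xy] e(2) by blast
    ultimately have "{f x, f y} \<in> snd (edge_list_graph 10 planar_edges)"
      by (simp add: clique_def)
    then show "f ` e \<in> snd (edge_list_graph 10 planar_edges)" by (simp add: e(1))
  qed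
qed

text \<open>The bound 6 on principal ideals leaves factors with at most three elements. If all have
  two, the graph is planar. Otherwise take two coordinate ideals, each omitting a different one of
  the other two factors: they overlap in a factor of order 3, and each has at least three private
  elements.\<close>

lemma not_crosscap_one_three_factors:
  assumes A: "cring A" "finite (carrier A)" "\<one>\<^bsub>A\<^esub> \<noteq> \<zero>\<^bsub>A\<^esub>"
    and B: "cring B" "finite (carrier B)" "\<one>\<^bsub>B\<^esub> \<noteq> \<zero>\<^bsub>B\<^esub>"
    and C: "cring C" "finite (carrier C)" "\<one>\<^bsub>C\<^esub> \<noteq> \<zero>\<^bsub>C\<^esub>"
  shows "\<not> crosscap_one (RDirProd A (RDirProd B C))"
proof
  let ?R = "RDirProd A (RDirProd B C)"
  assume cc: "crosscap_one ?R"
  interpret A: cring A by fact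
  interpret B: cring B by fact
  interpret C: cring C by fact
  note BC = RDirProd_cring[OF B(1) C(1)]
  note R = RDirProd_cring[OF A(1) BC]
  have finR: "finite (carrier ?R)" using A(2) B(2) C(2) by simp
  note nuA = nonunits_iff[OF A(1)] and nuB = nonunits_iff[OF B(1)] and nuC = nonunits_iff[OF C(1)]
  note nu = RDirProd_nonunits[OF A(1) BC] RDirProd_nonunits[OF B(1) C(1)]
    zero_nonunit[OF A(1,3)] zero_nonunit[OF B(1,3)] zero_nonunit[OF C(1,3)]
  note id = RDirProd_cgenideal cgenideal_one[OF A(1)] cgenideal_one[OF B(1)] cgenideal_one[OF C(1)]
    cgenideal_zero[OF A(1)] cgenideal_zero[OF B(1)] cgenideal_zero[OF C(1)]
  define a b c where "a = card (carrier A)" and "b = card (carrier B)" and "c = card (carrier C)"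
  have ge: "a \<ge> 2" "b \<ge> 2" "c \<ge> 2" using card_ge_2[OF A] card_ge_2[OF B] card_ge_2[OF C] by (simp_all add: a_def b_def c_def)
  have small: "card (PIdl\<^bsub>?R\<^esub> z) \<le> 6" if "z \<in> nonunits ?R" for z
    using not_embeds_projective_plane_if_large_principal_ideal[OF R that] cc by linarith
  have ab: "a * b \<le> 6"
    using small[of "(\<one>\<^bsub>A\<^esub>, \<one>\<^bsub>B\<^esub>, \<zero>\<^bsub>C\<^esub>)"] by (simp add: nu id card_cartesian_product a_def b_def)
  have ac: "a * c \<le> 6"
    using small[of "(\<one>\<^bsub>A\<^esub>, \<zero>\<^bsub>B\<^esub>, \<one>\<^bsub>C\<^esub>)"] by (simp add: nu id card_cartesian_product a_def c_def)
  have bc: "b * c \<le> 6"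
    using small[of "(\<zero>\<^bsub>A\<^esub>, \<one>\<^bsub>B\<^esub>, \<one>\<^bsub>C\<^esub>)"] by (simp add: nu id card_cartesian_product b_def c_def)
  have le3: "n \<le> 3" if "n * m \<le> 6" "m \<ge> 2" for n m :: nat
  proof -
    have "n * 2 \<le> n * m" using that(2) by simp
    then show ?thesis using that(1) by linarith
  qed
  have not33: "\<not> (n \<ge> 3 \<and> m \<ge> 3)" if "n * m \<le> 6" for n m :: nat
    using mult_le_mono[of 3 n 3 m] that by linarith
  have "a \<le> 3" "b \<le> 3" "c \<le> 3" using le3[of a b] le3[of b c] le3[of c a] ab ac bc ge by (simp_all add: mult.commute)
  then consider "a = 2" "b = 2" "c = 2" | "c = 3" "a \<ge> 2" "b \<ge> 2" | "b = 3" "a \<ge> 2" "c \<ge> 2" | "a = 3" "b \<ge> 2" "c \<ge> 2"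
    using ge by linarith
  then show False
  proof cases
    case 1
    note two = carrier_card_2
    show False
      using embeds_sphere_Z2_cubed[OF A(1) two[OF A(1) _ A(3)] A(3) B(1) two[OF B(1) _ B(3)] B(3) C(1) two[OF C(1) _ C(3)] C(3)]
        1 cc by (simp add: a_def b_def c_def)
  next
    case 2
    let ?z = "(\<one>\<^bsub>A\<^esub>, \<zero>\<^bsub>B\<^esub>, \<one>\<^bsub>C\<^esub>)" and ?w = "(\<zero>\<^bsub>A\<^esub>, \<one>\<^bsub>B\<^esub>, \<one>\<^bsub>C\<^esub>)"
    have "PIdl\<^bsub>?R\<^esub> ?z - PIdl\<^bsub>?R\<^esub> ?w = (carrier A - {\<zero>\<^bsub>A\<^esub>}) \<times> ({\<zero>\<^bsub>B\<^esub>} \<times> carrier C)"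
      "PIdl\<^bsub>?R\<^esub> ?w - PIdl\<^bsub>?R\<^esub> ?z = {\<zero>\<^bsub>A\<^esub>} \<times> ((carrier B - {\<zero>\<^bsub>B\<^esub>}) \<times> carrier C)"
      "PIdl\<^bsub>?R\<^esub> ?z \<inter> PIdl\<^bsub>?R\<^esub> ?w = {\<zero>\<^bsub>A\<^esub>} \<times> ({\<zero>\<^bsub>B\<^esub>} \<times> carrier C)"
      unfolding id by auto
    then have "\<not> embeds_in (upper_ideal_relation_graph ?R) projective_plane"
      using 2 by (intro not_embeds_projective_plane_if_two_principal_ideals[OF R finR, of ?z ?w])
        (simp_all add: nu card_cartesian_product a_def b_def c_def)
    then show False using cc by blast
  next
    case 3
    let ?z = "(\<one>\<^bsub>A\<^esub>, \<one>\<^bsub>B\<^esub>, \<zero>\<^bsub>C\<^esub>)" and ?w = "(\<zero>\<^bsub>A\<^esub>, \<one>\<^bsub>B\<^esub>, \<one>\<^bsub>C\<^esub>)"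
    have "PIdl\<^bsub>?R\<^esub> ?z - PIdl\<^bsub>?R\<^esub> ?w = (carrier A - {\<zero>\<^bsub>A\<^esub>}) \<times> (carrier B \<times> {\<zero>\<^bsub>C\<^esub>})"
      "PIdl\<^bsub>?R\<^esub> ?w - PIdl\<^bsub>?R\<^esub> ?z = {\<zero>\<^bsub>A\<^esub>} \<times> (carrier B \<times> (carrier C - {\<zero>\<^bsub>C\<^esub>}))"
      "PIdl\<^bsub>?R\<^esub> ?z \<inter> PIdl\<^bsub>?R\<^esub> ?w = {\<zero>\<^bsub>A\<^esub>} \<times> (carrier B \<times> {\<zero>\<^bsub>C\<^esub>})"
      unfolding id by auto
    then have "\<not> embeds_in (upper_ideal_relation_graph ?R) projective_plane"
      using 3 by (intro not_embeds_projective_plane_if_two_principal_ideals[OF R finR, of ?z ?w])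
        (simp_all add: nu card_cartesian_product a_def b_def c_def)
    then show False using cc by blast
  next
    case 4
    let ?z = "(\<one>\<^bsub>A\<^esub>, \<one>\<^bsub>B\<^esub>, \<zero>\<^bsub>C\<^esub>)" and ?w = "(\<one>\<^bsub>A\<^esub>, \<zero>\<^bsub>B\<^esub>, \<one>\<^bsub>C\<^esub>)"
    have "PIdl\<^bsub>?R\<^esub> ?z - PIdl\<^bsub>?R\<^esub> ?w = carrier A \<times> ((carrier B - {\<zero>\<^bsub>B\<^esub>}) \<times> {\<zero>\<^bsub>C\<^esub>})"
      "PIdl\<^bsub>?R\<^esub> ?w - PIdl\<^bsub>?R\<^esub> ?z = carrier A \<times> ({\<zero>\<^bsub>B\<^esub>} \<times> (carrier C - {\<zero>\<^bsub>C\<^esub>}))"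
      "PIdl\<^bsub>?R\<^esub> ?z \<inter> PIdl\<^bsub>?R\<^esub> ?w = carrier A \<times> ({\<zero>\<^bsub>B\<^esub>} \<times> {\<zero>\<^bsub>C\<^esub>})"
      unfolding id by auto
    then have "\<not> embeds_in (upper_ideal_relation_graph ?R) projective_plane"
      using 4 by (intro not_embeds_projective_plane_if_two_principal_ideals[OF R finR, of ?z ?w])
        (simp_all add: nu card_cartesian_product a_def b_def c_def)
    then show False using cc by blast
  qed
qed

text \<open>The two coordinate ideals are copies of \<open>K\<^sub>5\<close> with only zero in
  common, although neither exceeds the size bound.\<close>

lemma not_embeds_two_fields_card_5:
  assumes A: "cring A" "card (carrier A) = 5" and B: "cring B" "card (carrier B) = 5"
  shows "\<not> embeds_in (upper_ideal_relation_graph (RDirProd A B)) projective_plane"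
proof -
  let ?R = "RDirProd A B"
  interpret A: cring A by fact
  interpret B: cring B by fact
  note R = RDirProd_cring[OF A(1) B(1)]
  have one: "\<one>\<^bsub>A\<^esub> \<noteq> \<zero>\<^bsub>A\<^esub>" "\<one>\<^bsub>B\<^esub> \<noteq> \<zero>\<^bsub>B\<^esub>"
    using one_not_zero_if_card[OF A(1)] one_not_zero_if_card[OF B(1)] A(2) B(2) by simp_all
  have nu: "(\<one>\<^bsub>A\<^esub>, \<zero>\<^bsub>B\<^esub>) \<in> nonunits ?R" "(\<zero>\<^bsub>A\<^esub>, \<one>\<^bsub>B\<^esub>) \<in> nonunits ?R"
    using zero_nonunit[OF A(1) one(1)] zero_nonunit[OF B(1) one(2)] by (simp_all add: RDirProd_nonunits[OF A(1) B(1)])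
  have id: "PIdl\<^bsub>?R\<^esub> (\<one>\<^bsub>A\<^esub>, \<zero>\<^bsub>B\<^esub>) = carrier A \<times> {\<zero>\<^bsub>B\<^esub>}" "PIdl\<^bsub>?R\<^esub> (\<zero>\<^bsub>A\<^esub>, \<one>\<^bsub>B\<^esub>) = {\<zero>\<^bsub>A\<^esub>} \<times> carrier B"
    by (simp_all add: RDirProd_cgenideal cgenideal_one cgenideal_zero A(1) B(1))
  show ?thesis
  proof (rule not_embeds_projective_plane_if_two_K5[OF upper_graph_edges])
    show "clique (upper_ideal_relation_graph ?R) (carrier A \<times> {\<zero>\<^bsub>B\<^esub>})" "clique (upper_ideal_relation_graph ?R) ({\<zero>\<^bsub>A\<^esub>} \<times> carrier B)"
      using clique_cgenideal[OF R nu(1)] clique_cgenideal[OF R nu(2)] unfolding id by blast+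
    show "(\<zero>\<^bsub>A\<^esub>, \<zero>\<^bsub>B\<^esub>) \<in> carrier A \<times> {\<zero>\<^bsub>B\<^esub>}" "(\<zero>\<^bsub>A\<^esub>, \<zero>\<^bsub>B\<^esub>) \<in> {\<zero>\<^bsub>A\<^esub>} \<times> carrier B" by simp_all
  qed (auto simp: card_cartesian_product A(2) B(2))
qed

section \<open>The classification\<close>

definition listed_product :: "('a, 'b) ring_scheme \<Rightarrow> bool" where
  "listed_product R \<longleftrightarrow>
    is_ring_iso R (RDirProd (residue_ring 2) (residue_ring 5)) \<or>
    is_ring_iso R (RDirProd (residue_ring 3) (residue_ring 5)) \<or>
    (\<exists>F :: nat ring. field F \<and> card (carrier F) = 4 \<and> is_ring_iso R (RDirProd F (residue_ring 5))) \<or>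
    is_ring_iso R (RDirProd (residue_ring 3) (residue_ring 4)) \<or>
    is_ring_iso R (RDirProd (residue_ring 3) Z2_X_mod_X_squared)"

lemma listed_product_iso: "R \<simeq> S \<Longrightarrow> listed_product S \<Longrightarrow> listed_product R"
  unfolding listed_product_def by (meson is_ring_iso_trans)

lemma residue_ring_cring: "m > 1 \<Longrightarrow> cring (residue_ring m)"
  by (rule residues.cring) (simp add: residues_def)

lemma card_residue_ring: "card (carrier (residue_ring m)) = nat m"
  by (simp add: residue_ring_def)

lemma nonunits_residue_ring_prime: "Factorial_Ring.prime (p::nat) \<Longrightarrow> nonunits (residue_ring (int p)) = {0}"
  using nonunits_prime_card[OF residue_ring_cring, of "int p" p] prime_gt_1_nat[of p]
  by (simp add: card_residue_ring) (simp add: residue_ring_def)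

lemma nonunits_residue_ring_4: "nonunits (residue_ring 4) = {0, 2}"
proof -
  have "carrier (residue_ring 4) = {0, 1, 2, 3}" by (auto simp: residue_ring_def)
  then show ?thesis
    by (auto simp: nonunits_iff[OF residue_ring_cring]) (auto simp: residue_ring_def)
qed

lemma nonunits_dual_numbers_Z2: "nonunits dual_numbers_Z2 = {(False, False), (False, True)}"
proof -
  have "(a, b) \<in> nonunits dual_numbers_Z2 \<longleftrightarrow> \<not> a" for a b
  proof -
    have "(a, b) \<in> nonunits dual_numbers_Z2 \<longleftrightarrow>
      (\<forall>c d. (c, d) \<otimes>\<^bsub>dual_numbers_Z2\<^esub> (a, b) \<noteq> \<one>\<^bsub>dual_numbers_Z2\<^esub>)"
      unfolding nonunits_iff[OF dual_numbers_Z2_cring] by (simp add: dual_numbers_Z2_def)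
    also have "\<dots> \<longleftrightarrow> \<not> a" by (auto simp: dual_numbers_Z2_def)
    finally show ?thesis .
  qed
  then show ?thesis by auto
qed

lemma crosscap_one_if_iso_product:
  assumes "cring R" "R \<simeq> RDirProd A B" "cring A" "cring B" "crosscap_one (RDirProd A B)"
  shows "crosscap_one R"
  using crosscap_one_iso[OF assms(1) RDirProd_cring[OF assms(3,4)] assms(2)] assms(5) by blast

lemma crosscap_one_listed:
  assumes R: "cring R" and l: "listed_product R"
  shows "crosscap_one R"
proof -
  have pr: "Factorial_Ring.prime (2::nat)" "Factorial_Ring.prime (3::nat)" "Factorial_Ring.prime (5::nat)" by simp_all
  have nz: "nonunits (residue_ring 2) = {\<zero>\<^bsub>residue_ring 2\<^esub>}" "nonunits (residue_ring 3) = {\<zero>\<^bsub>residue_ring 3\<^esub>}"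
    "nonunits (residue_ring 5) = {\<zero>\<^bsub>residue_ring 5\<^esub>}"
    using nonunits_residue_ring_prime[OF pr(1)] nonunits_residue_ring_prime[OF pr(2)] nonunits_residue_ring_prime[OF pr(3)]
    by (simp_all add: residue_ring_def)
  have c: "cring (residue_ring 2)" "cring (residue_ring 3)" "cring (residue_ring 4)" "cring (residue_ring 5)"
    by (simp_all add: residue_ring_cring)
  have fin: "finite (carrier (residue_ring m))" for m by (simp add: residue_ring_def)
  note * = crosscap_one_if_iso_product[OF R]
  from l show ?thesis
    unfolding listed_product_def
  proof (elim disjE exE conjE)
    assume "R \<simeq> RDirProd (residue_ring 2) (residue_ring 5)"
    then show ?thesis
      by (rule *[OF _ c(1,4)]) (rule field_product_crosscap_one; simp add: c nz fin card_residue_ring)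
  next
    assume "R \<simeq> RDirProd (residue_ring 3) (residue_ring 5)"
    then show ?thesis
      by (rule *[OF _ c(2,4)]) (rule field_product_crosscap_one; simp add: c nz fin card_residue_ring)
  next
    fix F :: "nat ring" assume F: "field F" "card (carrier F) = 4" "R \<simeq> RDirProd F (residue_ring 5)"
    interpret F: field F by fact
    have nF: "nonunits F = {\<zero>\<^bsub>F\<^esub>}" using F.field_Units F.zero_closed by (auto simp: nonunits_def)
    have "finite (carrier F)" using F(2) by (metis card.infinite zero_neq_numeral)
    then show ?thesis
      using F(2) by (intro *[OF F(3) F.cring_axioms c(4)] field_product_crosscap_one) (simp_all add: F.cring_axioms nF c nz card_residue_ring)
  next
    assume "R \<simeq> RDirProd (residue_ring 3) (residue_ring 4)"
    then show ?thesis
      by (rule *[OF _ c(2,3)]) (rule mixed_product_crosscap_one; simp add: c nz card_residue_ring nonunits_residue_ring_4)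
  next
    assume "R \<simeq> RDirProd (residue_ring 3) Z2_X_mod_X_squared"
    moreover have "RDirProd (residue_ring 3) Z2_X_mod_X_squared \<simeq> RDirProd (residue_ring 3) dual_numbers_Z2"
      by (rule RDirProd_iso_cong[OF ring_iso_refl Z2_X_mod_X_squared_iso(2)])
    ultimately have "R \<simeq> RDirProd (residue_ring 3) dual_numbers_Z2" by (rule is_ring_iso_trans)
    moreover have "card (carrier dual_numbers_Z2) = 4"
      by (simp add: dual_numbers_Z2_def UNIV_Times_UNIV[symmetric] card_cartesian_product card_UNIV_bool del: UNIV_Times_UNIV)
    ultimately show ?thesis
      by (intro *[OF _ c(2) dual_numbers_Z2_cring] mixed_product_crosscap_one)
        (simp_all add: c dual_numbers_Z2_cring nz card_residue_ring nonunits_dual_numbers_Z2)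
  qed
qed

lemma connected_ring_sizes:
  assumes D: "cring D" "finite (carrier D)" "\<one>\<^bsub>D\<^esub> \<noteq> \<zero>\<^bsub>D\<^esub>" "trivial_idempotents D" "card (carrier D) \<le> 6"
  shows "card (carrier D) \<in> {2, 3, 5} \<and> nonunits D = {\<zero>\<^bsub>D\<^esub>} \<or>
      card (carrier D) = 4 \<and> (nonunits D = {\<zero>\<^bsub>D\<^esub>} \<or> card (nonunits D) = 2)"
proof -
  have "card (carrier D) \<noteq> 6" using card_6_idempotents[OF D(1)] D(4) by blast
  then consider "card (carrier D) = 2" | "card (carrier D) = 3" | "card (carrier D) = 4" | "card (carrier D) = 5"
    using card_ge_2[OF D(1-3)] D(5) by linarith
  then show ?thesis
    using nonunits_prime_card[OF D(1)] nonunits_card_4[OF D(1) _ D(4)] by cases auto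
qed

text \<open>The order conditions break the symmetry: a factor with nonzero nonunits comes second,
  and of two fields the larger one does.\<close>

lemma two_factors_classification:
  assumes A: "cring A" "finite (carrier A)" "\<one>\<^bsub>A\<^esub> \<noteq> \<zero>\<^bsub>A\<^esub>" "trivial_idempotents A"
    and B: "cring B" "finite (carrier B)" "\<one>\<^bsub>B\<^esub> \<noteq> \<zero>\<^bsub>B\<^esub>" "trivial_idempotents B"
    and cc: "crosscap_one (RDirProd A B)" and le: "card (nonunits A) \<le> card (nonunits B)"
      "card (nonunits B) = 1 \<Longrightarrow> card (carrier A) \<le> card (carrier B)"
  shows "listed_product (RDirProd A B)"
proof -
  have AB: "cring (RDirProd A B)" by (rule RDirProd_cring[OF A(1) B(1)])
  have bound: "card (carrier A) * card (PIdl\<^bsub>B\<^esub> z) \<le> 6" if "z \<in> nonunits B" for z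
    using product_card_bound[OF A(1,3) B(1) that] cc by blast
  have a6: "card (carrier A) \<le> 6"
    using bound[OF zero_nonunit[OF B(1,3)]] by (simp add: cgenideal_zero[OF B(1)])
  have b6: "card (carrier B) \<le> 6"
  proof -
    have "embeds_in (upper_ideal_relation_graph (RDirProd B A)) projective_plane"
      using embeds_upper_graph_iso[OF RDirProd_cring[OF B(1) A(1)] AB RDirProd_iso_commute] cc by blast
    from product_card_bound[OF B(1,3) A(1) zero_nonunit[OF A(1,3)] this]
    show ?thesis by (simp add: cgenideal_zero[OF A(1)])
  qed
  note sA = connected_ring_sizes[OF A a6] and sB = connected_ring_sizes[OF B b6]
  show ?thesis
  proof (cases "nonunits B = {\<zero>\<^bsub>B\<^esub>}")
    case True
    have nA: "nonunits A = {\<zero>\<^bsub>A\<^esub>}" using sA le(1) True by auto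
    have leAB: "card (carrier A) \<le> card (carrier B)" using le(2) True by simp
    have "card (carrier B) = 5"
    proof (rule ccontr)
      assume "card (carrier B) \<noteq> 5"
      then have b4: "card (carrier B) \<le> 4" using sB by auto
      \<comment> \<open>With at most four elements in each field, the graph fits into two copies of
        \<open>K\<^sub>4\<close> glued at the vertex zero.\<close>
      have "embeds_in (upper_ideal_relation_graph (RDirProd A B)) two_sphere"
        by (rule embeds_product_with_field[OF A(1,2) nA B(1,2) planar_cliques(1,2) _ _ embeds_planar_graph])
          (use b4 leAB in \<open>auto simp: True\<close>)
      then show False using cc by blast
    qed
    then have B5: "B \<simeq> residue_ring 5" using prime_card_iso_residue_ring[OF B(1), of 5] by simp
    have "card (carrier A) \<noteq> 5"
      using not_embeds_two_fields_card_5[OF A(1) _ B(1) \<open>card (carrier B) = 5\<close>] cc by blast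
    then consider "card (carrier A) = 2" | "card (carrier A) = 3" | "card (carrier A) = 4" using sA by auto
    then show ?thesis
    proof cases
      case 1
      then have "A \<simeq> residue_ring 2" using prime_card_iso_residue_ring[OF A(1), of 2] by simp
      then show ?thesis using RDirProd_iso_cong[OF _ B5] unfolding listed_product_def by blast
    next
      case 2
      then have "A \<simeq> residue_ring 3" using prime_card_iso_residue_ring[OF A(1), of 3] by simp
      then show ?thesis using RDirProd_iso_cong[OF _ B5] unfolding listed_product_def by blast
    next
      case 3
      obtain F :: "nat ring" where "field F" "card (carrier F) = 4" "A \<simeq> F"
        using field_nat_copy[OF field_if_nonunits_zero[OF A(1) nA] A(2)] 3 by auto
      then show ?thesis using RDirProd_iso_cong[OF _ B5] unfolding listed_product_def by blast
    qed
  next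
    case False
    then have B4: "card (carrier B) = 4" "card (nonunits B) = 2" using sB by auto
    obtain z where z: "z \<in> nonunits B" "z \<noteq> \<zero>\<^bsub>B\<^esub>"
      using False zero_nonunit[OF B(1,3)] by blast
    have zc: "z \<in> carrier B" using z(1) by (simp add: nonunits_def)
    have "PIdl\<^bsub>B\<^esub> z \<subseteq> carrier B" using cgenideal_nonunits[OF B(1) z(1)] by (auto simp: nonunits_def)
    then have "card {\<zero>\<^bsub>B\<^esub>, z} \<le> card (PIdl\<^bsub>B\<^esub> z)"
      using card_mono[OF finite_subset[OF _ B(2)] zero_mem_cgenideal[OF B(1) zc]] by blast
    then have "card (carrier A) * 2 \<le> card (carrier A) * card (PIdl\<^bsub>B\<^esub> z)" using z(2) by simp
    \<comment> \<open>In particular the first factor cannot have order 4, so it is a field and at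
      most one factor has nonzero nonunits.\<close>
    then have a3: "card (carrier A) \<le> 3" using bound[OF z(1)] by linarith
    then have nA: "nonunits A = {\<zero>\<^bsub>A\<^esub>}" using sA by auto
    have "card (carrier A) \<noteq> 2"
    proof
      assume 2: "card (carrier A) = 2"
      \<comment> \<open>Here the regions have two elements each: two copies of
        \<open>K\<^sub>4\<close> sharing an edge.\<close>
      have "embeds_in (upper_ideal_relation_graph (RDirProd A B)) two_sphere"
        by (rule embeds_product_with_field[OF A(1,2) nA B(1,2) planar_cliques(3,4) _ _ embeds_planar_graph])
          (auto simp: 2 B4)
      then show False using cc by blast
    qed
    then have "card (carrier A) = 3" using sA a3 by auto
    then have A3: "A \<simeq> residue_ring 3" using prime_card_iso_residue_ring[OF A(1), of 3] by simp
    consider "B \<simeq> residue_ring 4" | "B \<simeq> dual_numbers_Z2"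
      using card_4_nonfield_iso[OF B(1) B4(1) B(4) B4(2)] by blast
    then show ?thesis
    proof cases
      case 1
      then show ?thesis using RDirProd_iso_cong[OF A3] unfolding listed_product_def by blast
    next
      case 2
      have "dual_numbers_Z2 \<simeq> Z2_X_mod_X_squared"
        by (rule ring_iso_sym[OF cring.axioms(1)[OF Z2_X_mod_X_squared_iso(1)] Z2_X_mod_X_squared_iso(2)])
      with 2 have "B \<simeq> Z2_X_mod_X_squared" by (rule is_ring_iso_trans)
      then show ?thesis using RDirProd_iso_cong[OF A3] unfolding listed_product_def by blast
    qed
  qed
qed

lemma listed_if_crosscap_one:
  fixes R :: "('a, 'b) ring_scheme"
  assumes R: "cring R" "finite (carrier R)" "\<not> local_ring R" and cc: "crosscap_one R"
  shows "listed_product R"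
proof -
  interpret cring R by fact
  \<comment> \<open>The zero ring has no maximal ideal and so counts as non-local. Its only element
    is a unit, its graph is empty, and the empty graph lies on the sphere.\<close>
  have one: "\<one>\<^bsub>R\<^esub> \<noteq> \<zero>\<^bsub>R\<^esub>"
  proof
    assume 0: "\<one>\<^bsub>R\<^esub> = \<zero>\<^bsub>R\<^esub>"
    have "r \<otimes>\<^bsub>R\<^esub> x = \<one>\<^bsub>R\<^esub>" if "r \<in> carrier R" "x \<in> carrier R" for r x
      using one_zeroD[OF 0] 0 m_closed[OF that] by simp
    then have "nonunits R = {}" unfolding set_eq_iff nonunits_iff[OF R(1)] by blast
    then have "fst (upper_ideal_relation_graph R) = {}" "snd (upper_ideal_relation_graph R) = {}"
      unfolding upper_ideal_relation_graph_def by auto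
    then have "embeds_in (upper_ideal_relation_graph R) two_sphere"
      by (intro embeds_in_mono[OF embeds_planar_graph, where f = "\<lambda>_. 0"]) auto
    then show False using cc by blast
  qed
  have "\<not> trivial_idempotents R"
    using local_ring_if_trivial_idempotents[OF R(1,2) _ one] R(3) by blast
  then obtain A B :: "'a ring" where A: "cring A" "finite (carrier A)" "\<one>\<^bsub>A\<^esub> \<noteq> \<zero>\<^bsub>A\<^esub>"
    and B: "cring B" "finite (carrier B)" "\<one>\<^bsub>B\<^esub> \<noteq> \<zero>\<^bsub>B\<^esub>" and iso: "R \<simeq> RDirProd A B"
    using nontrivial_decomposition[OF R(1,2)] by metis
  have AB: "crosscap_one (RDirProd A B)"
    using crosscap_one_iso[OF R(1) RDirProd_cring[OF A(1) B(1)] iso] cc by blast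
  have BA: "crosscap_one (RDirProd B A)"
    using crosscap_one_iso[OF RDirProd_cring[OF A(1) B(1)] RDirProd_cring[OF B(1) A(1)] RDirProd_iso_commute] AB by blast
  \<comment> \<open>A nontrivial idempotent in a factor would split the ring into three nonzero
    factors.\<close>
  have triv: "trivial_idempotents D"
    if D: "cring D" "finite (carrier D)" and E: "cring E" "finite (carrier E)" "\<one>\<^bsub>E\<^esub> \<noteq> \<zero>\<^bsub>E\<^esub>"
      and DE: "crosscap_one (RDirProd D E)" for D E :: "'a ring"
  proof (rule ccontr)
    assume "\<not> trivial_idempotents D"
    then obtain F G :: "'a ring" where F: "cring F" "finite (carrier F)" "\<one>\<^bsub>F\<^esub> \<noteq> \<zero>\<^bsub>F\<^esub>"
      and G: "cring G" "finite (carrier G)" "\<one>\<^bsub>G\<^esub> \<noteq> \<zero>\<^bsub>G\<^esub>" and FG: "D \<simeq> RDirProd F G"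
      using nontrivial_decomposition[OF D] by metis
    have "RDirProd D E \<simeq> RDirProd F (RDirProd G E)"
      using RDirProd_iso_cong[OF FG ring_iso_refl] RDirProd_iso_assoc by (rule is_ring_iso_trans)
    then have "crosscap_one (RDirProd F (RDirProd G E))"
      using crosscap_one_iso[OF RDirProd_cring[OF D(1) E(1)] RDirProd_cring[OF F(1) RDirProd_cring[OF G(1) E(1)]]] DE by blast
    then show False using not_crosscap_one_three_factors[OF F G E] by blast
  qed
  have tA: "trivial_idempotents A" by (rule triv[OF A(1,2) B AB])
  have tB: "trivial_idempotents B" by (rule triv[OF B(1,2) A BA])
  have pos: "card (nonunits D) \<ge> 1" if "cring D" "finite (carrier D)" "\<one>\<^bsub>D\<^esub> \<noteq> \<zero>\<^bsub>D\<^esub>" for D :: "'a ring"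
  proof -
    have "finite (nonunits D)" using that(2) by (simp add: nonunits_def)
    then show ?thesis using zero_nonunit[OF that(1,3)] by (auto simp: Suc_le_eq card_gt_0_iff)
  qed
  \<comment> \<open>If the numbers of nonunits differ, the larger exceeds 1, since zero is always a
    nonunit, and the condition on the orders is void; if they agree, the orders of the rings
    decide.\<close>
  have "(card (nonunits A) \<le> card (nonunits B) \<and> (card (nonunits B) = 1 \<longrightarrow> card (carrier A) \<le> card (carrier B))) \<or>
    (card (nonunits B) \<le> card (nonunits A) \<and> (card (nonunits A) = 1 \<longrightarrow> card (carrier B) \<le> card (carrier A)))"
    using pos[OF A] pos[OF B] by linarith
  then consider "card (nonunits A) \<le> card (nonunits B)" "card (nonunits B) = 1 \<Longrightarrow> card (carrier A) \<le> card (carrier B)"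
    | "card (nonunits B) \<le> card (nonunits A)" "card (nonunits A) = 1 \<Longrightarrow> card (carrier B) \<le> card (carrier A)"
    by blast
  then have "listed_product (RDirProd A B)"
  proof cases
    case 1
    show ?thesis by (rule two_factors_classification[OF A tA B tB AB 1])
  next
    case 2
    show ?thesis
      by (rule listed_product_iso[OF RDirProd_iso_commute two_factors_classification[OF B tB A tA BA 2]])
  qed
  then show ?thesis using listed_product_iso[OF iso] by blast
qed

theorem theorem4p9:
  fixes R :: "('a, 'b) ring_scheme"
  assumes "cring R" and "finite (carrier R)" and "\<not> local_ring R"
  shows "crosscap (upper_ideal_relation_graph R) = 1 \<longleftrightarrow>
    is_ring_iso R (RDirProd (residue_ring 2) (residue_ring 5)) \<or>
    is_ring_iso R (RDirProd (residue_ring 3) (residue_ring 5)) \<or>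
    (\<exists>F :: nat ring. field F \<and> card (carrier F) = 4 \<and> is_ring_iso R (RDirProd F (residue_ring 5))) \<or>
    is_ring_iso R (RDirProd (residue_ring 3) (residue_ring 4)) \<or>
    is_ring_iso R (RDirProd (residue_ring 3) Z2_X_mod_X_squared)"
  unfolding crosscap_eq_1_iff listed_product_def[symmetric]
  using listed_if_crosscap_one[OF assms] crosscap_one_listed[OF assms(1)] by blast

end
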